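(* Let $U\subset\mathbb{R}^n$ be open. For any symbols $\sigma_0,\dots,\sigma_{2n}\in CS^0_{\rm com}(U)$, $$\chi_{2n}^{\rm res}(\sigma_0,\dots,\sigma_{2n})=\mathrm{res}\left(\sigma_0\,d\sigma_1\wedge\cdots\wedge d\sigma_{2n}\right)=\int_{S^*U}j^*\iota_X\left(\sigma_0^L\,d\sigma_1^L\wedge\cdots\wedge d\sigma_{2n}^L\right)$$ $$=\frac{(-i)^n}{n!}\,A\left[\mathrm{res}\left(\sigma_0\,\theta(\sigma_1,\sigma_2)\cdots\theta(\sigma_{2n-1},\sigma_{2n})\right)\right],$$ where $\chi_{2n}^{\rm res}(\sigma_0,\dots,\sigma_{2n})=\mathrm{res}\left(\sigma_0\ast d\sigma_1\wedge_\ast\cdots\wedge_\ast d\sigma_{2n}\right)$.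
   Context: $U\subset\mathbb{R}^n$ is open, $T^*U=U\times\mathbb{R}^n$ with coordinates $(x,\xi)$, $|\xi|$ is the Euclidean norm. Fix a smooth function $\chi$ on $T^*U$ with $\chi=0$ for $|\xi|\le 1/2$ and $\chi=1$ for $|\xi|\ge 1$. A symbol $\sigma$ is classical of order $m\in\mathbb{C}$ if for every positive integer $N$, $\sigma=\sum_{i=0}^N\chi\,\sigma_{m-i}+\sigma_{(N)}$ with $\sigma_{m-i}$ positively homogeneous of degree $m-i$ in $\xi\ne0$ and $\sigma_{(N)}$ a symbol of order $m-N-1$ (i.e. $\mathrm{Re}(m)-N-1$). $CS^m_{\rm com}(U)$ is the set of classical symbols of order $m$ with compact support in $x\in U$, and $CS_{\rm com}(U)$ is the algebra generated by them over all $m\in\mathbb C$. For $\sigma\in CS^0_{\rm com}(U)$, $\sigma^L$ denotes its leading symbol (homogeneous component of degree $0$). The left product $\ast$ is the symbol product corresponding to composition of pseudodifferential operators, with $\sigma\ast\sigma'\sim\sum_{k\ge0}(-i)^k\sum_{|\alpha|=k}\frac1{\alpha!}\partial_\xi^\alpha\sigma\,\partial_x^\alpha\sigma'$. On forms with coefficients in $CS_{\rm com}(U)$, $(a\,dx_I\wedge d\xi_J)\wedge_\ast(b\,dx_K\wedge d\xi_L)=(a\ast b)\,dx_I\wedge d\xi_J\wedge dx_K\wedge d\xi_L$; $d$ is the exterior differential on $T^*U$. Set $\theta(a,b)=a\ast b-a\cdot b$, where $\cdot$ is the pointwise product. $A$ denotes the (unnormalised) antisymmetrisation over all but the first variable: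 $A[\varphi](\sigma_0,\dots,\sigma_{2n})=\sum_{\tau\in S_{2n}}\mathrm{sgn}(\tau)\,\varphi(\sigma_0,\sigma_{\tau(1)},\dots,\sigma_{\tau(2n)})$. Residue: for $f\in CS_{\rm com}(U)$, $\mathrm{res}(f)=\int_U\int_{|\xi|=1}f_{-n}(x,\xi)\,d_S\xi\,dx$, where $f_{-n}$ is the homogeneous component of degree $-n$ and $d_S\xi=\sum_i(-1)^{i+1}\xi_i\,d\xi_1\wedge\cdots\wedge\widehat{d\xi_i}\wedge\cdots\wedge d\xi_n$. For a symbol valued form, $\mathrm{res}\left(\sum_{I,J}\alpha_{I,J}\,dx_I\wedge d\xi_J\right)=\mathrm{res}(\alpha_{I,J})$ with $|I|=|J|=n$ (i.e. the coefficient of $dx_1\wedge\cdots\wedge dx_n\wedge d\xi_1\wedge\cdots\wedge d\xi_n$), all other terms contributing $0$. $X=\sum_i\xi_i\,\partial/\partial\xi_i$ is the Liouville (radial) field, $\iota_X$ the interior product, $S^*U=\{|\xi|=1\}$, and $j:S^*U\to T^*U\setminus\{0\}$ is the inclusion; $S^*U$ is oriented as the boundary of $\{|\xi|\le1\}$ in $T^*U$ oriented by $dx_1\wedge\cdots\wedge dx_n\wedge d\xi_1\wedge\cdots\wedge d\xi_n$. *)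

theory Defs
  imports "HOL-Analysis.Analysis"
begin

section \<open>Smooth functions\<close>

fun dderivs :: "'a::real_normed_vector list \<Rightarrow> ('a \<Rightarrow> complex) \<Rightarrow> 'a \<Rightarrow> complex" where
  "dderivs [] f = f"
| "dderivs (v # vs) f = (\<lambda>z. frechet_derivative (dderivs vs f) (at z) v)"

text \<open>On an open set this is \<open>C\<^sup>\<infinity>\<close>: all iterated directional derivatives exist and are
  Frechet differentiable, in particular continuous.\<close>

definition smooth_on :: "'a::real_normed_vector set \<Rightarrow> ('a \<Rightarrow> complex) \<Rightarrow> bool" where
  "smooth_on S f \<longleftrightarrow> (\<forall>vs. \<forall>z\<in>S. dderivs vs f differentiable (at z))"


section \<open>Classical symbols\<close>

text \<open>A point of the cotangent space is a pair \<open>(x, \<xi>)\<close>. Symbols are total functions of which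
  only the values over \<open>U\<close> matter.\<close>

type_synonym 'n tpoint = "(real ^ 'n) \<times> (real ^ 'n)"
type_synonym 'n symb = "'n tpoint \<Rightarrow> complex"

definition cotangent :: "(real ^ 'n) set \<Rightarrow> 'n tpoint set" where
  "cotangent U = U \<times> UNIV"

definition cotangent0 :: "(real ^ 'n) set \<Rightarrow> 'n tpoint set" where
  "cotangent0 U = U \<times> (- {0})"

definition cutoff :: "(real ^ 'n::finite) set \<Rightarrow> 'n symb \<Rightarrow> bool" where
  "cutoff U \<psi> \<longleftrightarrow> smooth_on (cotangent U) \<psi> \<and>
     (\<forall>x\<in>U. \<forall>\<xi>. (norm \<xi> \<le> 1/2 \<longrightarrow> \<psi> (x, \<xi>) = 0) \<and> (1 \<le> norm \<xi> \<longrightarrow> \<psi> (x, \<xi>) = 1))"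

text \<open>The lists \<open>I\<close> and \<open>J\<close> of coordinate directions play the role of the multi-indices in
  \<open>\<partial>\<^sub>x\<^sup>\<alpha> \<partial>\<^sub>\<xi>\<^sup>\<beta>\<close>, so \<open>length J\<close> is \<open>|\<beta>|\<close>.\<close>

definition is_symbol :: "(real ^ 'n::finite) set \<Rightarrow> real \<Rightarrow> 'n symb \<Rightarrow> bool" where
  "is_symbol U r \<sigma> \<longleftrightarrow> smooth_on (cotangent U) \<sigma> \<and>
     (\<forall>K I J. compact K \<and> K \<subseteq> U \<longrightarrow>
       (\<exists>C. \<forall>x\<in>K. \<forall>\<xi>.
          norm (dderivs (map (\<lambda>i. (axis i 1, 0)) I @ map (\<lambda>j. (0, axis j 1)) J) \<sigma> (x, \<xi>))
            \<le> C * (1 + norm \<xi>) powr (r - real (length J))))"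

definition pos_homogeneous :: "(real ^ 'n::finite) set \<Rightarrow> complex \<Rightarrow> 'n symb \<Rightarrow> bool" where
  "pos_homogeneous U d g \<longleftrightarrow> smooth_on (cotangent0 U) g \<and>
     (\<forall>x\<in>U. \<forall>\<xi>. \<forall>t>0. \<xi> \<noteq> 0 \<longrightarrow> g (x, t *\<^sub>R \<xi>) = of_real t powr d * g (x, \<xi>))"

text \<open>\<open>s i\<close> is the component of degree \<open>m - i\<close>.\<close>

definition classical_expansion ::
    "'n symb \<Rightarrow> (real ^ 'n::finite) set \<Rightarrow> complex \<Rightarrow> 'n symb \<Rightarrow> (nat \<Rightarrow> 'n symb) \<Rightarrow> bool" where
  "classical_expansion \<psi> U m \<sigma> s \<longleftrightarrow>
     (\<forall>i. pos_homogeneous U (m - of_nat i) (s i)) \<and>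
     (\<forall>N\<ge>1. is_symbol U (Re m - real N - 1) (\<lambda>z. \<sigma> z - (\<Sum>i\<le>N. \<psi> z * s i z)))"

definition compact_x_support :: "(real ^ 'n) set \<Rightarrow> 'n symb \<Rightarrow> bool" where
  "compact_x_support U \<sigma> \<longleftrightarrow>
     (\<exists>K. compact K \<and> K \<subseteq> U \<and> (\<forall>x\<in>U - K. \<forall>\<xi>. \<sigma> (x, \<xi>) = 0))"

definition CS_com :: "'n symb \<Rightarrow> (real ^ 'n::finite) set \<Rightarrow> complex \<Rightarrow> 'n symb set" where
  "CS_com \<psi> U m = {\<sigma>. is_symbol U (Re m) \<sigma> \<and> (\<exists>s. classical_expansion \<psi> U m \<sigma> s) \<and>
     compact_x_support U \<sigma>}"

text \<open>Homogeneous component of degree \<open>d\<close> of an element \<open>f\<close> of the algebra generated by all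
  \<open>CS_com \<psi> U m\<close>. The product of symbols in \<open>CS_com \<psi> U m\<close> and \<open>CS_com \<psi> U m'\<close> is in
  \<open>CS_com \<psi> U (m + m')\<close>, so the elements of that algebra are the finite sums
  \<open>f = f\<^sub>0 + \<dots> + f\<^sub>k\<close> with \<open>f\<^sub>j\<close> classical of order \<open>m\<^sub>j\<close>, and the component of \<open>f\<close> is the sum of
  the components of the \<open>f\<^sub>j\<close>. The inner sum below has at most one term. The component is set to
  \<open>0\<close> where it is not meaningful, to make it unique as a total function.\<close>

definition is_hom_component ::
    "'n symb \<Rightarrow> (real ^ 'n::finite) set \<Rightarrow> complex \<Rightarrow> 'n symb \<Rightarrow> 'n symb \<Rightarrow> bool" where
  "is_hom_component \<psi> U d f g \<longleftrightarrow>
     (\<exists>(k::nat) m fs s.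
        (\<forall>j<k. fs j \<in> CS_com \<psi> U (m j) \<and> classical_expansion \<psi> U (m j) (fs j) (s j)) \<and>
        (\<forall>z\<in>cotangent U. f z = (\<Sum>j<k. fs j z)) \<and>
        (\<forall>z\<in>cotangent0 U. g z = (\<Sum>j<k. \<Sum>i | m j - of_nat i = d. s j i z)) \<and>
        (\<forall>z. z \<notin> cotangent0 U \<longrightarrow> g z = 0))"

definition hom_component ::
    "'n symb \<Rightarrow> (real ^ 'n::finite) set \<Rightarrow> complex \<Rightarrow> 'n symb \<Rightarrow> 'n symb" where
  "hom_component \<psi> U d f = (THE g. is_hom_component \<psi> U d f g)"

abbreviation leading_symbol :: "'n symb \<Rightarrow> (real ^ 'n::finite) set \<Rightarrow> 'n symb \<Rightarrow> 'n symb" where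
  "leading_symbol \<psi> U \<sigma> \<equiv> hom_component \<psi> U 0 \<sigma>"


section \<open>The left product\<close>

text \<open>\<open>Op(a) u (x) = (2\<pi>)\<^sup>-\<^sup>n \<integral> exp(i x\<cdot>\<eta>) a(x,\<eta>) u\<^sup>^(\<eta>) d\<eta>\<close> for \<open>u\<close> supported in \<open>U\<close>.\<close>

definition Op :: "(real ^ 'n::finite) set \<Rightarrow> 'n symb \<Rightarrow> (real ^ 'n \<Rightarrow> complex) \<Rightarrow> real ^ 'n \<Rightarrow> complex"
  where
  "Op U a u x = (LINT \<eta>|lborel. cis (x \<bullet> \<eta>) * a (x, \<eta>) * (LINT y:U|lborel. cis (- (y \<bullet> \<eta>)) * u y))
     / of_real ((2 * pi) ^ CARD('n))"

text \<open>The symbol of an operator \<open>C\<close> at \<open>(x,\<xi>)\<close> is \<open>exp(-i x\<cdot>\<xi>) (C e\<^sub>\<xi>)(x)\<close> with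
  \<open>e\<^sub>\<xi>(y) = exp(i y\<cdot>\<xi>)\<close>. For \<open>C = Op(a) Op(b)\<close> one has \<open>Op(b) e\<^sub>\<xi> = e\<^sub>\<xi> b(\<cdot>,\<xi>)\<close>, which gives the
  symbol of the composition. Substituting \<open>\<eta> = \<xi> + \<zeta>\<close> and expanding \<open>a(x,\<xi> + \<zeta>)\<close> in \<open>\<zeta>\<close> yields
  \<open>\<Sum>\<^sub>\<alpha> (-i)\<^sup>|\<^sup>\<alpha>\<^sup>| \<partial>\<^sub>\<xi>\<^sup>\<alpha>a \<partial>\<^sub>x\<^sup>\<alpha>b / \<alpha>!\<close>.\<close>

definition star :: "(real ^ 'n::finite) set \<Rightarrow> 'n symb \<Rightarrow> 'n symb \<Rightarrow> 'n symb" where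
  "star U a b = (\<lambda>(x, \<xi>). cis (- (x \<bullet> \<xi>)) * Op U a (\<lambda>y. cis (y \<bullet> \<xi>) * b (y, \<xi>)) x)"

definition theta :: "(real ^ 'n::finite) set \<Rightarrow> 'n symb \<Rightarrow> 'n symb \<Rightarrow> 'n symb" where
  "theta U a b = (\<lambda>z. star U a b z - a z * b z)"


section \<open>Differential forms\<close>

text \<open>A \<open>p\<close>-form sends a point and \<open>p\<close> tangent vectors \<open>v 0, \<dots>, v (p - 1)\<close> to a number; the
  remaining entries of \<open>v\<close> are ignored. The degree is not part of the type.\<close>

type_synonym 'a form = "'a \<Rightarrow> (nat \<Rightarrow> 'a) \<Rightarrow> complex"

text \<open>The wedge product of a \<open>p\<close>-form and a \<open>q\<close>-form relative to a product \<open>prd\<close> of functions: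
  the usual formula, in which the values on constant vector fields are multiplied by \<open>prd\<close>.\<close>

definition wedge_with ::
    "(('a \<Rightarrow> complex) \<Rightarrow> ('a \<Rightarrow> complex) \<Rightarrow> 'a \<Rightarrow> complex) \<Rightarrow> nat \<Rightarrow> nat \<Rightarrow> 'a form \<Rightarrow> 'a form \<Rightarrow> 'a form"
  where
  "wedge_with prd p q \<alpha> \<beta> = (\<lambda>z v.
     (\<Sum>\<pi> | \<pi> permutes {..<p + q}. of_int (sign \<pi>) *
        prd (\<lambda>w. \<alpha> w (\<lambda>k. v (\<pi> k))) (\<lambda>w. \<beta> w (\<lambda>k. v (\<pi> (p + k)))) z)
     / (fact p * fact q))"

definition pw_mult :: "('a \<Rightarrow> complex) \<Rightarrow> ('a \<Rightarrow> complex) \<Rightarrow> 'a \<Rightarrow> complex" where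
  "pw_mult f g = (\<lambda>z. f z * g z)"

text \<open>\<open>f \<omega>\<^sub>0 \<and> \<dots> \<and> \<omega>\<^sub>p\<^sub>-\<^sub>1\<close> for 1-forms \<open>\<omega>\<^sub>k\<close>\<close>

primrec iterated_wedge ::
    "(('a \<Rightarrow> complex) \<Rightarrow> ('a \<Rightarrow> complex) \<Rightarrow> 'a \<Rightarrow> complex) \<Rightarrow> ('a \<Rightarrow> complex) \<Rightarrow> (nat \<Rightarrow> 'a form) \<Rightarrow>
     nat \<Rightarrow> 'a form" where
  "iterated_wedge prd f \<omega> 0 = (\<lambda>z v. f z)"
| "iterated_wedge prd f \<omega> (Suc p) = wedge_with prd p 1 (iterated_wedge prd f \<omega> p) (\<omega> p)"

definition diff_form :: "('a::real_normed_vector \<Rightarrow> complex) \<Rightarrow> 'a form" where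
  "diff_form f = (\<lambda>z v. frechet_derivative f (at z) (v 0))"

definition interior_product :: "('a \<Rightarrow> 'a) \<Rightarrow> 'a form \<Rightarrow> 'a form" where
  "interior_product X \<omega> = (\<lambda>z v. \<omega> z (case_nat (X z) v))"

definition liouville :: "'n tpoint \<Rightarrow> 'n::finite tpoint" where
  "liouville = (\<lambda>(x, \<xi>). (0, \<xi>))"

lemma star_scale:
  "star U (\<lambda>z. a z * c) (\<lambda>z. b z * c') z = star U a b z * (c * c')"
proof (cases z)
  case (Pair x \<xi>)
  have "(LINT y:U|lborel. cis (- (y \<bullet> \<eta>)) * (cis (y \<bullet> \<xi>) * (b (y, \<xi>) * c')))
      = (LINT y:U|lborel. cis (- (y \<bullet> \<eta>)) * (cis (y \<bullet> \<xi>) * b (y, \<xi>))) * c'" for \<eta>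
    unfolding set_lebesgue_integral_def
    by (simp flip: integral_mult_left_zero mult_scaleR_left add: mult.assoc)
  then have "(LINT \<eta>|lborel. cis (x \<bullet> \<eta>) * (a (x, \<eta>) * c) *
        (LINT y:U|lborel. cis (- (y \<bullet> \<eta>)) * (cis (y \<bullet> \<xi>) * (b (y, \<xi>) * c'))))
      = (LINT \<eta>|lborel. cis (x \<bullet> \<eta>) * a (x, \<eta>) *
        (LINT y:U|lborel. cis (- (y \<bullet> \<eta>)) * (cis (y \<bullet> \<xi>) * b (y, \<xi>)))) * (c * c')"
    by (simp flip: integral_mult_left_zero add: mult_ac)
  then show ?thesis
    by (simp add: Pair star_def Op_def)
qed

text \<open>For \<open>\<gamma>\<close> and \<open>\<gamma>'\<close> with constant coefficients, e.g. \<open>\<gamma> = dx\<^sub>I \<and> d\<xi>\<^sub>J\<close> and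
  \<open>\<gamma>' = dx\<^sub>K \<and> d\<xi>\<^sub>L\<close>: the product of \<open>a \<gamma>\<close> and \<open>b \<gamma>'\<close> is \<open>(a * b) \<gamma> \<and> \<gamma>'\<close>.\<close>

lemma wedge_star_monomial:
  "wedge_with (star U) p q (\<lambda>z v. a z * \<gamma> v) (\<lambda>z v. b z * \<gamma>' v) z v =
     star U a b z * wedge_with pw_mult p q (\<lambda>z. \<gamma>) (\<lambda>z. \<gamma>') z v"
  by (simp add: wedge_with_def star_scale pw_mult_def sum_distrib_left mult_ac)


section \<open>Integration over oriented hypersurfaces\<close>

text \<open>The orientation of an \<open>N\<close>-dimensional space is given by an ordered orthonormal basis
  \<open>b 0, \<dots>, b (N - 1)\<close>.\<close>

definition det_form :: "(nat \<Rightarrow> 'a::euclidean_space) \<Rightarrow> (nat \<Rightarrow> 'a) \<Rightarrow> real" where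
  "det_form b v = (\<Sum>\<pi> | \<pi> permutes {..<DIM('a)}.
     of_int (sign \<pi>) * (\<Prod>k<DIM('a). v (\<pi> k) \<bullet> b k))"

text \<open>Orthonormal frames of the tangent space of a hypersurface with unit normal \<open>\<nu>\<close>\<close>

definition tangent_frame :: "'a::euclidean_space \<Rightarrow> (nat \<Rightarrow> 'a) \<Rightarrow> bool" where
  "tangent_frame \<nu> e \<longleftrightarrow>
     (\<forall>j<DIM('a) - 1. \<forall>k<DIM('a) - 1. e j \<bullet> e k = (if j = k then 1 else 0)) \<and>
     (\<forall>k<DIM('a) - 1. e k \<bullet> \<nu> = 0)"

text \<open>Integral over \<open>M\<close> of the pullback to \<open>M\<close> of an \<open>(N - 1)\<close>-form \<open>\<omega>\<close>, where \<open>\<mu>\<close> is the surface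
  measure and \<open>\<nu>\<close> the outward unit normal. The pullback is the restriction to tangent vectors of
  \<open>M\<close>. The determinant is \<open>1\<close> or \<open>-1\<close>: the sign of the frame \<open>e\<close> for the boundary orientation
  (outward normal first). The integrand does not depend on the choice of \<open>e\<close>. For \<open>N = 1\<close> the
  frame is empty and the determinant is the sign of the point.\<close>

definition hypersurface_integral ::
    "(nat \<Rightarrow> 'a::euclidean_space) \<Rightarrow> 'a set \<Rightarrow> 'a measure \<Rightarrow> ('a \<Rightarrow> 'a) \<Rightarrow> 'a form \<Rightarrow> complex" where
  "hypersurface_integral b M \<mu> \<nu> \<omega> =
     (LINT z:M|\<mu>. let e = (SOME e. tangent_frame (\<nu> z) e)
        in of_real (det_form b (case_nat (\<nu> z) e)) * \<omega> z e)"

text \<open>Surface measure of the unit sphere: \<open>A\<close> has measure \<open>N\<close> times the volume of the cone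
  \<open>{t \<xi> | 0 < t \<le> 1, \<xi> \<in> A}\<close>.\<close>

definition sphere_measure :: "'a::euclidean_space measure" where
  "sphere_measure =
     distr (density lborel (\<lambda>\<xi>. of_nat DIM('a) * indicator (cball 0 1) \<xi>)) borel sgn"

text \<open>The coordinates are numbered by \<open>0, \<dots>, n - 1\<close> through a fixed bijection onto \<open>'n\<close>.\<close>

definition coord :: "nat \<Rightarrow> 'n::finite" where
  "coord = from_nat_into UNIV"

lemma bij_betw_coord: "bij_betw (coord :: nat \<Rightarrow> 'n::finite) {..<CARD('n)} UNIV"
  unfolding coord_def by (rule bij_betw_from_nat_into_finite) simp

definition std_frame :: "nat \<Rightarrow> real ^ 'n::finite" where
  "std_frame k = axis (coord k) 1"

text \<open>\<open>\<partial>/\<partial>x\<^sub>1, \<dots>, \<partial>/\<partial>x\<^sub>n, \<partial>/\<partial>\<xi>\<^sub>1, \<dots>, \<partial>/\<partial>\<xi>\<^sub>n\<close>\<close>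

definition cotangent_frame :: "nat \<Rightarrow> 'n::finite tpoint" where
  "cotangent_frame k =
     (if k < CARD('n) then (std_frame k, 0) else (0, std_frame (k - CARD('n))))"

text \<open>\<open>S\<^sup>*U\<close> is the boundary of \<open>{|\<xi>| \<le> 1}\<close>, with outward unit normal \<open>(0, \<xi>)\<close> at \<open>(x, \<xi>)\<close>.\<close>

definition cosphere_integral :: "(real ^ 'n::finite) set \<Rightarrow> 'n tpoint form \<Rightarrow> complex" where
  "cosphere_integral U \<omega> =
     hypersurface_integral cotangent_frame (U \<times> sphere 0 1) (lborel \<Otimes>\<^sub>M sphere_measure)
       (\<lambda>(x, \<xi>). (0, \<xi>)) \<omega>"


section \<open>The residue\<close>

text \<open>\<open>d\<^sub>S\<xi>\<close>; coordinates are numbered from \<open>0\<close>, so the sign is \<open>(-1)\<^sup>i\<close>.\<close>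

definition dS :: "(real ^ 'n::finite) form" where
  "dS = (\<lambda>\<xi> v. \<Sum>i<CARD('n). (-1) ^ i * of_real (\<xi> $ coord i) *
     iterated_wedge pw_mult (\<lambda>_. 1)
       (\<lambda>k _ w. of_real (w 0 $ coord (if k < i then k else Suc k))) (CARD('n) - 1) \<xi> v)"

definition res :: "'n symb \<Rightarrow> (real ^ 'n::finite) set \<Rightarrow> 'n symb \<Rightarrow> complex" where
  "res \<psi> U f = (LINT x:U|lborel.
     hypersurface_integral std_frame (sphere 0 1) sphere_measure (\<lambda>\<xi>. \<xi>)
       (\<lambda>\<xi> v. hom_component \<psi> U (- of_nat CARD('n)) f (x, \<xi>) * dS \<xi> v))"

text \<open>For a \<open>2n\<close>-form; its value on the coordinate frame is the coefficient of
  \<open>dx\<^sub>1 \<and> \<dots> \<and> dx\<^sub>n \<and> d\<xi>\<^sub>1 \<and> \<dots> \<and> d\<xi>\<^sub>n\<close>.\<close>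

definition res_form :: "'n symb \<Rightarrow> (real ^ 'n::finite) set \<Rightarrow> 'n tpoint form \<Rightarrow> complex" where
  "res_form \<psi> U \<omega> = res \<psi> U (\<lambda>z. \<omega> z cotangent_frame)"

definition chi_res :: "'n symb \<Rightarrow> (real ^ 'n::finite) set \<Rightarrow> (nat \<Rightarrow> 'n symb) \<Rightarrow> complex" where
  "chi_res \<psi> U \<sigma> = res_form \<psi> U
     (iterated_wedge (star U) (\<sigma> 0) (\<lambda>k. diff_form (\<sigma> (Suc k))) (2 * CARD('n)))"

text \<open>A permutation of \<open>{1..N}\<close> fixes \<open>0\<close>.\<close>

definition antisymmetrise :: "nat \<Rightarrow> ((nat \<Rightarrow> 'b) \<Rightarrow> complex) \<Rightarrow> (nat \<Rightarrow> 'b) \<Rightarrow> complex" where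
  "antisymmetrise N \<phi> \<sigma> = (\<Sum>\<tau> | \<tau> permutes {1..N}. of_int (sign \<tau>) * \<phi> (\<lambda>k. \<sigma> (\<tau> k)))"

end

theory Submission
  imports Defs "HOL-Probability.Sinc_Integral" "HOL-Probability.Characteristic_Functions"
    "Jordan_Normal_Form.Determinant"
begin

text \<open>All four expressions vanish. The leading symbols \<open>\<sigma>\<^sub>k\<^sup>L\<close> are homogeneous of degree \<open>0\<close>, so the Liouville
  field \<open>X\<close> is in the kernel of all \<open>d\<sigma>\<^sub>k\<^sup>L\<close>. These are \<open>2n\<close> covectors on a \<open>2n\<close>-dimensional space with a
  common kernel vector, hence \<open>d\<sigma>\<^sub>1\<^sup>L \<and> \<dots> \<and> d\<sigma>\<^sub>2\<^sub>n\<^sup>L = 0\<close> and every determinant of their values is \<open>0\<close>.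
  The four integrands are such determinants, because the symbols under the residue have order \<open>-n\<close>
  and leading symbols \<open>\<sigma>\<^sub>0\<^sup>L \<Prod>\<^sub>k \<partial>\<sigma>\<^sub>k\<^sup>L\<close> with \<open>n\<close> derivatives in \<open>\<xi>\<close> and \<open>n\<close> in \<open>x\<close>. For the left product
  this needs the composition formula: with
  \<open>a * b (x, \<xi>) = (2\<pi>)\<^sup>-\<^sup>n \<integral>\<integral> exp(-i w\<cdot>\<zeta>) a(x, \<xi> + \<zeta>) b(x + w, \<xi>) dw d\<zeta>\<close>
  the remainder of the Taylor expansion of \<open>a\<close> in \<open>\<zeta>\<close> is estimated by Peetre's inequality. Products and
  remainders obey the Leibniz rule, so that estimates of the functions give those of all derivatives.\<close>

section \<open>Calculus of iterated directional derivatives\<close>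

text \<open>Only leading components have to be followed through derivatives, sums and both products,
  since n differentiations in \<xi>, or n factors \<open>theta\<close>, lower the order 0 by exactly
  n. Three obstacles shape the proof. \<open>hom_component\<close> is a definite description over
  all representations as finite sums of classical symbols of arbitrary complex orders, so components
  must first be shown unique; along a ray this is the independence of powers t^d at infinity, where
  exponents with equal real part oscillate and cannot be separated by growth. A component exists
  only for a classical symbol, so the left product needs its complete expansion with estimates of
  all derivatives. Its integral involves a symbol meaningful only over \<open>U\<close>; compact
  support in x permits extension by zero and gives rapid decay in \<zeta>. Finally, in the
  antisymmetrised expression only the signed sum vanishes at each point, not the single terms; the
  sum is moved under the integrals, which requires integrability of each term.\<close>

lemma has_derivative_cong_open:
  assumes "open S" "z \<in> S" "\<And>w. w \<in> S \<Longrightarrow> f w = g w"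
  shows "(f has_derivative D) (at z) \<longleftrightarrow> (g has_derivative D) (at z)"
  using assms has_derivative_transform_within_open[of f D z UNIV S g]
    has_derivative_transform_within_open[of g D z UNIV S f] by auto

lemma frechet_derivative_cong_open:
  assumes "open S" "z \<in> S" "\<And>w. w \<in> S \<Longrightarrow> f w = g w"
  shows "frechet_derivative f (at z) = frechet_derivative g (at z)"
  unfolding frechet_derivative_def using has_derivative_cong_open[OF assms] by simp

lemma differentiable_cong_open:
  assumes "open S" "z \<in> S" "\<And>w. w \<in> S \<Longrightarrow> f w = g w"
  shows "f differentiable (at z) \<longleftrightarrow> g differentiable (at z)"
  unfolding differentiable_def using has_derivative_cong_open[OF assms] by simp

section \<open>Locality of derivatives and smoothness of finite order\<close>

lemma dderivs_append: "dderivs (vs @ ws) f = dderivs vs (dderivs ws f)"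
  by (induction vs) auto

lemma dderivs_cong:
  assumes "open S" "\<And>w. w \<in> S \<Longrightarrow> f w = g w"
  shows "z \<in> S \<Longrightarrow> dderivs vs f z = dderivs vs g z"
proof (induction vs arbitrary: z)
  case (Cons v vs)
  then show ?case
    using frechet_derivative_cong_open[OF assms(1), of z "dderivs vs f" "dderivs vs g"] by simp
qed (use assms in auto)

text \<open>Grading by the number of derivatives permits induction: one derivative of a product is a
  sum of products again, to be differentiated once less.\<close>

definition smooth_upto :: "nat \<Rightarrow> 'a::real_normed_vector set \<Rightarrow> ('a \<Rightarrow> complex) \<Rightarrow> bool" where
  "smooth_upto k S f \<longleftrightarrow> (\<forall>vs. length vs \<le> k \<longrightarrow> (\<forall>z\<in>S. dderivs vs f differentiable (at z)))"

lemma smooth_on_iff_upto: "smooth_on S f \<longleftrightarrow> (\<forall>k. smooth_upto k S f)"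
  unfolding smooth_on_def smooth_upto_def by blast

lemma smooth_upto_mono: "smooth_upto k S f \<Longrightarrow> j \<le> k \<Longrightarrow> smooth_upto j S f"
  unfolding smooth_upto_def by auto

lemma smooth_upto_cong:
  assumes "open S" "\<And>w. w \<in> S \<Longrightarrow> f w = g w" "smooth_upto k S f"
  shows "smooth_upto k S g"
  unfolding smooth_upto_def
proof (intro allI impI ballI)
  fix vs :: "'a list" and z assume *: "length vs \<le> k" "z \<in> S"
  then have "dderivs vs f differentiable (at z)" using assms(3) unfolding smooth_upto_def by blast
  then show "dderivs vs g differentiable (at z)"
    using differentiable_cong_open[OF assms(1) *(2), of "dderivs vs f" "dderivs vs g"]
      dderivs_cong[OF assms(1,2), where vs = vs] by simp
qed

lemma smooth_on_cong:
  assumes "open S" "\<And>w. w \<in> S \<Longrightarrow> f w = g w" "smooth_on S f"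
  shows "smooth_on S g"
  using assms smooth_upto_cong unfolding smooth_on_iff_upto by metis

text \<open>The derivative split off is the innermost one, the last entry of the list, because the
  sum and product rules apply to the function itself and not to an iterated derivative of
  it.\<close>

lemma smooth_upto_Suc:
  "smooth_upto (Suc k) S f \<longleftrightarrow>
    (\<forall>z\<in>S. f differentiable (at z)) \<and> (\<forall>v. smooth_upto k S (dderivs [v] f))" (is "?L \<longleftrightarrow> ?R")
proof
  assume L: ?L
  then have "dderivs [] f differentiable (at z)" if "z \<in> S" for z
    using that unfolding smooth_upto_def by (metis le0 list.size(3))
  moreover have "smooth_upto k S (dderivs [v] f)" for v
    unfolding smooth_upto_def
  proof (intro allI impI ballI)
    fix vs :: "'a list" and z assume *: "length vs \<le> k" "z \<in> S"
    then have "length (vs @ [v]) \<le> Suc k" by simp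
    then have "dderivs (vs @ [v]) f differentiable (at z)"
      using L *(2) unfolding smooth_upto_def by blast
    then show "dderivs vs (dderivs [v] f) differentiable (at z)" by (simp add: dderivs_append)
  qed
  ultimately show ?R by auto
next
  assume R: ?R
  show ?L unfolding smooth_upto_def
  proof (intro allI impI ballI)
    fix vs :: "'a list" and z assume *: "length vs \<le> Suc k" "z \<in> S"
    show "dderivs vs f differentiable (at z)"
    proof (cases vs rule: rev_cases)
      case (snoc ws v)
      then show ?thesis using R * unfolding smooth_upto_def by (simp add: dderivs_append)
    qed (use R * in auto)
  qed
qed

lemma smooth_upto_0: "smooth_upto 0 S f \<longleftrightarrow> (\<forall>z\<in>S. f differentiable (at z))"
  unfolding smooth_upto_def by simp

lemma smooth_on_dderivs: "smooth_on S f \<Longrightarrow> smooth_on S (dderivs vs f)"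
  unfolding smooth_on_def by (simp flip: dderivs_append)

lemma smooth_on_differentiable: "smooth_on S f \<Longrightarrow> z \<in> S \<Longrightarrow> f differentiable (at z)"
  unfolding smooth_on_def by (metis dderivs.simps(1))

lemma smooth_on_continuous: "smooth_on S f \<Longrightarrow> continuous_on S f"
  by (meson continuous_at_imp_continuous_on differentiable_imp_continuous_within
      smooth_on_differentiable)

lemma smooth_on_subset: "smooth_on S f \<Longrightarrow> T \<subseteq> S \<Longrightarrow> smooth_on T f"
  unfolding smooth_on_def by auto

lemma smooth_on_Un: "smooth_on S f \<Longrightarrow> smooth_on T f \<Longrightarrow> smooth_on (S \<union> T) f"
  unfolding smooth_on_def by auto

lemma smooth_on_const_upto: "smooth_upto k S (\<lambda>_. c)"
proof (induction k arbitrary: c)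
  case (Suc k)
  have "dderivs [v] (\<lambda>_::'a. c) = (\<lambda>_. 0)" for v :: 'a by (auto simp: frechet_derivative_const)
  then show ?case unfolding smooth_upto_Suc using Suc by simp
qed (simp add: smooth_upto_0)

lemma smooth_on_const: "smooth_on S (\<lambda>_. c)"
  unfolding smooth_on_iff_upto using smooth_on_const_upto by blast

section \<open>Sums, products and the Leibniz rule\<close>

lemma frechet_derivative_add:
  assumes "f differentiable (at z)" "g differentiable (at z)"
  shows "frechet_derivative (\<lambda>z. f z + g z) (at z) v
    = frechet_derivative f (at z) v + frechet_derivative g (at z) v"
  using has_derivative_add[OF assms[unfolded frechet_derivative_works]] frechet_derivative_at
  by metis

lemma frechet_derivative_mult:
  fixes f g :: "'a::real_normed_vector \<Rightarrow> complex"
  assumes "f differentiable (at z)" "g differentiable (at z)"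
  shows "frechet_derivative (\<lambda>z. f z * g z) (at z) v
    = f z * frechet_derivative g (at z) v + frechet_derivative f (at z) v * g z"
  using has_derivative_mult[OF assms[unfolded frechet_derivative_works]] frechet_derivative_at
  by metis

lemma smooth_upto_add:
  assumes "open S"
  shows "smooth_upto k S f \<Longrightarrow> smooth_upto k S g \<Longrightarrow> smooth_upto k S (\<lambda>z. f z + g z)"
proof (induction k arbitrary: f g)
  case 0 then show ?case by (simp add: smooth_upto_0)
next
  case (Suc k)
  have "smooth_upto k S (dderivs [v] (\<lambda>z. f z + g z))" for v
  proof (rule smooth_upto_cong[OF assms])
    show "smooth_upto k S (\<lambda>z. dderivs [v] f z + dderivs [v] g z)"
      using Suc unfolding smooth_upto_Suc by blast
  qed (use Suc.prems in \<open>simp add: smooth_upto_Suc frechet_derivative_add\<close>)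
  then show ?case using Suc.prems unfolding smooth_upto_Suc by auto
qed

lemma smooth_upto_mult:
  assumes "open S"
  shows "smooth_upto k S f \<Longrightarrow> smooth_upto k S g \<Longrightarrow> smooth_upto k S (\<lambda>z. f z * g z)"
proof (induction k arbitrary: f g)
  case 0 then show ?case by (simp add: smooth_upto_0)
next
  case (Suc k)
  \<comment> \<open>The product rule also contains the undifferentiated factors, which are smooth to
    order \<open>Suc k\<close> but enter to order \<open>k\<close>.\<close>
  have fg: "smooth_upto k S f" "smooth_upto k S g" using Suc.prems smooth_upto_mono by fastforce+
  have "smooth_upto k S (dderivs [v] (\<lambda>z. f z * g z))" for v
  proof (rule smooth_upto_cong[OF assms])
    show "smooth_upto k S (\<lambda>z. f z * dderivs [v] g z + dderivs [v] f z * g z)"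
      using Suc.prems fg unfolding smooth_upto_Suc
      by (intro smooth_upto_add assms Suc.IH) auto
  qed (use Suc.prems in \<open>simp add: smooth_upto_Suc frechet_derivative_mult\<close>)
  then show ?case using Suc.prems unfolding smooth_upto_Suc by auto
qed

lemma smooth_on_add: "open S \<Longrightarrow> smooth_on S f \<Longrightarrow> smooth_on S g \<Longrightarrow> smooth_on S (\<lambda>z. f z + g z)"
  and smooth_on_mult: "open S \<Longrightarrow> smooth_on S f \<Longrightarrow> smooth_on S g \<Longrightarrow> smooth_on S (\<lambda>z. f z * g z)"
  unfolding smooth_on_iff_upto using smooth_upto_add smooth_upto_mult by blast+

lemma smooth_on_cmult: "open S \<Longrightarrow> smooth_on S f \<Longrightarrow> smooth_on S (\<lambda>z. c * f z)"
  by (intro smooth_on_mult smooth_on_const)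

lemma smooth_on_diff: "open S \<Longrightarrow> smooth_on S f \<Longrightarrow> smooth_on S g \<Longrightarrow> smooth_on S (\<lambda>z. f z - g z)"
  using smooth_on_add[of S f "\<lambda>z. - 1 * g z"] smooth_on_cmult[of S g "- 1"] by simp

lemma smooth_on_sum:
  "open S \<Longrightarrow> (\<And>i. i \<in> I \<Longrightarrow> smooth_on S (f i)) \<Longrightarrow> smooth_on S (\<lambda>z. \<Sum>i\<in>I. f i z)"
  by (induction I rule: infinite_finite_induct)
     (simp_all add: smooth_on_const smooth_on_add)

lemma dderivs_1_add:
  "open S \<Longrightarrow> smooth_on S f \<Longrightarrow> smooth_on S g \<Longrightarrow> z \<in> S \<Longrightarrow>
    dderivs [v] (\<lambda>z. f z + g z) z = dderivs [v] f z + dderivs [v] g z"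
  by (simp add: frechet_derivative_add smooth_on_differentiable)

lemma dderivs_1_mult:
  "open S \<Longrightarrow> smooth_on S f \<Longrightarrow> smooth_on S g \<Longrightarrow> z \<in> S \<Longrightarrow>
    dderivs [v] (\<lambda>z. f z * g z) z = dderivs [v] f z * g z + f z * dderivs [v] g z"
  by (simp add: frechet_derivative_mult smooth_on_differentiable)

lemma dderivs_add:
  assumes "open S" "smooth_on S f" "smooth_on S g"
  shows "z \<in> S \<Longrightarrow> dderivs vs (\<lambda>z. f z + g z) z = dderivs vs f z + dderivs vs g z"
proof (induction vs arbitrary: z)
  case (Cons v vs)
  have "dderivs (v # vs) (\<lambda>z. f z + g z) z = dderivs [v] (dderivs vs (\<lambda>z. f z + g z)) z" by simp
  also have "\<dots> = dderivs [v] (\<lambda>z. dderivs vs f z + dderivs vs g z) z"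
    by (rule dderivs_cong[OF assms(1)]) (use Cons in auto)
  also have "\<dots> = dderivs [v] (dderivs vs f) z + dderivs [v] (dderivs vs g) z"
    by (intro dderivs_1_add[OF assms(1)] smooth_on_dderivs assms Cons.prems)
  finally show ?case by simp
qed simp

lemma dderivs_const: "vs \<noteq> [] \<Longrightarrow> dderivs vs (\<lambda>_. c) = (\<lambda>_. 0)"
proof (induction vs)
  case (Cons v vs)
  then show ?case by (cases vs) (auto simp: frechet_derivative_const)
qed simp

lemma dderivs_cmult:
  assumes "open S" "smooth_on S f"
  shows "z \<in> S \<Longrightarrow> dderivs vs (\<lambda>z. c * f z) z = c * dderivs vs f z"
proof (induction vs arbitrary: z)
  case (Cons v vs)
  have "dderivs (v # vs) (\<lambda>z. c * f z) z = dderivs [v] (dderivs vs (\<lambda>z. c * f z)) z" by simp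
  also have "\<dots> = dderivs [v] (\<lambda>z. c * dderivs vs f z) z"
    by (rule dderivs_cong[OF assms(1)]) (use Cons in auto)
  also have "\<dots> = dderivs [v] (\<lambda>_. c) z * dderivs vs f z + c * dderivs [v] (dderivs vs f) z"
    by (intro dderivs_1_mult[OF assms(1)] smooth_on_dderivs smooth_on_const assms Cons.prems)
  finally show ?case by (simp add: dderivs_const frechet_derivative_const)
qed simp

lemma dderivs_0: "dderivs vs (\<lambda>_. 0) = (\<lambda>_. 0)"
  using dderivs_const[of vs 0] by (cases vs) auto

lemma dderivs_sum:
  assumes "open S" "\<And>i. i \<in> I \<Longrightarrow> smooth_on S (f i)" "z \<in> S"
  shows "dderivs vs (\<lambda>z. \<Sum>i\<in>I. f i z) z = (\<Sum>i\<in>I. dderivs vs (f i) z)"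
  using assms(2)
proof (induction I rule: infinite_finite_induct)
  case (insert i I)
  have "dderivs vs (\<lambda>z. f i z + (\<Sum>i\<in>I. f i z)) z
      = dderivs vs (f i) z + dderivs vs (\<lambda>z. \<Sum>i\<in>I. f i z) z"
    using insert.prems
    by (intro dderivs_add[OF assms(1) _ _ assms(3)] smooth_on_sum[OF assms(1)]) auto
  then show ?case using insert by simp
qed (auto simp: dderivs_0)

text \<open>By the mean value inequality in the direction \<open>v\<close>, applied to \<open>t \<mapsto> f (z + h u + t v) - f (z + t v)\<close>.\<close>

lemma second_difference:
  fixes f :: "'a::real_normed_vector \<Rightarrow> complex"
  assumes S: "open S" "z \<in> S" and f: "\<And>w. w \<in> S \<Longrightarrow> f differentiable (at w)"
    and fv: "dderivs [v] f differentiable (at z)" and "\<epsilon> > 0"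
  shows "\<exists>\<delta>>0. \<forall>h. 0 < h \<and> h < \<delta> \<longrightarrow>
    norm (f (z + h *\<^sub>R u + h *\<^sub>R v) - f (z + h *\<^sub>R u) - f (z + h *\<^sub>R v) + f z
      - h\<^sup>2 *\<^sub>R dderivs [u, v] f z) \<le> \<epsilon> * h\<^sup>2"
proof -
  let ?g = "dderivs [v] f" and ?L = "frechet_derivative (dderivs [v] f) (at z)"
  \<comment> \<open>Every increment \<open>s u + t v\<close> with s and t in [0, h] has norm at most
    \<open>h * c\<close>; with \<open>e\<close> as below two errors \<open>e * (h * c)\<close> add
    up to \<open>\<epsilon> * h\<close>.\<close>
  define c where "c = norm u + norm v + 1"
  define e where "e = \<epsilon> / (2 * c)"
  have c: "c > 0" unfolding c_def by (smt (verit) norm_ge_zero)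
  then have e: "e > 0" unfolding e_def using \<open>\<epsilon> > 0\<close> by simp
  have L: "(?g has_derivative ?L) (at z)" using fv frechet_derivative_works by blast
  obtain d1 where d1: "d1 > 0" "\<And>w. norm (w - z) < d1 \<Longrightarrow>
      norm (?g w - ?g z - ?L (w - z)) \<le> e * norm (w - z)"
    using L e unfolding has_derivative_at_alt by blast
  obtain d2 where d2: "d2 > 0" "ball z d2 \<subseteq> S" using S openE by blast
  define \<delta> where "\<delta> = min d1 d2 / c"
  have "\<delta> > 0" unfolding \<delta>_def using d1 d2 c by simp
  have linL: "linear ?L" using L has_derivative_linear by blast
  have "norm (f (z + h *\<^sub>R u + h *\<^sub>R v) - f (z + h *\<^sub>R u) - f (z + h *\<^sub>R v) + f z
      - h\<^sup>2 *\<^sub>R ?L u) \<le> \<epsilon> * h\<^sup>2" if h: "0 < h" "h < \<delta>" for h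
  proof -
    have hc: "h * c < min d1 d2" using h c unfolding \<delta>_def by (simp add: pos_less_divide_eq)
    have small: "norm (s *\<^sub>R u + t *\<^sub>R v) \<le> h * c" if "0 \<le> s" "s \<le> h" "0 \<le> t" "t \<le> h" for s t
    proof -
      have "norm (s *\<^sub>R u + t *\<^sub>R v) \<le> s * norm u + t * norm v"
        using norm_triangle_ineq[of "s *\<^sub>R u" "t *\<^sub>R v"] that by simp
      also have "\<dots> \<le> h * norm u + h * norm v" using that by (intro add_mono mult_right_mono) auto
      also have "\<dots> \<le> h * c" unfolding c_def using h by (simp add: algebra_simps)
      finally show ?thesis .
    qed
    \<comment> \<open>\<open>p h - p 0\<close> is the second difference minus its expected value,
      and \<open>p'\<close> is the derivative of \<open>p\<close>; a bound
      \<open>\<epsilon> * h\<close> for \<open>p'\<close> on [0, h] gives the claim.\<close>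
    define p where "p = (\<lambda>t. f (z + h *\<^sub>R u + t *\<^sub>R v) - f (z + t *\<^sub>R v) - (t * h) *\<^sub>R ?L u)"
    define p' where "p' = (\<lambda>t. ?g (z + h *\<^sub>R u + t *\<^sub>R v) - ?g (z + t *\<^sub>R v) - h *\<^sub>R ?L u)"
    have der1: "((\<lambda>t. f (z + s *\<^sub>R u + t *\<^sub>R v)) has_derivative
        (\<lambda>r. r *\<^sub>R ?g (z + s *\<^sub>R u + t *\<^sub>R v))) (at t)" if "0 \<le> s" "s \<le> h" "0 \<le> t" "t \<le> h" for s t
    proof -
      have "z + s *\<^sub>R u + t *\<^sub>R v \<in> S"
        using small[OF that] hc d2(2) by (auto simp: dist_norm subset_iff add.assoc norm_minus_commute)
      then have *: "(f has_derivative frechet_derivative f (at (z + s *\<^sub>R u + t *\<^sub>R v)))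
          (at (z + s *\<^sub>R u + t *\<^sub>R v))"
        using f frechet_derivative_works by blast
      have "((\<lambda>t. f (z + s *\<^sub>R u + t *\<^sub>R v)) has_derivative
          (\<lambda>r. frechet_derivative f (at (z + s *\<^sub>R u + t *\<^sub>R v)) (r *\<^sub>R v))) (at t)"
        by (rule has_derivative_compose[of "\<lambda>t. z + s *\<^sub>R u + t *\<^sub>R v" _ t, OF _ *])
           (auto intro!: derivative_eq_intros)
      moreover have "linear (frechet_derivative f (at (z + s *\<^sub>R u + t *\<^sub>R v)))"
        using * has_derivative_linear by blast
      ultimately show ?thesis by (simp add: linear_cmul)
    qed
    have der: "(p has_derivative (\<lambda>r. r *\<^sub>R p' t)) (at t)" if "0 \<le> t" "t \<le> h" for t
    proof -
      have 1: "((\<lambda>t. f (z + h *\<^sub>R u + t *\<^sub>R v)) has_derivative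
          (\<lambda>r. r *\<^sub>R ?g (z + h *\<^sub>R u + t *\<^sub>R v))) (at t)"
        using der1[of h t] that h by simp
      have 2: "((\<lambda>t. f (z + t *\<^sub>R v)) has_derivative (\<lambda>r. r *\<^sub>R ?g (z + t *\<^sub>R v))) (at t)"
        using der1[of 0 t] that h by simp
      have 3: "((\<lambda>t. (t * h) *\<^sub>R ?L u) has_derivative (\<lambda>r. (r * h) *\<^sub>R ?L u)) (at t)"
        by (auto intro!: derivative_eq_intros)
      have "(\<lambda>r. r *\<^sub>R ?g (z + h *\<^sub>R u + t *\<^sub>R v) - r *\<^sub>R ?g (z + t *\<^sub>R v) - (r * h) *\<^sub>R ?L u)
          = (\<lambda>r. r *\<^sub>R p' t)"
        unfolding p'_def by (simp only: scaleR_diff_right scaleR_scaleR)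
      then show ?thesis
        using has_derivative_diff[OF has_derivative_diff[OF 1 2] 3] unfolding p_def by simp
    qed
    have bound: "norm (p' t) \<le> \<epsilon> * h" if t: "0 \<le> t" "t \<le> h" for t
    proof -
      have a1: "norm (?g (z + h *\<^sub>R u + t *\<^sub>R v) - ?g z - ?L (h *\<^sub>R u + t *\<^sub>R v)) \<le> e * (h * c)"
        using d1(2)[of "z + h *\<^sub>R u + t *\<^sub>R v"] small[of h t] t h hc e
        by (simp add: add.assoc) (smt (verit) mult_left_mono)
      have a2: "norm (?g (z + t *\<^sub>R v) - ?g z - ?L (t *\<^sub>R v)) \<le> e * (h * c)"
        using d1(2)[of "z + t *\<^sub>R v"] small[of 0 t] t h hc e
        by simp (smt (verit) mult_left_mono)
      \<comment> \<open>The values at \<open>z\<close> cancel, and by linearity the two values of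
        \<open>?L\<close> differ by \<open>h\<close> times \<open>?L u\<close>, the term subtracted
        in \<open>p'\<close>.\<close>
      have "p' t = (?g (z + h *\<^sub>R u + t *\<^sub>R v) - ?g z - ?L (h *\<^sub>R u + t *\<^sub>R v))
          - (?g (z + t *\<^sub>R v) - ?g z - ?L (t *\<^sub>R v))"
        unfolding p'_def using linL by (simp add: linear_add linear_cmul)
      then have "norm (p' t) \<le> e * (h * c) + e * (h * c)"
        using a1 a2 norm_triangle_ineq4 by (smt (verit, best))
      also have "\<dots> = \<epsilon> * h" unfolding e_def using c by simp
      finally show ?thesis .
    qed
    have "norm (p h - p 0) \<le> (\<epsilon> * h) * norm (h - 0)"
    proof (rule differentiable_bound[of "{0..h}"])
      show "(p has_derivative (\<lambda>r. r *\<^sub>R p' t)) (at t within {0..h})" if "t \<in> {0..h}" for t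
        using der that by (auto intro: has_derivative_at_withinI)
      show "onorm (\<lambda>r. r *\<^sub>R p' t) \<le> \<epsilon> * h" if "t \<in> {0..h}" for t
        using bound[of t] that by (intro onorm_le) (auto simp: mult_left_mono mult.commute)
    qed (use h in auto)
    then show ?thesis unfolding p_def using h by (simp add: power2_eq_square algebra_simps)
  qed
  then show ?thesis using \<open>\<delta> > 0\<close> by auto
qed

text \<open>The second difference is symmetric in \<open>u\<close> and \<open>v\<close>, and by
  \<open>second_difference\<close> both mixed derivatives are its limit after division by the square
  of \<open>h\<close>.\<close>

lemma dderivs_commute:
  assumes "open S" "z \<in> S" "smooth_on S f"
  shows "dderivs [u, v] f z = dderivs [v, u] f z"
proof (rule ccontr)
  let ?a = "dderivs [u, v] f z" and ?b = "dderivs [v, u] f z"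
  assume "?a \<noteq> ?b"
  \<comment> \<open>A third of the distance: the two estimates then yield
    \<open>3 * \<epsilon> \<le> 2 * \<epsilon>\<close>.\<close>
  define \<epsilon> where "\<epsilon> = norm (?a - ?b) / 3"
  have \<epsilon>: "\<epsilon> > 0" using \<open>?a \<noteq> ?b\<close> unfolding \<epsilon>_def by simp
  have d: "dderivs vs f differentiable (at w)" if "w \<in> S" for vs w
    using assms(3) that unfolding smooth_on_def by blast
  have f: "f differentiable (at w)" if "w \<in> S" for w
    using d[OF that, of "[]"] by simp
  obtain d1 where d1: "d1 > 0" "\<And>h. 0 < h \<Longrightarrow> h < d1 \<Longrightarrow> norm (f (z + h *\<^sub>R u + h *\<^sub>R v)
      - f (z + h *\<^sub>R u) - f (z + h *\<^sub>R v) + f z - h\<^sup>2 *\<^sub>R ?a) \<le> \<epsilon> * h\<^sup>2"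
    using second_difference[OF assms(1,2) f d[OF assms(2)] \<epsilon>, of u v] by blast
  obtain d2 where d2: "d2 > 0" "\<And>h. 0 < h \<Longrightarrow> h < d2 \<Longrightarrow> norm (f (z + h *\<^sub>R v + h *\<^sub>R u)
      - f (z + h *\<^sub>R v) - f (z + h *\<^sub>R u) + f z - h\<^sup>2 *\<^sub>R ?b) \<le> \<epsilon> * h\<^sup>2"
    using second_difference[OF assms(1,2) f d[OF assms(2)] \<epsilon>, of v u] by blast
  define h where "h = min d1 d2 / 2"
  have h: "h > 0" "h < d1" "h < d2" using d1 d2 unfolding h_def by auto
  define E where "E = f (z + h *\<^sub>R u + h *\<^sub>R v) - f (z + h *\<^sub>R u) - f (z + h *\<^sub>R v) + f z"
  have "norm (E - h\<^sup>2 *\<^sub>R ?a) \<le> \<epsilon> * h\<^sup>2" using d1(2)[OF h(1,2)] unfolding E_def .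
  moreover have "norm (E - h\<^sup>2 *\<^sub>R ?b) \<le> \<epsilon> * h\<^sup>2"
    using d2(2)[OF h(1,3)] unfolding E_def by (simp add: algebra_simps)
  moreover have "(E - h\<^sup>2 *\<^sub>R ?b) - (E - h\<^sup>2 *\<^sub>R ?a) = h\<^sup>2 *\<^sub>R (?a - ?b)"
    by (simp add: scaleR_right_diff_distrib)
  ultimately have "norm (h\<^sup>2 *\<^sub>R (?a - ?b)) \<le> 2 * \<epsilon> * h\<^sup>2"
    using norm_triangle_ineq4[of "E - h\<^sup>2 *\<^sub>R ?b" "E - h\<^sup>2 *\<^sub>R ?a"] by simp
  then have "h\<^sup>2 * (3 * \<epsilon>) \<le> h\<^sup>2 * (2 * \<epsilon>)" by (simp add: \<epsilon>_def mult.commute)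
  then show False using \<epsilon> h by (simp add: mult_le_cancel_left)
qed

lemma dderivs_snoc:
  assumes "open S" "smooth_on S f"
  shows "z \<in> S \<Longrightarrow> dderivs (vs @ [v]) f z = dderivs (v # vs) f z"
proof (induction vs arbitrary: z)
  case (Cons u vs)
  have "dderivs ((u # vs) @ [v]) f z = dderivs [u] (dderivs (vs @ [v]) f) z" by simp
  also have "\<dots> = dderivs [u] (dderivs (v # vs) f) z"
    by (rule dderivs_cong[OF assms(1)]) (use Cons in auto)
  also have "\<dots> = dderivs [v] (dderivs (u # vs) f) z"
    using dderivs_commute[OF assms(1) Cons.prems smooth_on_dderivs[OF assms(2)]] by simp
  finally show ?case by simp
qed simp

text \<open>Serves to sort words: \<open>is_symbol\<close> bounds only words in which all
  x-directions precede the \<xi>-directions.\<close>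

lemma dderivs_perm:
  assumes "open S" "smooth_on S f"
  shows "mset vs = mset ws \<Longrightarrow> z \<in> S \<Longrightarrow> dderivs vs f z = dderivs ws f z"
proof (induction vs arbitrary: ws z)
  case (Cons v vs)
  then have "v \<in> set ws" by (metis list.set_intros(1) mset_eq_setD)
  then obtain xs ys where ws: "ws = xs @ v # ys" by (meson split_list)
  have "dderivs (v # vs) f z = dderivs [v] (dderivs vs f) z" by simp
  also have "\<dots> = dderivs [v] (dderivs (xs @ ys) f) z"
    by (rule dderivs_cong[OF assms(1)]) (use Cons ws in auto)
  also have "\<dots> = dderivs (v # xs) (dderivs ys f) z" by (simp add: dderivs_append)
  also have "\<dots> = dderivs (xs @ [v]) (dderivs ys f) z"
    by (rule dderivs_snoc[OF assms(1) smooth_on_dderivs[OF assms(2)], symmetric]) (use Cons in simp)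
  also have "\<dots> = dderivs ws f z" by (simp add: dderivs_append ws)
  finally show ?case .
qed simp

lemma dderivs_1_swap:
  assumes "open S" "smooth_on S f" "z \<in> S"
  shows "dderivs vs (dderivs [v] f) z = dderivs [v] (dderivs vs f) z"
  using dderivs_snoc[OF assms, of vs v] by (simp add: dderivs_append)

section \<open>Symbol estimates\<close>

text \<open>The set of covectors is a parameter, taken as \<open>UNIV\<close> for symbols and as
  \<open>far\<close> for homogeneous functions, which may be unbounded near \<xi> = 0.\<close>

definition bounded_order :: "(real ^ 'n) set \<Rightarrow> (real ^ 'n::finite) set \<Rightarrow> real \<Rightarrow> 'n symb \<Rightarrow> bool" where
  "bounded_order U \<Omega> r f \<longleftrightarrow> (\<forall>K. compact K \<and> K \<subseteq> U \<longrightarrow>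
     (\<exists>C. \<forall>x\<in>K. \<forall>\<xi>\<in>\<Omega>. norm (f (x, \<xi>)) \<le> C * (1 + norm \<xi>) powr r))"

lemma bounded_orderE:
  assumes "bounded_order U \<Omega> r f" "compact K" "K \<subseteq> U"
  obtains C where "C \<ge> 0" "\<And>x \<xi>. x \<in> K \<Longrightarrow> \<xi> \<in> \<Omega> \<Longrightarrow> norm (f (x, \<xi>)) \<le> C * (1 + norm \<xi>) powr r"
proof -
  obtain C where C: "\<And>x \<xi>. x \<in> K \<Longrightarrow> \<xi> \<in> \<Omega> \<Longrightarrow> norm (f (x, \<xi>)) \<le> C * (1 + norm \<xi>) powr r"
    using assms unfolding bounded_order_def by metis
  have "norm (f (x, \<xi>)) \<le> \<bar>C\<bar> * (1 + norm \<xi>) powr r" if "x \<in> K" "\<xi> \<in> \<Omega>" for x \<xi>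
    using C[OF that] by (rule order_trans) (simp add: mult_right_mono)
  then show ?thesis using that[of "\<bar>C\<bar>"] by simp
qed

lemma bounded_orderI:
  assumes "\<And>K. compact K \<Longrightarrow> K \<subseteq> U \<Longrightarrow>
    \<exists>C. \<forall>x\<in>K. \<forall>\<xi>\<in>\<Omega>. norm (f (x, \<xi>)) \<le> C * (1 + norm \<xi>) powr r"
  shows "bounded_order U \<Omega> r f"
  using assms unfolding bounded_order_def by blast

lemma bounded_order_cong:
  assumes "\<And>z. z \<in> U \<times> \<Omega> \<Longrightarrow> f z = g z" "bounded_order U \<Omega> r f"
  shows "bounded_order U \<Omega> r g"
  using assms unfolding bounded_order_def by (smt (verit, best) mem_Sigma_iff subset_iff)

lemma bounded_order_mono:
  assumes "bounded_order U \<Omega> r f" "r \<le> s"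
  shows "bounded_order U \<Omega> s f"
proof (rule bounded_orderI)
  fix K assume K: "compact K" "K \<subseteq> U"
  obtain C where C: "C \<ge> 0" "\<And>x \<xi>. x \<in> K \<Longrightarrow> \<xi> \<in> \<Omega> \<Longrightarrow> norm (f (x, \<xi>)) \<le> C * (1 + norm \<xi>) powr r"
    using bounded_orderE[OF assms(1) K] by metis
  have "norm (f (x, \<xi>)) \<le> C * (1 + norm \<xi>) powr s" if "x \<in> K" "\<xi> \<in> \<Omega>" for x \<xi>
    using C(2)[OF that] by (rule order_trans) (intro mult_left_mono powr_mono assms C, simp)
  then show "\<exists>C. \<forall>x\<in>K. \<forall>\<xi>\<in>\<Omega>. norm (f (x, \<xi>)) \<le> C * (1 + norm \<xi>) powr s" by blast
qed

lemma bounded_order_add: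
  assumes "bounded_order U \<Omega> r f" "bounded_order U \<Omega> r g"
  shows "bounded_order U \<Omega> r (\<lambda>z. f z + g z)"
proof (rule bounded_orderI)
  fix K assume K: "compact K" "K \<subseteq> U"
  obtain C where C: "\<And>x \<xi>. x \<in> K \<Longrightarrow> \<xi> \<in> \<Omega> \<Longrightarrow> norm (f (x, \<xi>)) \<le> C * (1 + norm \<xi>) powr r"
    using bounded_orderE[OF assms(1) K] by metis
  obtain D where D: "\<And>x \<xi>. x \<in> K \<Longrightarrow> \<xi> \<in> \<Omega> \<Longrightarrow> norm (g (x, \<xi>)) \<le> D * (1 + norm \<xi>) powr r"
    using bounded_orderE[OF assms(2) K] by metis
  have "norm (f (x, \<xi>) + g (x, \<xi>)) \<le> (C + D) * (1 + norm \<xi>) powr r" if "x \<in> K" "\<xi> \<in> \<Omega>" for x \<xi>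
    using C[OF that] D[OF that] norm_triangle_ineq[of "f (x, \<xi>)" "g (x, \<xi>)"]
    by (simp add: algebra_simps)
  then show "\<exists>C. \<forall>x\<in>K. \<forall>\<xi>\<in>\<Omega>. norm (f (x, \<xi>) + g (x, \<xi>)) \<le> C * (1 + norm \<xi>) powr r" by blast
qed

lemma bounded_order_mult:
  assumes "bounded_order U \<Omega> r f" "bounded_order U \<Omega> s g"
  shows "bounded_order U \<Omega> (r + s) (\<lambda>z. f z * g z)"
proof (rule bounded_orderI)
  fix K assume K: "compact K" "K \<subseteq> U"
  obtain C where C: "C \<ge> 0" "\<And>x \<xi>. x \<in> K \<Longrightarrow> \<xi> \<in> \<Omega> \<Longrightarrow> norm (f (x, \<xi>)) \<le> C * (1 + norm \<xi>) powr r"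
    using bounded_orderE[OF assms(1) K] by metis
  obtain D where D: "\<And>x \<xi>. x \<in> K \<Longrightarrow> \<xi> \<in> \<Omega> \<Longrightarrow> norm (g (x, \<xi>)) \<le> D * (1 + norm \<xi>) powr s"
    using bounded_orderE[OF assms(2) K] by metis
  have "norm (f (x, \<xi>) * g (x, \<xi>)) \<le> (C * D) * (1 + norm \<xi>) powr (r + s)"
    if "x \<in> K" "\<xi> \<in> \<Omega>" for x \<xi>
    using mult_mono[OF C(2)[OF that] D[OF that]] C(1)
    by (simp add: norm_mult powr_add mult_ac)
  then show "\<exists>C. \<forall>x\<in>K. \<forall>\<xi>\<in>\<Omega>. norm (f (x, \<xi>) * g (x, \<xi>)) \<le> C * (1 + norm \<xi>) powr (r + s)" by blast
qed

lemma bounded_order_const: "bounded_order U \<Omega> 0 (\<lambda>z. c)"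
proof -
  have "1 + norm \<xi> \<noteq> 0" for \<xi> :: "real ^ 'a" by (smt (verit) norm_ge_zero)
  then show ?thesis by (intro bounded_orderI exI[of _ "norm c"]) simp
qed

lemma bounded_order_cmult: "bounded_order U \<Omega> r f \<Longrightarrow> bounded_order U \<Omega> r (\<lambda>z. c * f z)"
  using bounded_order_mult[OF bounded_order_const[of U \<Omega> c]] by simp

lemma bounded_order_0: "bounded_order U \<Omega> r (\<lambda>z. 0)"
  by (rule bounded_orderI) (auto intro!: exI[of _ 0])

section \<open>Words of basis directions and symbol classes\<close>

definition xi_count :: "'n::finite tpoint list \<Rightarrow> nat" where
  "xi_count w = length (filter (\<lambda>v. fst v = 0) w)"

lemma xi_count_simps [simp]:
  "xi_count [] = 0" "xi_count (v # w) = (if fst v = 0 then 1 else 0) + xi_count w"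
  "xi_count (w @ w') = xi_count w + xi_count w'"
  by (auto simp: xi_count_def)

text \<open>Basis words in any order, unlike the sorted ones of \<open>is_symbol\<close>, make the
  class stable under a further derivative at either end of the word. In \<open>Basis\<close> the
  \<xi>-directions are exactly the vectors with vanishing first component, so
  \<open>xi_count\<close> is the expected gain of order.\<close>

definition symbol_on :: "(real ^ 'n) set \<Rightarrow> (real ^ 'n::finite) set \<Rightarrow> real \<Rightarrow> 'n symb \<Rightarrow> bool" where
  "symbol_on U \<Omega> r f \<longleftrightarrow> smooth_on (U \<times> \<Omega>) f \<and>
     (\<forall>w. set w \<subseteq> Basis \<longrightarrow> bounded_order U \<Omega> (r - real (xi_count w)) (dderivs w f))"

lemma Basis_tpoint:
  "(Basis :: 'n::finite tpoint set) = range (\<lambda>i. (axis i 1, 0)) \<union> range (\<lambda>j. (0, axis j 1))"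
  unfolding Basis_prod_def Basis_vec_def by auto

lemma axis_1_nonzero [simp]: "axis i (1::real) \<noteq> 0"
  by (simp add: axis_eq_0_iff)

lemma sort_basis_word:
  assumes "set w \<subseteq> (Basis :: 'n::finite tpoint set)"
  shows "\<exists>I J. mset w = mset (map (\<lambda>i. (axis i 1, 0)) I @ map (\<lambda>j. (0, axis j 1)) J)
    \<and> xi_count w = length J"
  using assms
proof (induction w)
  case (Cons v w)
  then obtain I J where IJ: "mset w = mset (map (\<lambda>i. (axis i 1, 0)) I @ map (\<lambda>j. (0, axis j 1)) J)"
    "xi_count w = length J" by auto
  consider i where "v = (axis i 1, 0)" | j where "v = (0, axis j 1)"
    using Cons.prems by (auto simp: Basis_tpoint)
  then show ?case
  proof cases
    case 1 then show ?thesis using IJ by (intro exI[of _ "i # I"] exI[of _ J]) simp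
  next
    case 2 then show ?thesis using IJ by (intro exI[of _ I] exI[of _ "j # J"]) simp
  qed
qed (auto intro!: exI[of _ "[]"])

lemma xi_count_sorted:
  "xi_count (map (\<lambda>i. (axis i 1, 0)) I @ map (\<lambda>j. (0, axis j 1)) J) = length J"
  by (simp add: xi_count_def filter_map o_def)

text \<open>Sorting a word changes neither the derivative, by \<open>dderivs_perm\<close>, nor the
  number of its \<xi>-directions.\<close>

lemma is_symbol_iff:
  fixes U :: "(real ^ 'n::finite) set"
  assumes "open U"
  shows "is_symbol U r \<sigma> \<longleftrightarrow> symbol_on U UNIV r \<sigma>"
proof
  assume L: "is_symbol U r \<sigma>"
  have sm: "smooth_on (U \<times> UNIV) \<sigma>" using L unfolding is_symbol_def cotangent_def by blast
  have "bounded_order U UNIV (r - real (xi_count w)) (dderivs w \<sigma>)" if w: "set w \<subseteq> Basis" for w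
  proof -
    obtain I J where IJ: "mset w = mset (map (\<lambda>i. (axis i 1, 0)) I @ map (\<lambda>j. (0, axis j 1)) J)"
      "xi_count w = length J" using sort_basis_word[OF w] by blast
    show ?thesis
    proof (rule bounded_order_cong)
      show "bounded_order U UNIV (r - real (xi_count w))
          (dderivs (map (\<lambda>i. (axis i 1, 0)) I @ map (\<lambda>j. (0, axis j 1)) J) \<sigma>)"
      proof (rule bounded_orderI)
        fix K assume "compact K" "K \<subseteq> U"
        then show "\<exists>C. \<forall>x\<in>K. \<forall>\<xi>\<in>UNIV. norm (dderivs (map (\<lambda>i. (axis i 1, 0)) I @ map (\<lambda>j. (0, axis j 1)) J)
            \<sigma> (x, \<xi>)) \<le> C * (1 + norm \<xi>) powr (r - real (xi_count w))"
          using conjunct2[OF L[unfolded is_symbol_def], rule_format, of K I J] IJ(2) by simp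
      qed
      show "dderivs (map (\<lambda>i. (axis i 1, 0)) I @ map (\<lambda>j. (0, axis j 1)) J) \<sigma> z = dderivs w \<sigma> z"
        if "z \<in> U \<times> UNIV" for z
        using dderivs_perm[OF _ sm IJ(1) that] assms by (simp add: open_Times)
    qed
  qed
  then show "symbol_on U UNIV r \<sigma>" unfolding symbol_on_def using sm by blast
next
  assume R: "symbol_on U UNIV r \<sigma>"
  have "bounded_order U UNIV (r - real (length J))
      (dderivs (map (\<lambda>i. (axis i 1, 0)) I @ map (\<lambda>j. (0, axis j 1)) J) \<sigma>)" for I J
  proof -
    let ?w = "map (\<lambda>i. (axis i 1, 0)) I @ map (\<lambda>j. (0, axis j 1)) J :: 'n tpoint list"
    have "set ?w \<subseteq> Basis" by (auto simp: Basis_tpoint)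
    then show ?thesis using R xi_count_sorted[of I J] unfolding symbol_on_def by metis
  qed
  then show "is_symbol U r \<sigma>"
    using R unfolding is_symbol_def symbol_on_def bounded_order_def cotangent_def by (meson UNIV_I)
qed

lemma symbol_on_smooth: "symbol_on U \<Omega> r f \<Longrightarrow> smooth_on (U \<times> \<Omega>) f"
  unfolding symbol_on_def by blast

lemma symbol_on_bounded: "symbol_on U \<Omega> r f \<Longrightarrow> bounded_order U \<Omega> r f"
  unfolding symbol_on_def by (metis (no_types, lifting) diff_0_right dderivs.simps(1) empty_subsetI
      list.set(1) of_nat_0 xi_count_simps(1))

lemma symbol_on_cong:
  assumes "open (U \<times> \<Omega>)" "symbol_on U \<Omega> r f" "\<And>z. z \<in> U \<times> \<Omega> \<Longrightarrow> f z = g z"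
  shows "symbol_on U \<Omega> r g"
  unfolding symbol_on_def
proof (intro conjI allI impI)
  show "smooth_on (U \<times> \<Omega>) g" by (rule smooth_on_cong[OF assms(1,3) symbol_on_smooth[OF assms(2)]])
  show "bounded_order U \<Omega> (r - real (xi_count w)) (dderivs w g)" if "set w \<subseteq> Basis" for w
  proof (rule bounded_order_cong)
    show "bounded_order U \<Omega> (r - real (xi_count w)) (dderivs w f)"
      using assms(2) that unfolding symbol_on_def by simp
  qed (rule dderivs_cong[OF assms(1,3)])
qed

lemma symbol_on_mono: "symbol_on U \<Omega> r f \<Longrightarrow> r \<le> s \<Longrightarrow> symbol_on U \<Omega> s f"
  unfolding symbol_on_def
  by (meson bounded_order_mono diff_right_mono)

lemma symbol_on_subset: "symbol_on U \<Omega> r f \<Longrightarrow> \<Omega>' \<subseteq> \<Omega> \<Longrightarrow> symbol_on U \<Omega>' r f"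
  unfolding symbol_on_def bounded_order_def
  by (meson Sigma_mono smooth_on_subset subset_refl subset_iff)

lemma symbol_on_add:
  assumes "open (U \<times> \<Omega>)" "symbol_on U \<Omega> r f" "symbol_on U \<Omega> r g"
  shows "symbol_on U \<Omega> r (\<lambda>z. f z + g z)"
  unfolding symbol_on_def
proof (intro conjI allI impI)
  have sm: "smooth_on (U \<times> \<Omega>) f" "smooth_on (U \<times> \<Omega>) g" using assms symbol_on_smooth by auto
  then show "smooth_on (U \<times> \<Omega>) (\<lambda>z. f z + g z)" using assms by (intro smooth_on_add)
  show "bounded_order U \<Omega> (r - real (xi_count w)) (dderivs w (\<lambda>z. f z + g z))"
    if "set w \<subseteq> Basis" for w
    by (rule bounded_order_cong[OF dderivs_add[OF assms(1) sm, symmetric] bounded_order_add])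
       (use assms that in \<open>auto simp: symbol_on_def\<close>)
qed

lemma symbol_on_cmult:
  assumes "open (U \<times> \<Omega>)" "symbol_on U \<Omega> r f"
  shows "symbol_on U \<Omega> r (\<lambda>z. c * f z)"
  unfolding symbol_on_def
proof (intro conjI allI impI)
  have sm: "smooth_on (U \<times> \<Omega>) f" using assms symbol_on_smooth by auto
  then show "smooth_on (U \<times> \<Omega>) (\<lambda>z. c * f z)" using assms by (intro smooth_on_cmult)
  show "bounded_order U \<Omega> (r - real (xi_count w)) (dderivs w (\<lambda>z. c * f z))"
    if "set w \<subseteq> Basis" for w
    by (rule bounded_order_cong[OF dderivs_cmult[OF assms(1) sm, symmetric] bounded_order_cmult])
       (use assms that in \<open>auto simp: symbol_on_def\<close>)
qed

lemma symbol_on_0: "symbol_on U \<Omega> r (\<lambda>z. 0)"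
  unfolding symbol_on_def by (auto simp: smooth_on_const dderivs_0 bounded_order_0)

lemma symbol_on_sum:
  "open (U \<times> \<Omega>) \<Longrightarrow> (\<And>i. i \<in> I \<Longrightarrow> symbol_on U \<Omega> r (f i)) \<Longrightarrow>
    symbol_on U \<Omega> r (\<lambda>z. \<Sum>i\<in>I. f i z)"
  by (induction I rule: infinite_finite_induct) (auto intro: symbol_on_0 symbol_on_add)

lemma symbol_on_dderivs:
  assumes "symbol_on U \<Omega> r f" "set w \<subseteq> Basis"
  shows "symbol_on U \<Omega> (r - real (xi_count w)) (dderivs w f)"
  unfolding symbol_on_def
proof (intro conjI allI impI)
  show "smooth_on (U \<times> \<Omega>) (dderivs w f)"
    using assms symbol_on_smooth smooth_on_dderivs by blast
  fix w' :: "'a tpoint list" assume "set w' \<subseteq> Basis"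
  then have "set (w' @ w) \<subseteq> Basis" using assms by simp
  then have "bounded_order U \<Omega> (r - real (xi_count (w' @ w))) (dderivs (w' @ w) f)"
    using assms unfolding symbol_on_def by blast
  then show "bounded_order U \<Omega> (r - real (xi_count w) - real (xi_count w')) (dderivs w' (dderivs w f))"
    by (simp add: dderivs_append algebra_simps)
qed

lemma symbol_on_dderiv_basis:
  "symbol_on U \<Omega> r f \<Longrightarrow> v \<in> Basis \<Longrightarrow> symbol_on U \<Omega> (r - real (xi_count [v])) (dderivs [v] f)"
  using symbol_on_dderivs[of U \<Omega> r f "[v]"] by simp

lemma frechet_derivative_expand:
  assumes "f differentiable (at z)"
  shows "frechet_derivative f (at z) v = (\<Sum>b\<in>Basis. (v \<bullet> b) *\<^sub>R frechet_derivative f (at z) b)"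
proof -
  have "linear (frechet_derivative f (at z))"
    using assms frechet_derivative_works has_derivative_linear by blast
  then have "frechet_derivative f (at z) (\<Sum>b\<in>Basis. (v \<bullet> b) *\<^sub>R b)
      = (\<Sum>b\<in>Basis. (v \<bullet> b) *\<^sub>R frechet_derivative f (at z) b)"
    by (simp add: linear_sum linear_cmul)
  then show ?thesis by (simp add: euclidean_representation)
qed

text \<open>No gain of order, since \<open>v\<close> may have an x-component. Arbitrary directions
  occur because \<open>smooth_on\<close> speaks of all of them.\<close>

lemma symbol_on_dderiv_any:
  assumes "open (U \<times> \<Omega>)" "symbol_on U \<Omega> r f"
  shows "symbol_on U \<Omega> r (dderivs [v] f)"
proof (rule symbol_on_cong[OF assms(1)])
  show "symbol_on U \<Omega> r (\<lambda>z. \<Sum>b\<in>Basis. of_real (v \<bullet> b) * dderivs [b] f z)"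
  proof (intro symbol_on_sum symbol_on_cmult assms)
    fix b :: "'a tpoint" assume "b \<in> Basis"
    then show "symbol_on U \<Omega> r (dderivs [b] f)"
      using symbol_on_mono[OF symbol_on_dderivs[OF assms(2), of "[b]"], of r] by simp
  qed
  show "(\<Sum>b\<in>Basis. of_real (v \<bullet> b) * dderivs [b] f z) = dderivs [v] f z" if "z \<in> U \<times> \<Omega>" for z
    using frechet_derivative_expand[OF smooth_on_differentiable[OF symbol_on_smooth[OF assms(2)] that], of v]
    by (simp add: scaleR_conv_of_real)
qed

text \<open>Leibniz rule and estimate of \<open>\<Phi> a b\<close> alone suffice, as they carry over to all derivatives.\<close>

lemma symbol_on_bilinear:
  fixes \<Phi> :: "'n::finite symb \<Rightarrow> 'n symb \<Rightarrow> 'n symb"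
  assumes O: "open (U \<times> \<Omega>)"
    and P: "\<And>r a v. P r a \<Longrightarrow> P r (dderivs [v] a)"
      "\<And>r a v. P r a \<Longrightarrow> v \<in> Basis \<Longrightarrow> P (r - real (xi_count [v])) (dderivs [v] a)"
    and Q: "\<And>r a v. Q r a \<Longrightarrow> Q r (dderivs [v] a)"
      "\<And>r a v. Q r a \<Longrightarrow> v \<in> Basis \<Longrightarrow> Q (r - real (xi_count [v])) (dderivs [v] a)"
    and diff: "\<And>r s a b z. P r a \<Longrightarrow> Q s b \<Longrightarrow> z \<in> U \<times> \<Omega> \<Longrightarrow> \<Phi> a b differentiable (at z)"
    and leib: "\<And>r s a b z v. P r a \<Longrightarrow> Q s b \<Longrightarrow> z \<in> U \<times> \<Omega> \<Longrightarrow>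
      dderivs [v] (\<Phi> a b) z = \<Phi> (dderivs [v] a) b z + \<Phi> a (dderivs [v] b) z"
    and bd: "\<And>r s a b. P r a \<Longrightarrow> Q s b \<Longrightarrow> bounded_order U \<Omega> (r + s - c) (\<Phi> a b)"
    and ab: "P r a" "Q s b"
  shows "symbol_on U \<Omega> (r + s - c) (\<Phi> a b)"
proof -
  have sm: "smooth_on (U \<times> \<Omega>) (\<Phi> a b)" if "P r a" "Q s b" for r s a b
    unfolding smooth_on_iff_upto
  proof
    fix k show "smooth_upto k (U \<times> \<Omega>) (\<Phi> a b)" using that
    proof (induction k arbitrary: a b)
      case 0 then show ?case using diff by (simp add: smooth_upto_0)
    next
      case (Suc k)
      have "smooth_upto k (U \<times> \<Omega>) (dderivs [v] (\<Phi> a b))" for v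
      proof (rule smooth_upto_cong[OF O])
        show "smooth_upto k (U \<times> \<Omega>) (\<lambda>z. \<Phi> (dderivs [v] a) b z + \<Phi> a (dderivs [v] b) z)"
          using Suc P(1) Q(1) by (intro smooth_upto_add[OF O]) auto
      qed (use leib[OF Suc.prems] in simp)
      then show ?case using diff[OF Suc.prems] unfolding smooth_upto_Suc by blast
    qed
  qed
  have "bounded_order U \<Omega> (r + s - c - real (xi_count w)) (dderivs w (\<Phi> a b))"
    if "set w \<subseteq> Basis" "P r a" "Q s b" for w r s a b
    using that
  proof (induction w arbitrary: r s a b rule: rev_induct)
    case Nil then show ?case using bd by simp
  next
    \<comment> \<open>The last letter is the derivative nearest to \<open>\<Phi> a b\<close>, where
      \<open>leib\<close> applies. It leaves two expressions of the same kind, in each of which one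
      argument has lost \<open>?n\<close> orders, so the induction hypothesis gives the same total
      order for both.\<close>
    case (snoc v w)
    have v: "v \<in> Basis" using snoc.prems by simp
    let ?a = "dderivs [v] a" and ?b = "dderivs [v] b" and ?n = "real (xi_count [v])"
    have P': "P (r - ?n) ?a" and Q': "Q (s - ?n) ?b" using P(2) Q(2) snoc.prems v by auto
    show ?case
    proof (rule bounded_order_cong)
      have F: "bounded_order U \<Omega> (r - ?n + s - c - real (xi_count w)) (dderivs w (\<Phi> ?a b))"
        "bounded_order U \<Omega> (r + (s - ?n) - c - real (xi_count w)) (dderivs w (\<Phi> a ?b))"
        using snoc P' Q' by auto
      have e: "r - ?n + s - c - real (xi_count w) = r + s - c - real (xi_count (w @ [v]))"
        "r + (s - ?n) - c - real (xi_count w) = r + s - c - real (xi_count (w @ [v]))" by simp_all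
      show "bounded_order U \<Omega> (r + s - c - real (xi_count (w @ [v])))
          (\<lambda>z. dderivs w (\<Phi> ?a b) z + dderivs w (\<Phi> a ?b) z)"
        using F unfolding e by (rule bounded_order_add)
      fix z assume z: "z \<in> U \<times> \<Omega>"
      have "dderivs (w @ [v]) (\<Phi> a b) z = dderivs w (dderivs [v] (\<Phi> a b)) z" by (simp add: dderivs_append)
      also have "\<dots> = dderivs w (\<lambda>z. \<Phi> ?a b z + \<Phi> a ?b z) z"
        by (rule dderivs_cong[OF O _ z]) (use leib snoc.prems in blast)
      also have "\<dots> = dderivs w (\<Phi> ?a b) z + dderivs w (\<Phi> a ?b) z"
        using sm P' Q' snoc.prems by (intro dderivs_add[OF O _ _ z]) blast+
      finally show "dderivs w (\<Phi> ?a b) z + dderivs w (\<Phi> a ?b) z = dderivs (w @ [v]) (\<Phi> a b) z" by simp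
    qed
  qed
  then show ?thesis unfolding symbol_on_def using sm ab by blast
qed

lemma symbol_on_mult:
  assumes O: "open (U \<times> \<Omega>)" and "symbol_on U \<Omega> r f" "symbol_on U \<Omega> s g"
  shows "symbol_on U \<Omega> (r + s) (\<lambda>z. f z * g z)"
proof -
  have "symbol_on U \<Omega> (r + s - 0) (\<lambda>z. f z * g z)"
  proof (rule symbol_on_bilinear[where P = "symbol_on U \<Omega>" and Q = "symbol_on U \<Omega>"
        and \<Phi> = "\<lambda>f g z. f z * g z"])
    show "dderivs [v] (\<lambda>z. a z * b z) z = dderivs [v] a z * b z + a z * dderivs [v] b z"
      if "symbol_on U \<Omega> r a" "symbol_on U \<Omega> s b" "z \<in> U \<times> \<Omega>" for r s a b z v
      using that symbol_on_smooth by (intro dderivs_1_mult[OF O]) blast+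
    show "(\<lambda>z. a z * b z) differentiable (at z)"
      if "symbol_on U \<Omega> r a" "symbol_on U \<Omega> s b" "z \<in> U \<times> \<Omega>" for r s a b z
      using that symbol_on_smooth smooth_on_differentiable by (intro differentiable_mult) blast+
    show "bounded_order U \<Omega> (r + s - 0) (\<lambda>z. a z * b z)"
      if "symbol_on U \<Omega> r a" "symbol_on U \<Omega> s b" for r s a b
      using bounded_order_mult[OF that[THEN symbol_on_bounded]] by simp
  qed (fact assms | erule symbol_on_dderiv_any[OF O] | erule (1) symbol_on_dderiv_basis)+
  then show ?thesis by simp
qed

text \<open>Open, so that derivatives on it are determined by values on it, and contained in the
  region where every cutoff equals 1.\<close>

abbreviation far :: "(real ^ 'n::finite) set" where "far \<equiv> {\<xi>. 1 < norm \<xi>}"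

lemma open_far: "open U \<Longrightarrow> open (U \<times> far)"
  by (intro open_Times open_Collect_less continuous_intros) auto

text \<open>For small \<xi> the estimates follow from smoothness alone, as each derivative is
  continuous on the compact set \<open>K \<times> cball 0 1\<close>.\<close>

lemma symbol_on_UNIV_iff:
  fixes f :: "'n::finite symb"
  assumes "open U"
  shows "symbol_on U UNIV r f \<longleftrightarrow> smooth_on (U \<times> UNIV) f \<and> symbol_on U far r f"
proof
  assume R: "smooth_on (U \<times> UNIV) f \<and> symbol_on U far r f"
  have "bounded_order U UNIV (r - real (xi_count w)) (dderivs w f)" if "set w \<subseteq> Basis" for w
  proof (rule bounded_orderI)
    fix K assume K: "compact K" "K \<subseteq> U"
    let ?s = "r - real (xi_count w)"
    have "bounded_order U far ?s (dderivs w f)"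
      using R that unfolding symbol_on_def by blast
    then obtain C where C: "C \<ge> 0"
        "\<And>x \<xi>. x \<in> K \<Longrightarrow> \<xi> \<in> far \<Longrightarrow> norm (dderivs w f (x, \<xi>)) \<le> C * (1 + norm \<xi>) powr ?s"
      using bounded_orderE[OF _ K] by metis
    have "continuous_on (U \<times> UNIV) (dderivs w f)"
      using R smooth_on_dderivs smooth_on_continuous by blast
    then have "continuous_on (K \<times> cball 0 1) (dderivs w f)"
      by (rule continuous_on_subset) (use K in auto)
    then have "compact (dderivs w f ` (K \<times> cball 0 1))"
      using K by (intro compact_continuous_image compact_Times) auto
    then obtain B where B: "B > 0" "\<And>z. z \<in> K \<times> cball 0 1 \<Longrightarrow> norm (dderivs w f z) \<le> B"
      using compact_imp_bounded bounded_pos by (metis image_eqI)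
    have "norm (dderivs w f (x, \<xi>)) \<le> max C (B * 2 powr \<bar>?s\<bar>) * (1 + norm \<xi>) powr ?s"
      if x: "x \<in> K" for x \<xi>
    proof (cases "\<xi> \<in> far")
      case True
      show ?thesis by (rule order_trans[OF C(2)[OF x True]]) (simp add: mult_right_mono)
    next
      case False
      \<comment> \<open>Here \<open>1 + norm \<xi>\<close> lies between 1 and 2, so this factor
        lifts the weight to at least 1 for either sign of the exponent.\<close>
      have "1 \<le> 2 powr \<bar>?s\<bar> * (1 + norm \<xi>) powr ?s"
      proof (cases "?s \<ge> 0")
        case True
        then show ?thesis using ge_one_powr_ge_zero[of "1 + norm \<xi>" ?s] ge_one_powr_ge_zero[of 2 ?s]
          by (simp add: mult_ge1_I)
      next
        case neg: False
        have "2 powr ?s \<le> (1 + norm \<xi>) powr ?s"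
          using False neg by (intro powr_mono2') (auto intro: add_pos_nonneg)
        then have "2 powr (- ?s) * 2 powr ?s \<le> 2 powr (- ?s) * (1 + norm \<xi>) powr ?s"
          by (intro mult_left_mono) auto
        then show ?thesis using neg by (simp flip: powr_add)
      qed
      then have "B \<le> B * (2 powr \<bar>?s\<bar> * (1 + norm \<xi>) powr ?s)" using B(1) by simp
      also have "\<dots> = (B * 2 powr \<bar>?s\<bar>) * (1 + norm \<xi>) powr ?s" by simp
      also have "\<dots> \<le> max C (B * 2 powr \<bar>?s\<bar>) * (1 + norm \<xi>) powr ?s" by (intro mult_right_mono) auto
      finally show ?thesis using B(2)[of "(x, \<xi>)"] x False by simp
    qed
    then show "\<exists>C. \<forall>x\<in>K. \<forall>\<xi>\<in>UNIV. norm (dderivs w f (x, \<xi>)) \<le> C * (1 + norm \<xi>) powr ?s" by blast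
  qed
  then show "symbol_on U UNIV r f" unfolding symbol_on_def using R by blast
qed (auto intro: symbol_on_subset symbol_on_smooth)

section \<open>Homogeneous functions\<close>

lemma open_cotangent0: "open U \<Longrightarrow> open (cotangent0 U)"
  unfolding cotangent0_def by (auto intro: open_Times)

lemma pos_homogeneous_add:
  "open U \<Longrightarrow> pos_homogeneous U d f \<Longrightarrow> pos_homogeneous U d g \<Longrightarrow> pos_homogeneous U d (\<lambda>z. f z + g z)"
  unfolding pos_homogeneous_def by (auto intro: smooth_on_add open_cotangent0 simp: algebra_simps)

lemma pos_homogeneous_cmult:
  "open U \<Longrightarrow> pos_homogeneous U d f \<Longrightarrow> pos_homogeneous U d (\<lambda>z. c * f z)"
  unfolding pos_homogeneous_def by (auto intro: smooth_on_cmult open_cotangent0 simp: algebra_simps)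

lemma pos_homogeneous_0: "pos_homogeneous U d (\<lambda>z. 0)"
  unfolding pos_homogeneous_def by (auto intro: smooth_on_const)

lemma pos_homogeneous_sum:
  "open U \<Longrightarrow> (\<And>i. i \<in> I \<Longrightarrow> pos_homogeneous U d (f i)) \<Longrightarrow> pos_homogeneous U d (\<lambda>z. \<Sum>i\<in>I. f i z)"
  by (induction I rule: infinite_finite_induct) (auto intro: pos_homogeneous_0 pos_homogeneous_add)

lemma pos_homogeneous_mult:
  "open U \<Longrightarrow> pos_homogeneous U d f \<Longrightarrow> pos_homogeneous U e g \<Longrightarrow>
    pos_homogeneous U (d + e) (\<lambda>z. f z * g z)"
  unfolding pos_homogeneous_def
  by (auto intro: smooth_on_mult open_cotangent0 simp: powr_add)

text \<open>Differentiate the identity g(A w) = t^d g(w) for the linear map A(x, \<xi>) = (x, t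
  \<xi>): A fixes the x-directions and multiplies the \<xi>-directions by t, which must then be
  divided out.\<close>

lemma pos_homogeneous_dderiv:
  fixes g :: "'n::finite symb"
  assumes "open U" "pos_homogeneous U d g" "v \<in> Basis"
  shows "pos_homogeneous U (d - of_nat (xi_count [v])) (dderivs [v] g)"
  unfolding pos_homogeneous_def
proof (intro conjI ballI allI impI)
  have sm: "smooth_on (cotangent0 U) g" and hom: "\<And>x \<xi> t. x \<in> U \<Longrightarrow> t > 0 \<Longrightarrow> \<xi> \<noteq> 0 \<Longrightarrow>
      g (x, t *\<^sub>R \<xi>) = of_real t powr d * g (x, \<xi>)"
    using assms unfolding pos_homogeneous_def by auto
  show "smooth_on (cotangent0 U) (dderivs [v] g)" using sm smooth_on_dderivs by blast
  fix x \<xi> :: "real ^ 'n" and t :: real assume z: "x \<in> U" "0 < t" "\<xi> \<noteq> 0"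
  define A where "A = (\<lambda>z::'n tpoint. (fst z, t *\<^sub>R snd z))"
  have dA: "(A has_derivative A) (at w)" for w
    unfolding A_def by (auto intro!: derivative_eq_intros)
  have in0: "(x, \<xi>) \<in> cotangent0 U" "A (x, \<xi>) \<in> cotangent0 U"
    using z unfolding cotangent0_def A_def by auto
  have "(g has_derivative frechet_derivative g (at (A (x, \<xi>)))) (at (A (x, \<xi>)))"
    using sm in0 smooth_on_differentiable frechet_derivative_works by blast
  then have "((\<lambda>w. g (A w)) has_derivative (\<lambda>h. frechet_derivative g (at (A (x, \<xi>))) (A h))) (at (x, \<xi>))"
    using has_derivative_compose[OF dA] by blast
  then have 1: "frechet_derivative (\<lambda>w. g (A w)) (at (x, \<xi>)) v = frechet_derivative g (at (A (x, \<xi>))) (A v)"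
    by (metis frechet_derivative_at)
  have 2: "frechet_derivative (\<lambda>w. g (A w)) (at (x, \<xi>)) v = of_real t powr d * dderivs [v] g (x, \<xi>)"
  proof -
    have "frechet_derivative (\<lambda>w. g (A w)) (at (x, \<xi>)) = frechet_derivative (\<lambda>w. of_real t powr d * g w) (at (x, \<xi>))"
    proof (rule frechet_derivative_cong_open[OF open_cotangent0[OF assms(1)] in0(1)])
      fix w assume "w \<in> cotangent0 U"
      then obtain a b where "w = (a, b)" "a \<in> U" "b \<noteq> 0" unfolding cotangent0_def by auto
      then show "g (A w) = of_real t powr d * g w" using hom z by (simp add: A_def)
    qed
    then show ?thesis
      using dderivs_cmult[OF open_cotangent0[OF assms(1)] sm in0(1), of "[v]"] by simp
  qed
  have lin: "linear (frechet_derivative g (at (A (x, \<xi>))))"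
    using sm in0 smooth_on_differentiable frechet_derivative_works has_derivative_linear by blast
  consider i where "v = (axis i 1, 0)" | j where "v = (0, axis j 1)"
    using assms by (auto simp: Basis_tpoint)
  then show "dderivs [v] g (x, t *\<^sub>R \<xi>) = of_real t powr (d - of_nat (xi_count [v])) * dderivs [v] g (x, \<xi>)"
  proof cases
    case (1 i)
    then have "A v = v" unfolding A_def by simp
    then show ?thesis using \<open>frechet_derivative (\<lambda>w. g (A w)) (at (x, \<xi>)) v = frechet_derivative g (at (A (x, \<xi>))) (A v)\<close> 2 1
      by (simp add: A_def)
  next
    case (2 j)
    then have "A v = t *\<^sub>R v" unfolding A_def by simp
    then have "t *\<^sub>R dderivs [v] g (x, t *\<^sub>R \<xi>) = of_real t powr d * dderivs [v] g (x, \<xi>)"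
      using \<open>frechet_derivative (\<lambda>w. g (A w)) (at (x, \<xi>)) v = frechet_derivative g (at (A (x, \<xi>))) (A v)\<close>
        \<open>frechet_derivative (\<lambda>w. g (A w)) (at (x, \<xi>)) v = of_real t powr d * dderivs [v] g (x, \<xi>)\<close> lin
      by (simp add: A_def linear_cmul)
    then have "dderivs [v] g (x, t *\<^sub>R \<xi>) = of_real t powr d * dderivs [v] g (x, \<xi>) / of_real t"
      using z by (simp add: scaleR_conv_of_real field_simps)
    moreover have "complex_of_real t powr (d - 1) = of_real t powr d / of_real t"
      using z by (simp add: powr_diff)
    ultimately show ?thesis using 2 by simp
  qed
qed

lemma pos_homogeneous_dderivs:
  assumes "open U" "pos_homogeneous U d g" "set w \<subseteq> Basis"
  shows "pos_homogeneous U (d - of_nat (xi_count w)) (dderivs w g)"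
  using assms(3)
proof (induction w)
  case (Cons v w)
  then have "pos_homogeneous U (d - of_nat (xi_count w) - of_nat (xi_count [v])) (dderivs [v] (dderivs w g))"
    by (intro pos_homogeneous_dderiv assms) auto
  then show ?case by (simp add: algebra_simps)
qed (use assms in simp)

text \<open>From \<open>t \<le> 1 + t \<le> 2 * t\<close>, in a form that covers both signs of
  \<open>s\<close>.\<close>

lemma powr_1_plus_le:
  fixes s t :: real assumes "t \<ge> 1"
  shows "t powr s \<le> 2 powr \<bar>s\<bar> * (1 + t) powr s"
proof (cases "s \<ge> 0")
  case True
  then have "t powr s \<le> (1 + t) powr s" using assms by (intro powr_mono2) auto
  also have "\<dots> \<le> 2 powr \<bar>s\<bar> * (1 + t) powr s"
    using ge_one_powr_ge_zero[of 2 s] True by (simp add: mult_le_cancel_right1)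
  finally show ?thesis .
next
  case False
  then have "t powr s \<le> ((1 + t) / 2) powr s" using assms by (intro powr_mono2') auto
  also have "\<dots> = 2 powr \<bar>s\<bar> * (1 + t) powr s"
    using False assms by (simp add: powr_divide powr_minus_divide)
  finally show ?thesis .
qed

text \<open>Homogeneity reduces the estimate to \<open>K \<times> sphere 0 1\<close>, where
  compactness bounds the function.\<close>

lemma pos_homogeneous_bounded:
  fixes g :: "'n::finite symb"
  assumes "pos_homogeneous U d g"
  shows "bounded_order U far (Re d) g"
proof (rule bounded_orderI)
  fix K assume K: "compact K" "K \<subseteq> U"
  have "continuous_on (cotangent0 U) g"
    using assms smooth_on_continuous unfolding pos_homogeneous_def by blast
  then have "continuous_on (K \<times> sphere 0 1) g"
    by (rule continuous_on_subset) (use K in \<open>auto simp: cotangent0_def\<close>)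
  then have "compact (g ` (K \<times> sphere 0 1))"
    using K by (intro compact_continuous_image compact_Times) auto
  then obtain B where B: "B > 0" "\<And>z. z \<in> K \<times> sphere 0 1 \<Longrightarrow> norm (g z) \<le> B"
    using compact_imp_bounded bounded_pos by (metis image_eqI)
  have "norm (g (x, \<xi>)) \<le> (B * 2 powr \<bar>Re d\<bar>) * (1 + norm \<xi>) powr Re d"
    if x: "x \<in> K" and xi: "\<xi> \<in> far" for x \<xi>
  proof -
    have pos: "norm \<xi> > 1" "\<xi> \<noteq> 0" using xi by auto
    have "g (x, \<xi>) = g (x, norm \<xi> *\<^sub>R sgn \<xi>)" using pos by (simp add: sgn_div_norm)
    also have "\<dots> = of_real (norm \<xi>) powr d * g (x, sgn \<xi>)"
      using assms x K pos unfolding pos_homogeneous_def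
      by (metis subsetD norm_sgn zero_less_norm_iff norm_zero zero_neq_one)
    finally have "norm (g (x, \<xi>)) = norm \<xi> powr Re d * norm (g (x, sgn \<xi>))"
      using pos by (simp add: norm_mult norm_powr_real_powr)
    also have "\<dots> \<le> (2 powr \<bar>Re d\<bar> * (1 + norm \<xi>) powr Re d) * B"
      using B(2)[of "(x, sgn \<xi>)"] x pos by (intro mult_mono powr_1_plus_le) (auto simp: norm_sgn)
    finally show ?thesis by (simp add: mult_ac)
  qed
  then show "\<exists>C. \<forall>x\<in>K. \<forall>\<xi>\<in>far. norm (g (x, \<xi>)) \<le> C * (1 + norm \<xi>) powr Re d" by blast
qed

lemma pos_homogeneous_symbol_on:
  assumes "open U" "pos_homogeneous U d g"
  shows "symbol_on U far (Re d) g"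
  unfolding symbol_on_def
proof (intro conjI allI impI)
  have "smooth_on (cotangent0 U) g" using assms unfolding pos_homogeneous_def by blast
  then show "smooth_on (U \<times> far) g" by (rule smooth_on_subset) (auto simp: cotangent0_def)
  show "bounded_order U far (Re d - real (xi_count w)) (dderivs w g)" if "set w \<subseteq> Basis" for w
    using pos_homogeneous_bounded[OF pos_homogeneous_dderivs[OF assms that]] by simp
qed

section \<open>Classical symbols without cutoff\<close>

text \<open>The cutoff is \<open>1\<close> for \<open>|\<xi>| \<ge> 1\<close>, and where \<open>|\<xi>| \<le> 1\<close> the symbol estimates only say that the symbol is
  smooth.\<close>

definition classical :: "(real ^ 'n::finite) set \<Rightarrow> complex \<Rightarrow> 'n symb \<Rightarrow> (nat \<Rightarrow> 'n symb) \<Rightarrow> bool" where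
  "classical U m \<sigma> s \<longleftrightarrow> smooth_on (U \<times> UNIV) \<sigma> \<and> compact_x_support U \<sigma> \<and>
     (\<forall>i. pos_homogeneous U (m - of_nat i) (s i)) \<and>
     (\<forall>N. symbol_on U far (Re m - real N) (\<lambda>z. \<sigma> z - (\<Sum>i<N. s i z)))"

text \<open>Two open sets cover the cotangent space: off the zero section both factors are smooth,
  and for \<open>norm \<xi> < 1/2\<close> the product is identically 0, whatever \<open>g\<close> is
  at \<xi> = 0.\<close>

lemma smooth_on_cutoff_mult:
  assumes "open U" "cutoff U \<psi>" "smooth_on (cotangent0 U) g"
  shows "smooth_on (U \<times> UNIV) (\<lambda>z. \<psi> z * g z)"
proof -
  have "smooth_on (cotangent0 U) \<psi>"
    by (rule smooth_on_subset[of "cotangent U"])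
       (use assms in \<open>auto simp: cutoff_def cotangent_def cotangent0_def\<close>)
  then have 1: "smooth_on (cotangent0 U) (\<lambda>z. \<psi> z * g z)"
    using assms by (intro smooth_on_mult open_cotangent0)
  have 2: "smooth_on (U \<times> ball 0 (1/2)) (\<lambda>z. \<psi> z * g z)"
  proof (rule smooth_on_cong[of _ "\<lambda>_. 0"])
    show "0 = \<psi> z * g z" if "z \<in> U \<times> ball 0 (1 / 2)" for z
      using assms(2) that unfolding cutoff_def by auto
  qed (use assms in \<open>auto intro: open_Times smooth_on_const\<close>)
  show ?thesis
    by (rule smooth_on_subset[OF smooth_on_Un[OF 1 2]]) (auto simp: cotangent0_def)
qed

lemma classical_iff:
  fixes \<sigma> :: "'n::finite symb"
  assumes U: "open U" and \<psi>: "cutoff U \<psi>"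
  shows "\<sigma> \<in> CS_com \<psi> U m \<and> classical_expansion \<psi> U m \<sigma> s \<longleftrightarrow> classical U m \<sigma> s"
proof
  note far = open_far[OF U]
  have far1: "\<psi> z = 1" if "z \<in> U \<times> far" for z using \<psi> that unfolding cutoff_def by auto
  {
    assume L: "\<sigma> \<in> CS_com \<psi> U m \<and> classical_expansion \<psi> U m \<sigma> s"
    have hom: "pos_homogeneous U (m - of_nat i) (s i)" for i
      using L unfolding classical_expansion_def by blast
    have sym: "symbol_on U UNIV (Re m) \<sigma>" using L is_symbol_iff[OF U] unfolding CS_com_def by blast
    have big: "symbol_on U far (Re m - real N) (\<lambda>z. \<sigma> z - (\<Sum>i<N. s i z))" if N: "N \<ge> 2" for N
    proof (rule symbol_on_cong[OF far])
      \<comment> \<open>Shift by one: components up to and including \<open>M\<close> leave a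
        remainder of order m - M - 1, those below \<open>N = Suc M\<close> one of order m -
        N.\<close>
      obtain M where M: "N = Suc M" "M \<ge> 1" using N by (cases N) auto
      have "symbol_on U UNIV (Re m - real M - 1) (\<lambda>z. \<sigma> z - (\<Sum>i\<le>M. \<psi> z * s i z))"
        using L M is_symbol_iff[OF U] unfolding classical_expansion_def by blast
      then show "symbol_on U far (Re m - real N) (\<lambda>z. \<sigma> z - (\<Sum>i<N. \<psi> z * s i z))"
        using M by (auto intro: symbol_on_subset simp: lessThan_Suc_atMost algebra_simps)
    qed (use far1 in auto)
    have "symbol_on U far (Re m - real N) (\<lambda>z. \<sigma> z - (\<Sum>i<N. s i z))" for N
    proof -
      \<comment> \<open>The defining expansions have at least two components. No component at all is
        the symbol estimate itself; for \<open>N = 1\<close> the component \<open>s 1\<close>, of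
        order m - 1, is moved back into the remainder.\<close>
      consider "N = 0" | "N = 1" | "N \<ge> 2" by linarith
      then show ?thesis
      proof cases
        case 1 then show ?thesis using symbol_on_subset[OF sym] by simp
      next
        case 2
        have "symbol_on U far (Re m - real 1) (\<lambda>z. (\<sigma> z - (\<Sum>i<2. s i z)) + s 1 z)"
          using symbol_on_mono[OF big[of 2], of "Re m - 1"] pos_homogeneous_symbol_on[OF U hom[of 1]]
          by (intro symbol_on_add far) simp_all
        then show ?thesis using 2 by (simp add: numeral_2_eq_2)
      qed (use big in auto)
    qed
    then show "classical U m \<sigma> s"
      unfolding classical_def using L hom symbol_on_smooth[OF sym] unfolding CS_com_def by blast
  }
  {
    assume R: "classical U m \<sigma> s"
    then have "symbol_on U far (Re m - real 0) (\<lambda>z. \<sigma> z - (\<Sum>i<0. s i z))"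
      unfolding classical_def by blast
    then have 1: "is_symbol U (Re m) \<sigma>"
      using R symbol_on_UNIV_iff[OF U] is_symbol_iff[OF U] unfolding classical_def by simp
    have "is_symbol U (Re m - real N - 1) (\<lambda>z. \<sigma> z - (\<Sum>i\<le>N. \<psi> z * s i z))" for N
    proof -
      have "smooth_on (cotangent0 U) (s i)" for i
        using R unfolding classical_def pos_homogeneous_def by blast
      then have sm: "smooth_on (U \<times> UNIV) (\<lambda>z. \<sigma> z - (\<Sum>i\<le>N. \<psi> z * s i z))"
        using R U \<psi> unfolding classical_def
        by (intro smooth_on_diff smooth_on_sum smooth_on_cutoff_mult open_Times) auto
      have "symbol_on U far (Re m - real (Suc N)) (\<lambda>z. \<sigma> z - (\<Sum>i<Suc N. s i z))"
        using R unfolding classical_def by blast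
      then have "symbol_on U far (Re m - real N - 1) (\<lambda>z. \<sigma> z - (\<Sum>i<Suc N. s i z))"
        by (simp add: algebra_simps)
      then have "symbol_on U far (Re m - real N - 1) (\<lambda>z. \<sigma> z - (\<Sum>i\<le>N. \<psi> z * s i z))"
        by (rule symbol_on_cong[OF far]) (use far1 in \<open>simp add: lessThan_Suc_atMost\<close>)
      then show ?thesis using sm symbol_on_UNIV_iff[OF U] is_symbol_iff[OF U] by blast
    qed
    then have "classical_expansion \<psi> U m \<sigma> s"
      using R unfolding classical_expansion_def classical_def by blast
    then show "\<sigma> \<in> CS_com \<psi> U m \<and> classical_expansion \<psi> U m \<sigma> s"
      using 1 R unfolding CS_com_def classical_def by blast
  }
qed

section \<open>Closure properties of classical symbols\<close>

lemma classical_symbol_on: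
  assumes "open U" "classical U m a s"
  shows "symbol_on U UNIV (Re m) a"
proof -
  have "symbol_on U far (Re m - real 0) (\<lambda>z. a z - (\<Sum>i<0. s i z))"
    using assms unfolding classical_def by blast
  then show ?thesis using assms symbol_on_UNIV_iff[OF assms(1)] unfolding classical_def by simp
qed

lemma compact_x_support_add:
  assumes "compact_x_support U f" "compact_x_support U g"
  shows "compact_x_support U (\<lambda>z. f z + g z)"
proof -
  obtain K L where "compact K" "K \<subseteq> U" "\<forall>x\<in>U - K. \<forall>\<xi>. f (x, \<xi>) = 0"
    "compact L" "L \<subseteq> U" "\<forall>x\<in>U - L. \<forall>\<xi>. g (x, \<xi>) = 0"
    using assms unfolding compact_x_support_def by blast
  then show ?thesis unfolding compact_x_support_def by (intro exI[of _ "K \<union> L"]) auto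
qed

lemma compact_x_support_mult:
  "compact_x_support U f \<Longrightarrow> compact_x_support U (\<lambda>z. f z * g z)"
  unfolding compact_x_support_def by (metis mult_zero_left)

lemma compact_x_support_cmult:
  "compact_x_support U f \<Longrightarrow> compact_x_support U (\<lambda>z. c * f z)"
  unfolding compact_x_support_def by (metis mult_zero_right)

lemma compact_x_support_0: "compact_x_support U (\<lambda>z. 0)"
  unfolding compact_x_support_def by (intro exI[of _ "{}"]) auto

text \<open>Over the open set \<open>U - K\<close> the symbol is locally the zero function, so the
  same \<open>K\<close> serves for every derivative.\<close>

lemma compact_x_support_dderivs:
  assumes "open U" "compact_x_support U f"
  shows "compact_x_support U (dderivs w f)"
proof -
  obtain K where K: "compact K" "K \<subseteq> U" "\<forall>x\<in>U - K. \<forall>\<xi>. f (x, \<xi>) = 0"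
    using assms(2) unfolding compact_x_support_def by blast
  have "open ((U - K) \<times> UNIV)" using assms(1) K by (intro open_Times open_Diff compact_imp_closed) auto
  then have "dderivs w f (x, \<xi>) = dderivs w (\<lambda>_. 0) (x, \<xi>)" if "x \<in> U - K" for x \<xi>
    using K that by (intro dderivs_cong) auto
  then show ?thesis unfolding compact_x_support_def using K
    by (intro exI[of _ K]) (auto simp: dderivs_0)
qed

lemma classical_add:
  assumes "open U" "classical U m a s" "classical U m b t"
  shows "classical U m (\<lambda>z. a z + b z) (\<lambda>i z. s i z + t i z)"
  unfolding classical_def
proof (intro conjI allI)
  fix N
  have "symbol_on U far (Re m - real N) (\<lambda>z. (a z - (\<Sum>i<N. s i z)) + (b z - (\<Sum>i<N. t i z)))"
    using assms unfolding classical_def by (intro symbol_on_add open_far) auto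
  then show "symbol_on U far (Re m - real N) (\<lambda>z. a z + b z - (\<Sum>i<N. s i z + t i z))"
    by (simp add: sum.distrib algebra_simps)
qed (use assms in \<open>auto simp: classical_def
      intro: smooth_on_add compact_x_support_add pos_homogeneous_add open_Times\<close>)

lemma classical_cmult:
  assumes "open U" "classical U m a s"
  shows "classical U m (\<lambda>z. c * a z) (\<lambda>i z. c * s i z)"
  unfolding classical_def
proof (intro conjI allI)
  fix N
  have "symbol_on U far (Re m - real N) (\<lambda>z. c * (a z - (\<Sum>i<N. s i z)))"
    using assms unfolding classical_def by (intro symbol_on_cmult open_far) auto
  then show "symbol_on U far (Re m - real N) (\<lambda>z. c * a z - (\<Sum>i<N. c * s i z))"
    by (simp add: sum_distrib_left algebra_simps)
qed (use assms in \<open>auto simp: classical_def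
      intro: smooth_on_cmult compact_x_support_cmult pos_homogeneous_cmult open_Times\<close>)

lemma classical_0: "classical U m (\<lambda>z. 0) (\<lambda>i z. 0)"
  unfolding classical_def
  by (auto intro: smooth_on_const compact_x_support_0 pos_homogeneous_0 symbol_on_0)

lemma classical_sum:
  assumes "open U" "\<And>i. i \<in> I \<Longrightarrow> classical U m (a i) (s i)"
  shows "classical U m (\<lambda>z. \<Sum>i\<in>I. a i z) (\<lambda>k z. \<Sum>i\<in>I. s i k z)"
  using assms(2) by (induction I rule: infinite_finite_induct)
    (auto intro: classical_0 classical_add[OF assms(1)])

lemma classical_dderivs:
  assumes "open U" "classical U m a s" "set w \<subseteq> Basis"
  shows "classical U (m - of_nat (xi_count w)) (dderivs w a) (\<lambda>i. dderivs w (s i))"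
  unfolding classical_def
proof (intro conjI allI)
  show "smooth_on (U \<times> UNIV) (dderivs w a)"
    using assms smooth_on_dderivs unfolding classical_def by blast
  show "compact_x_support U (dderivs w a)"
    using assms compact_x_support_dderivs unfolding classical_def by blast
  have hom: "pos_homogeneous U (m - of_nat i) (s i)" for i
    using assms unfolding classical_def by blast
  have sm_s: "smooth_on (U \<times> far) (s i)" for i
    using pos_homogeneous_symbol_on[OF assms(1) hom] symbol_on_smooth by blast
  show "pos_homogeneous U (m - of_nat (xi_count w) - of_nat i) (dderivs w (s i))" for i
    using pos_homogeneous_dderivs[OF assms(1) hom assms(3), of i] by (simp add: algebra_simps)
  fix N
  have "symbol_on U far (Re m - real N - real (xi_count w)) (dderivs w (\<lambda>z. a z - (\<Sum>i<N. s i z)))"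
    using assms unfolding classical_def by (intro symbol_on_dderivs) auto
  then have "symbol_on U far (Re m - real N - real (xi_count w))
      (\<lambda>z. dderivs w a z - (\<Sum>i<N. dderivs w (s i) z))"
  proof (rule symbol_on_cong[OF open_far[OF assms(1)]])
    fix z :: "'a tpoint" assume z: "z \<in> U \<times> far"
    note O = open_far[OF assms(1)]
    have a: "smooth_on (U \<times> far) a"
      by (rule smooth_on_subset[of "U \<times> UNIV"]) (use assms in \<open>auto simp: classical_def\<close>)
    have s: "smooth_on (U \<times> far) (\<lambda>z. \<Sum>i<N. s i z)" by (intro smooth_on_sum O sm_s)
    have "dderivs w (\<lambda>z. a z + (- 1) * (\<Sum>i<N. s i z)) z
        = dderivs w a z + dderivs w (\<lambda>z. (- 1) * (\<Sum>i<N. s i z)) z"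
      by (rule dderivs_add[OF O a smooth_on_cmult[OF O s] z])
    also have "dderivs w (\<lambda>z. (- 1) * (\<Sum>i<N. s i z)) z = (- 1) * dderivs w (\<lambda>z. \<Sum>i<N. s i z) z"
      by (rule dderivs_cmult[OF O s z])
    also have "dderivs w (\<lambda>z. \<Sum>i<N. s i z) z = (\<Sum>i<N. dderivs w (s i) z)"
      by (rule dderivs_sum[OF O sm_s z])
    finally have "dderivs w (\<lambda>z. a z + (- 1) * (\<Sum>i<N. s i z)) z
        = dderivs w a z + (- 1) * (\<Sum>i<N. dderivs w (s i) z)" .
    then show "dderivs w (\<lambda>z. a z - (\<Sum>i<N. s i z)) z = dderivs w a z - (\<Sum>i<N. dderivs w (s i) z)"
      by simp
  qed
  then show "symbol_on U far (Re (m - of_nat (xi_count w)) - real N)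
      (\<lambda>z. dderivs w a z - (\<Sum>i<N. dderivs w (s i) z))"
    by (simp add: algebra_simps)
qed

lemma triangle_sum_reindex:
  fixes f :: "nat \<Rightarrow> nat \<Rightarrow> 'a::comm_monoid_add"
  shows "(\<Sum>i<N. \<Sum>k\<le>i. f k (i - k)) = (\<Sum>k<N. \<Sum>l<N - k. f k l)"
proof -
  have "(\<Sum>i<N. \<Sum>k\<le>i. f k (i - k)) = (\<Sum>(i, k)\<in>(SIGMA i:{..<N}. {..i}). f k (i - k))"
    by (simp add: sum.Sigma)
  also have "\<dots> = (\<Sum>(k, l)\<in>(SIGMA k:{..<N}. {..<N - k}). f k l)"
    by (rule sum.reindex_bij_witness[of _ "\<lambda>(k, l). (k + l, k)" "\<lambda>(i, k). (k, i - k)"]) auto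
  also have "\<dots> = (\<Sum>k<N. \<Sum>l<N - k. f k l)" by (simp add: sum.Sigma)
  finally show ?thesis .
qed

text \<open>The remainder of the product is split so that \<open>s k\<close> multiplies the
  remainder of \<open>b\<close> after \<open>N - k\<close> components, and the remainder of
  \<open>a\<close> multiplies all of \<open>b\<close>. Each piece then has order m + n - N, and what
  has been subtracted is the Cauchy product truncated at total index \<open>N\<close>.\<close>

lemma classical_mult:
  assumes U: "open U" and a: "classical U m a s" and b: "classical U n b t"
  shows "classical U (m + n) (\<lambda>z. a z * b z) (\<lambda>i z. \<Sum>k\<le>i. s k z * t (i - k) z)"
  unfolding classical_def
proof (intro conjI allI)
  show "smooth_on (U \<times> UNIV) (\<lambda>z. a z * b z)"
    using assms unfolding classical_def by (intro smooth_on_mult open_Times) auto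
  show "compact_x_support U (\<lambda>z. a z * b z)"
    using assms compact_x_support_mult unfolding classical_def by blast
  have hs: "pos_homogeneous U (m - of_nat i) (s i)" and ht: "pos_homogeneous U (n - of_nat i) (t i)" for i
    using assms unfolding classical_def by blast+
  show "pos_homogeneous U (m + n - of_nat i) (\<lambda>z. \<Sum>k\<le>i. s k z * t (i - k) z)" for i
  proof (rule pos_homogeneous_sum[OF U])
    fix k assume "k \<in> {..i}"
    then have e: "m - of_nat k + (n - of_nat (i - k)) = m + n - of_nat i" by (simp add: of_nat_diff)
    show "pos_homogeneous U (m + n - of_nat i) (\<lambda>z. s k z * t (i - k) z)"
      using pos_homogeneous_mult[OF U hs[of k] ht[of "i - k"]] unfolding e .
  qed
  fix N
  note O = open_far[OF U]
  have "symbol_on U far (Re (m + n) - real N) (\<lambda>z. (\<Sum>k<N. s k z * (b z - (\<Sum>l<N - k. t l z))))"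
  proof (rule symbol_on_sum[OF O])
    fix k assume k: "k \<in> {..<N}"
    have "symbol_on U far (Re (m - of_nat k) + (Re n - real (N - k))) (\<lambda>z. s k z * (b z - (\<Sum>l<N - k. t l z)))"
      using b by (intro symbol_on_mult O pos_homogeneous_symbol_on U hs) (auto simp: classical_def)
    moreover have e: "Re (m - of_nat k) + (Re n - real (N - k)) = Re (m + n) - real N"
      using k by (simp add: of_nat_diff)
    ultimately show "symbol_on U far (Re (m + n) - real N) (\<lambda>z. s k z * (b z - (\<Sum>l<N - k. t l z)))"
      unfolding e by blast
  qed
  moreover have "symbol_on U far (Re (m + n) - real N) (\<lambda>z. (a z - (\<Sum>k<N. s k z)) * b z)"
  proof -
    have "symbol_on U far (Re m - real N + Re n) (\<lambda>z. (a z - (\<Sum>k<N. s k z)) * b z)"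
      using a symbol_on_subset[OF classical_symbol_on[OF U b]]
      by (intro symbol_on_mult O) (auto simp: classical_def)
    then show ?thesis by (simp add: algebra_simps)
  qed
  ultimately have "symbol_on U far (Re (m + n) - real N)
      (\<lambda>z. (\<Sum>k<N. s k z * (b z - (\<Sum>l<N - k. t l z))) + (a z - (\<Sum>k<N. s k z)) * b z)"
    by (rule symbol_on_add[OF O])
  moreover have "(\<Sum>k<N. s k z * (b z - (\<Sum>l<N - k. t l z))) + (a z - (\<Sum>k<N. s k z)) * b z
      = a z * b z - (\<Sum>i<N. \<Sum>k\<le>i. s k z * t (i - k) z)" for z
    unfolding triangle_sum_reindex[of "\<lambda>k l. s k z * t l z"]
    by (simp add: right_diff_distrib left_diff_distrib sum_subtractf sum_distrib_left sum_distrib_right)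
  ultimately show "symbol_on U far (Re (m + n) - real N)
      (\<lambda>z. a z * b z - (\<Sum>i<N. \<Sum>k\<le>i. s k z * t (i - k) z))" by simp
qed

text \<open>Resummation of an expansion whose terms \<open>h k\<close> are themselves classical, of
  order m - k: their components are regrouped by total index. The composition formula for the left
  product is of this kind.\<close>

lemma classical_asymptotic_sum:
  assumes U: "open U" and f: "smooth_on (U \<times> UNIV) f" "compact_x_support U f"
    and h: "\<And>k. classical U (m - of_nat k) (h k) (u k)"
    and r: "\<And>N. symbol_on U far (Re m - real N) (\<lambda>z. f z - (\<Sum>k<N. h k z))"
  shows "classical U m f (\<lambda>i z. \<Sum>k\<le>i. u k (i - k) z)"
  unfolding classical_def
proof (intro conjI allI f)
  have hu: "pos_homogeneous U (m - of_nat k - of_nat i) (u k i)" for k i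
    using h unfolding classical_def by blast
  show "pos_homogeneous U (m - of_nat i) (\<lambda>z. \<Sum>k\<le>i. u k (i - k) z)" for i
  proof (rule pos_homogeneous_sum[OF U])
    fix k assume "k \<in> {..i}"
    then have e: "m - of_nat k - of_nat (i - k) = m - of_nat i" by (simp add: of_nat_diff)
    show "pos_homogeneous U (m - of_nat i) (u k (i - k))" using hu[of k "i - k"] unfolding e .
  qed
  fix N
  note O = open_far[OF U]
  have "symbol_on U far (Re m - real N) (\<lambda>z. \<Sum>k<N. h k z - (\<Sum>l<N - k. u k l z))"
  proof (rule symbol_on_sum[OF O])
    fix k assume "k \<in> {..<N}"
    then have e: "Re (m - of_nat k) - real (N - k) = Re m - real N" by (simp add: of_nat_diff)
    have "symbol_on U far (Re (m - of_nat k) - real (N - k)) (\<lambda>z. h k z - (\<Sum>l<N - k. u k l z))"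
      using h unfolding classical_def by blast
    then show "symbol_on U far (Re m - real N) (\<lambda>z. h k z - (\<Sum>l<N - k. u k l z))" unfolding e .
  qed
  then have "symbol_on U far (Re m - real N)
      (\<lambda>z. (f z - (\<Sum>k<N. h k z)) + (\<Sum>k<N. h k z - (\<Sum>l<N - k. u k l z)))"
    by (intro symbol_on_add O r)
  moreover have "(f z - (\<Sum>k<N. h k z)) + (\<Sum>k<N. h k z - (\<Sum>l<N - k. u k l z))
      = f z - (\<Sum>i<N. \<Sum>k\<le>i. u k (i - k) z)" for z
    unfolding triangle_sum_reindex[of "\<lambda>k l. u k l z"] by (simp add: sum_subtractf)
  ultimately show "symbol_on U far (Re m - real N) (\<lambda>z. f z - (\<Sum>i<N. \<Sum>k\<le>i. u k (i - k) z))" by simp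
qed

section \<open>Uniqueness of asymptotic expansions\<close>

text \<open>Induction on the number of exponents: \<open>F(s + h) - e\<^sup>a\<^sup>h F(s)\<close> has one exponential fewer than \<open>F\<close>.\<close>

lemma exp_sum_tendsto_0:
  fixes c :: "complex \<Rightarrow> complex"
  assumes "finite D" "\<And>d. d \<in> D \<Longrightarrow> Re d \<ge> 0"
    "((\<lambda>s. \<Sum>d\<in>D. c d * exp (d * of_real s)) \<longlongrightarrow> 0) at_top"
  shows "d \<in> D \<Longrightarrow> c d = 0"
  using assms
proof (induction D arbitrary: c d rule: finite_induct)
  case (insert a D)
  let ?F = "\<lambda>s::real. \<Sum>d\<in>insert a D. c d * exp (d * of_real s)"
  have F: "?F s = c a * exp (a * of_real s) + (\<Sum>d\<in>D. c d * exp (d * of_real s))" for s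
    using insert by simp
  have D0: "c d = 0" if d: "d \<in> D" for d
  proof -
    \<comment> \<open>Then \<open>(d - a) * h\<close> has modulus 1, so it is not a nonzero multiple
      of 2 \<pi> i, and the two exponentials at \<open>h\<close> differ.\<close>
    define h where "h = 1 / norm (d - a)"
    have da: "d \<noteq> a" using d insert by blast
    have "((\<lambda>s. ?F (h + s)) \<longlongrightarrow> 0) at_top"
      using filterlim_compose[OF insert.prems(3) filterlim_tendsto_add_at_top[OF tendsto_const filterlim_ident]] .
    then have "((\<lambda>s. ?F (h + s) - exp (a * of_real h) * ?F s) \<longlongrightarrow> 0 - exp (a * of_real h) * 0) at_top"
      by (intro tendsto_diff tendsto_mult insert.prems tendsto_const)
    moreover have "?F (h + s) - exp (a * of_real h) * ?F s
        = (\<Sum>d\<in>D. c d * (exp (d * of_real h) - exp (a * of_real h)) * exp (d * of_real s))" for s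
      unfolding F by (simp add: ring_distribs exp_add sum_distrib_left sum_subtractf mult_ac)
    ultimately have "c d * (exp (d * of_real h) - exp (a * of_real h)) = 0"
      using insert.IH[OF d, of "\<lambda>d. c d * (exp (d * of_real h) - exp (a * of_real h))"] insert.prems
      by simp
    moreover have "exp (d * of_real h) \<noteq> exp (a * of_real h)"
    proof
      assume "exp (d * of_real h) = exp (a * of_real h)"
      then have "exp ((d - a) * of_real h) = 1" by (simp add: left_diff_distrib exp_diff)
      then obtain n where n: "Re ((d - a) * of_real h) = 0" "Im ((d - a) * of_real h) = of_int (2 * n) * pi"
        using exp_eq_1 by blast
      have "norm ((d - a) * of_real h) = 1" unfolding h_def using da by (simp add: norm_mult norm_divide)
      then have "\<bar>of_int (2 * n) * pi\<bar> = 1" using n(2) cmod_eq_Im[OF n(1)] by simp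
      then have 1: "real_of_int \<bar>2 * n\<bar> * pi = 1" by (simp add: abs_mult)
      then have "2 * n \<noteq> 0" by auto
      then have "1 \<le> \<bar>2 * n\<bar>" by linarith
      then have "1 \<le> real_of_int \<bar>2 * n\<bar>" by linarith
      then have "pi \<le> real_of_int \<bar>2 * n\<bar> * pi" by simp
      then show False using 1 pi_gt3 by linarith
    qed
    ultimately show ?thesis by simp
  qed
  \<comment> \<open>Only the exponent \<open>a\<close> is left; as its real part is nonnegative, the
    exponential has modulus at least 1 for \<open>s \<ge> 0\<close>.\<close>
  have "c a = 0"
  proof -
    have "(\<Sum>d\<in>D. c d * exp (d * of_real s)) = 0" for s using D0 by (intro sum.neutral) simp
    then have "((\<lambda>s. c a * exp (a * of_real s)) \<longlongrightarrow> 0) at_top" using insert.prems(3) unfolding F by simp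
    then have lim: "((\<lambda>s. norm (c a * exp (a * of_real s))) \<longlongrightarrow> 0) at_top" by (rule tendsto_norm_zero)
    have "\<forall>\<^sub>F s in at_top. norm (c a) \<le> norm (c a * exp (a * of_real s))"
    proof (rule eventually_mono[OF eventually_ge_at_top[of 0]])
      fix s :: real assume "0 \<le> s"
      then have "0 \<le> Re a * s" using insert.prems by simp
      then show "norm (c a) \<le> norm (c a * exp (a * of_real s))"
        by (simp add: norm_mult mult_le_cancel_left1)
    qed
    then have "norm (c a) \<le> 0" by (rule tendsto_lowerbound[OF lim]) simp
    then show ?thesis by simp
  qed
  then show ?case using D0 insert.prems by auto
qed simp

text \<open>The exponentials whose exponents have negative real part tend to 0 by themselves and can
  be subtracted.\<close>

lemma exp_sum_coeff_0:
  fixes c :: "complex \<Rightarrow> complex"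
  assumes D: "finite D" and lim: "((\<lambda>s. \<Sum>d\<in>D. c d * exp (d * of_real s)) \<longlongrightarrow> 0) at_top"
    and d: "d \<in> D" "Re d \<ge> 0"
  shows "c d = 0"
proof -
  let ?D = "{d\<in>D. Re d \<ge> 0}"
  have "((\<lambda>s. \<Sum>d\<in>D - ?D. c d * exp (d * of_real s)) \<longlongrightarrow> 0) at_top"
  proof (rule tendsto_null_sum)
    fix e assume "e \<in> D - ?D"
    then have "Re e < 0" by auto
    then have "LIM s at_top. Re e * s :> at_bot"
      by (rule filterlim_tendsto_neg_mult_at_bot[OF tendsto_const _ filterlim_ident])
    then have "((\<lambda>s. exp (Re e * s)) \<longlongrightarrow> 0) at_top" by (rule filterlim_compose[OF exp_at_bot])
    then have "((\<lambda>s. norm (exp (e * of_real s))) \<longlongrightarrow> 0) at_top" by simp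
    then have "((\<lambda>s. exp (e * of_real s)) \<longlongrightarrow> 0) at_top" by (rule tendsto_norm_zero_cancel)
    then show "((\<lambda>s. c e * exp (e * of_real s)) \<longlongrightarrow> 0) at_top" by (rule tendsto_mult_right_zero)
  qed
  from tendsto_diff[OF lim this]
  have "((\<lambda>s. \<Sum>d\<in>?D. c d * exp (d * of_real s)) \<longlongrightarrow> 0) at_top"
    using D by (simp add: sum_diff)
  then show ?thesis using D d by (intro exp_sum_tendsto_0[of ?D]) auto
qed

text \<open>On the ray through \<xi> homogeneity turns the expansion into a finite sum of powers of
  t with constant coefficients. The condition on t places \<open>t *\<^sub>R \<xi>\<close> in
  \<open>far\<close>.\<close>

lemma classical_ray:
  fixes a :: "'n::finite symb"
  assumes "classical U m a s" "x \<in> U" "\<xi> \<noteq> 0"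
  shows "\<exists>C. \<forall>t>1 / norm \<xi>.
    norm (a (x, t *\<^sub>R \<xi>) - (\<Sum>i<N. of_real t powr (m - of_nat i) * s i (x, \<xi>))) \<le> C * t powr (Re m - real N)"
proof -
  let ?r = "Re m - real N"
  have bo: "bounded_order U far ?r (\<lambda>z. a z - (\<Sum>i<N. s i z))"
    using assms symbol_on_bounded unfolding classical_def by blast
  have K: "compact {x}" "{x} \<subseteq> U" using assms by auto
  obtain C where C0: "C \<ge> 0" "\<And>y \<xi>. y \<in> {x} \<Longrightarrow> \<xi> \<in> far \<Longrightarrow>
      norm (a (y, \<xi>) - (\<Sum>i<N. s i (y, \<xi>))) \<le> C * (1 + norm \<xi>) powr ?r"
    using bounded_orderE[OF bo K] by blast
  note C = C0(1) C0(2)[OF singletonI]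
  have "norm (a (x, t *\<^sub>R \<xi>) - (\<Sum>i<N. of_real t powr (m - of_nat i) * s i (x, \<xi>)))
      \<le> (C * (2 powr \<bar>?r\<bar> * norm \<xi> powr ?r)) * t powr ?r" if t: "t > 1 / norm \<xi>" for t
  proof -
    have t0: "t > 0" using t by (smt (verit) divide_nonneg_nonneg norm_ge_zero)
    have tx: "t * norm \<xi> > 1" using t assms(3) by (simp add: pos_divide_less_eq)
    have "s i (x, t *\<^sub>R \<xi>) = of_real t powr (m - of_nat i) * s i (x, \<xi>)" for i
      using assms t0 unfolding classical_def pos_homogeneous_def by blast
    then have "(\<Sum>i<N. of_real t powr (m - of_nat i) * s i (x, \<xi>)) = (\<Sum>i<N. s i (x, t *\<^sub>R \<xi>))"
      by (intro sum.cong refl) (rule sym)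
    moreover have "t *\<^sub>R \<xi> \<in> far" "norm (t *\<^sub>R \<xi>) = t * norm \<xi>" using tx t0 by simp_all
    ultimately have A: "norm (a (x, t *\<^sub>R \<xi>) - (\<Sum>i<N. of_real t powr (m - of_nat i) * s i (x, \<xi>)))
        \<le> C * (1 + t * norm \<xi>) powr ?r"
      using C(2)[of "t *\<^sub>R \<xi>"] by metis
    have B: "(1 + t * norm \<xi>) powr ?r \<le> 2 powr \<bar>?r\<bar> * (t * norm \<xi>) powr ?r"
    proof (cases "?r \<ge> 0")
      case True
      have "(1 + t * norm \<xi>) powr ?r \<le> (2 * (t * norm \<xi>)) powr ?r"
        using True tx by (intro powr_mono2) auto
      then show ?thesis using True tx by (simp add: powr_mult)
    next
      case False
      have "(1 + t * norm \<xi>) powr ?r \<le> 1 * (t * norm \<xi>) powr ?r"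
        using powr_mono2'[of ?r "t * norm \<xi>" "1 + t * norm \<xi>"] False tx by simp
      also have "\<dots> \<le> 2 powr \<bar>?r\<bar> * (t * norm \<xi>) powr ?r"
        by (intro mult_right_mono ge_one_powr_ge_zero) auto
      finally show ?thesis .
    qed
    show ?thesis using order_trans[OF A mult_left_mono[OF B C(1)]] t0 by (simp add: powr_mult mult_ac)
  qed
  then show ?thesis by blast
qed

text \<open>With t = exp u the powers of t become exponentials in u, and division by t^(Re d) makes
  the remainders vanish at infinity. A linear combination is treated because two representations of
  one function are to be compared, where a degree may come from several summands.\<close>

lemma homogeneous_coefficient_zero:
  fixes fs :: "'j \<Rightarrow> 'n::finite symb" and m :: "'j \<Rightarrow> complex"
  assumes J: "finite J" and cl: "\<And>j. j \<in> J \<Longrightarrow> classical U (m j) (fs j) (s j)"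
    and x: "x \<in> U" "\<xi> \<noteq> 0"
    and zero: "\<And>t. t > 0 \<Longrightarrow> (\<Sum>j\<in>J. c j * fs j (x, t *\<^sub>R \<xi>)) = 0"
  shows "(\<Sum>j\<in>J. c j * (\<Sum>i | m j - of_nat i = d. s j i (x, \<xi>))) = 0"
proof -
  \<comment> \<open>So large that every remainder has order below \<open>Re d\<close>; the sum of
    absolute values dominates each single order.\<close>
  obtain N where N: "real N > (\<Sum>j\<in>J. \<bar>Re (m j)\<bar>) - Re d" using reals_Archimedean2 by blast
  have NJ: "Re (m j) - real N < Re d" if "j \<in> J" for j
    using member_le_sum[of j J "\<lambda>j. \<bar>Re (m j)\<bar>"] that J N by auto
  define P where "P = J \<times> {..<N}"
  define h where "h = (\<lambda>(j, i). m j - of_nat i - of_real (Re d))"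
  define co where "co = (\<lambda>(j, i). c j * s j i (x, \<xi>))"
  have finP: "finite P" unfolding P_def using J by simp
  have "\<forall>j\<in>J. \<exists>C. \<forall>t>1 / norm \<xi>. norm (fs j (x, t *\<^sub>R \<xi>) - (\<Sum>i<N. of_real t powr (m j - of_nat i) * s j i (x, \<xi>)))
      \<le> C * t powr (Re (m j) - real N)"
    using classical_ray[OF cl x] by blast
  from bchoice[OF this] obtain C where C: "\<And>j t. j \<in> J \<Longrightarrow> t > 1 / norm \<xi> \<Longrightarrow>
      norm (fs j (x, t *\<^sub>R \<xi>) - (\<Sum>i<N. of_real t powr (m j - of_nat i) * s j i (x, \<xi>)))
      \<le> C j * t powr (Re (m j) - real N)" by blast
  define R where "R = (\<lambda>u::real. \<Sum>j\<in>J. c j * (fs j (x, exp u *\<^sub>R \<xi>)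
      - (\<Sum>i<N. of_real (exp u) powr (m j - of_nat i) * s j i (x, \<xi>))) * exp (- of_real (Re d) * of_real u))"
  have "(R \<longlongrightarrow> 0) at_top"
    unfolding R_def
  proof (rule tendsto_null_sum)
    fix j assume j: "j \<in> J"
    let ?f = "\<lambda>u::real. c j * (fs j (x, exp u *\<^sub>R \<xi>)
      - (\<Sum>i<N. of_real (exp u) powr (m j - of_nat i) * s j i (x, \<xi>))) * exp (- of_real (Re d) * of_real u)"
    show "(?f \<longlongrightarrow> 0) at_top"
    proof (rule Lim_null_comparison)
      have "\<forall>\<^sub>F u in at_top. exp u > 1 / norm \<xi>"
        by (rule filterlim_at_top_dense[THEN iffD1, OF exp_at_top, rule_format])
      then show "\<forall>\<^sub>F u in at_top. norm (?f u) \<le> norm (c j) * C j * exp ((Re (m j) - real N - Re d) * u)"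
      proof eventually_elim
        case (elim u)
        have "norm (?f u) = norm (c j) * norm (fs j (x, exp u *\<^sub>R \<xi>)
            - (\<Sum>i<N. of_real (exp u) powr (m j - of_nat i) * s j i (x, \<xi>))) * exp (- Re d * u)"
          by (simp add: norm_mult)
        also have "\<dots> \<le> norm (c j) * (C j * exp u powr (Re (m j) - real N)) * exp (- Re d * u)"
          by (intro mult_left_mono mult_right_mono C j elim) auto
        also have "\<dots> = norm (c j) * C j * (exp ((Re (m j) - real N) * u) * exp (- Re d * u))"
          by (simp add: powr_def)
        also have "exp ((Re (m j) - real N) * u) * exp (- Re d * u) = exp ((Re (m j) - real N - Re d) * u)"
          by (simp flip: exp_add add: algebra_simps)
        finally show ?case .
      qed
      have "LIM u at_top. (Re (m j) - real N - Re d) * u :> at_bot"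
        using NJ[OF j] by (intro filterlim_tendsto_neg_mult_at_bot[OF tendsto_const _ filterlim_ident]) simp
      then have "((\<lambda>u. exp ((Re (m j) - real N - Re d) * u)) \<longlongrightarrow> 0) at_top"
        by (rule filterlim_compose[OF exp_at_bot])
      then show "((\<lambda>u. norm (c j) * C j * exp ((Re (m j) - real N - Re d) * u)) \<longlongrightarrow> 0) at_top"
        by (rule tendsto_mult_right_zero)
    qed
  qed
  \<comment> \<open>The combination vanishes along the ray, so the truncated sums of powers equal
    minus the remainder. Pairs \<open>(j, i)\<close> of equal degree are collected through the
    fibres of \<open>h\<close>.\<close>
  moreover have "- R u = (\<Sum>q\<in>h ` P. (\<Sum>p | p \<in> P \<and> h p = q. co p) * exp (q * of_real u))" for u
  proof -
    have "(\<Sum>q\<in>h ` P. (\<Sum>p | p \<in> P \<and> h p = q. co p) * exp (q * of_real u))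
        = (\<Sum>q\<in>h ` P. \<Sum>p | p \<in> P \<and> h p = q. co p * exp (h p * of_real u))"
      by (intro sum.cong refl) (simp add: sum_distrib_right)
    also have "\<dots> = (\<Sum>p\<in>P. co p * exp (h p * of_real u))"
      using sum.image_gen[OF finP, of "\<lambda>p. co p * exp (h p * of_real u)" h] by simp
    also have "\<dots> = (\<Sum>j\<in>J. \<Sum>i<N. c j * s j i (x, \<xi>) * exp ((m j - of_nat i - of_real (Re d)) * of_real u))"
      unfolding P_def h_def co_def by (simp add: sum.cartesian_product case_prod_beta)
    also have "\<dots> = (\<Sum>j\<in>J. c j * (\<Sum>i<N. of_real (exp u) powr (m j - of_nat i) * s j i (x, \<xi>))
        * exp (- of_real (Re d) * of_real u))"
    proof -
      have "exp ((m j - of_nat i - of_real (Re d)) * of_real u)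
          = of_real (exp u) powr (m j - of_nat i) * exp (- of_real (Re d) * of_real u)" for i j
      proof -
        have "Ln (of_real (exp u)) = of_real u" by (subst Ln_of_real) simp_all
        then show ?thesis
          by (simp add: powr_def left_diff_distrib exp_diff exp_minus divide_inverse del: of_real_exp)
      qed
      then show ?thesis by (simp add: sum_distrib_left sum_distrib_right mult_ac)
    qed
    also have "\<dots> = (\<Sum>j\<in>J. c j * fs j (x, exp u *\<^sub>R \<xi>)) * exp (- of_real (Re d) * of_real u) - R u"
      unfolding R_def sum_distrib_right sum_subtractf[symmetric]
      by (intro sum.cong refl) (simp add: algebra_simps)
    finally show ?thesis using zero[of "exp u"] by simp
  qed
  ultimately have lim: "((\<lambda>u. \<Sum>q\<in>h ` P. (\<Sum>p | p \<in> P \<and> h p = q. co p) * exp (q * of_real u)) \<longlongrightarrow> 0) at_top"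
    using tendsto_minus[of R 0 at_top] by simp
  \<comment> \<open>The degree \<open>d\<close> corresponds to this purely imaginary exponent, the
    borderline case of real part 0 in \<open>exp_sum_coeff_0\<close>.\<close>
  define q where "q = d - of_real (Re d)"
  have z: "(\<Sum>p | p \<in> P \<and> h p = q. co p) = 0"
  proof (cases "q \<in> h ` P")
    case True
    then show ?thesis using exp_sum_coeff_0[OF _ lim True] finP by (simp add: q_def)
  next
    case False
    then have "p \<notin> {p. p \<in> P \<and> h p = q}" for p by blast
    then show ?thesis by (intro sum.neutral) blast
  qed
  \<comment> \<open>The truncation at \<open>N\<close> loses no pair of degree \<open>d\<close>,
    since components with index at least \<open>N\<close> have real degree below
    \<open>Re d\<close>.\<close>
  have "{p. p \<in> P \<and> h p = q} = (SIGMA j:J. {i. m j - of_nat i = d})"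
  proof -
    have "i < N" if "j \<in> J" "m j - of_nat i = d" for j i
    proof -
      have "Re (m j) - real i = Re d" using that(2) by auto
      then show ?thesis using NJ[OF that(1)] by simp
    qed
    then show ?thesis unfolding P_def h_def q_def by auto
  qed
  then have z: "(\<Sum>(j, i)\<in>(SIGMA j:J. {i. m j - of_nat i = d}). c j * s j i (x, \<xi>)) = 0"
    using z unfolding co_def by simp
  have "finite {i. m j - of_nat i = d}" for j
    by (rule finite_subset[of _ "{nat \<lfloor>Re (m j - d)\<rfloor>}"]) auto
  then show ?thesis using z J by (simp add: sum.Sigma[symmetric] sum_distrib_left)
qed

text \<open>The expansion of \<open>f\<close> itself is one admissible representation; any other one
  is compared with it along every ray.\<close>

lemma hom_component_classical:
  fixes f :: "'n::finite symb"
  assumes U: "open U" and \<psi>: "cutoff U \<psi>" and f: "classical U m f s"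
  shows "hom_component \<psi> U (m - of_nat i) f = (\<lambda>z. if z \<in> cotangent0 U then s i z else 0)"
  unfolding hom_component_def
proof (rule the_equality)
  let ?g = "\<lambda>z. if z \<in> cotangent0 U then s i z else 0"
  have [simp]: "{i'. m - of_nat i' = m - of_nat i} = {i}" by auto
  show "is_hom_component \<psi> U (m - of_nat i) f ?g"
    unfolding is_hom_component_def
    by (rule exI[of _ 1], rule exI[of _ "\<lambda>_. m"], rule exI[of _ "\<lambda>_. f"], rule exI[of _ "\<lambda>_. s"])
       (use f classical_iff[OF U \<psi>] in auto)
  fix g assume "is_hom_component \<psi> U (m - of_nat i) f g"
  then obtain k m' fs s' where fs: "\<And>j. j < k \<Longrightarrow> fs j \<in> CS_com \<psi> U (m' j) \<and>
        classical_expansion \<psi> U (m' j) (fs j) (s' j)"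
      and sum: "\<And>z. z \<in> cotangent U \<Longrightarrow> f z = (\<Sum>j<(k::nat). fs j z)"
      and g: "\<And>z. z \<in> cotangent0 U \<Longrightarrow> g z = (\<Sum>j<k. \<Sum>i' | m' j - of_nat i' = m - of_nat i. s' j i' z)"
      and g0: "\<And>z. z \<notin> cotangent0 U \<Longrightarrow> g z = 0"
    unfolding is_hom_component_def by blast
  show "g = ?g"
  proof
    fix z
    show "g z = ?g z"
    proof (cases "z \<in> cotangent0 U")
      case True
      then obtain x \<xi> where z: "z = (x, \<xi>)" "x \<in> U" "\<xi> \<noteq> 0" unfolding cotangent0_def by auto
      \<comment> \<open>The summands of the other representation with coefficient 1 and
        \<open>f\<close> with coefficient -1 form a combination that vanishes over
        \<open>U\<close>.\<close>
      let ?J = "{..<k} <+> {()}"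
      let ?m = "case_sum m' (\<lambda>_. m)" and ?fs = "case_sum fs (\<lambda>_. f)" and ?s = "case_sum s' (\<lambda>_. s)"
        and ?c = "case_sum (\<lambda>_. 1) (\<lambda>_. - 1) :: nat + unit \<Rightarrow> complex"
      have "(\<Sum>j\<in>?J. ?c j * (\<Sum>i' | ?m j - of_nat i' = m - of_nat i. ?s j i' (x, \<xi>))) = 0"
      proof (rule homogeneous_coefficient_zero[OF _ _ z(2,3)])
        show "classical U (?m j) (?fs j) (?s j)" if "j \<in> ?J" for j
          using that fs classical_iff[OF U \<psi>] f by auto
        show "(\<Sum>j\<in>?J. ?c j * ?fs j (x, t *\<^sub>R \<xi>)) = 0" if "t > 0" for t
          using sum[of "(x, t *\<^sub>R \<xi>)"] z by (simp add: sum.Plus cotangent_def)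
      qed simp
      then show ?thesis using g[OF True] True z by (simp add: sum.Plus)
    qed (use g0 in simp)
  qed
qed

text \<open>Order and leading component in one relation, with the lower components hidden. Equality
  is asked only off the zero section, where homogeneous functions have a meaning; \<open>g\<close>
  may be 0.\<close>

definition leads :: "(real ^ 'n::finite) set \<Rightarrow> complex \<Rightarrow> 'n symb \<Rightarrow> 'n symb \<Rightarrow> bool" where
  "leads U m f g \<longleftrightarrow> (\<exists>s. classical U m f s \<and> (\<forall>z\<in>cotangent0 U. s 0 z = g z))"

lemma hom_component_leads:
  assumes "open U" "cutoff U \<psi>" "leads U m f g"
  shows "hom_component \<psi> U m f = (\<lambda>z. if z \<in> cotangent0 U then g z else 0)"
proof -
  obtain s where s: "classical U m f s" "\<forall>z\<in>cotangent0 U. s 0 z = g z"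
    using assms unfolding leads_def by blast
  show ?thesis using hom_component_classical[OF assms(1,2) s(1), of 0] s(2) by auto
qed

lemma leads_CS_com:
  assumes "open U" "cutoff U \<psi>" "\<sigma> \<in> CS_com \<psi> U m"
  shows "leads U m \<sigma> (hom_component \<psi> U m \<sigma>)"
proof -
  obtain s where s: "classical U m \<sigma> s"
    using assms classical_iff[OF assms(1,2)] unfolding CS_com_def by blast
  have "\<forall>z\<in>cotangent0 U. s 0 z = hom_component \<psi> U m \<sigma> z"
    using hom_component_classical[OF assms(1,2) s, of 0] by simp
  then show ?thesis unfolding leads_def using s by blast
qed

lemma leads_homogeneous:
  assumes "open U" "leads U m f g"
  shows "pos_homogeneous U m g"
proof -
  obtain s where s: "classical U m f s" "\<And>z. z \<in> cotangent0 U \<Longrightarrow> s 0 z = g z"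
    using assms unfolding leads_def by blast
  have h: "pos_homogeneous U (m - of_nat 0) (s 0)" using s unfolding classical_def by blast
  have "g (x, t *\<^sub>R \<xi>) = of_real t powr m * g (x, \<xi>)" if "x \<in> U" "t > 0" "\<xi> \<noteq> 0" for x t \<xi>
    using h that s(2)[of "(x, t *\<^sub>R \<xi>)"] s(2)[of "(x, \<xi>)"]
    unfolding pos_homogeneous_def cotangent0_def by simp
  moreover have "smooth_on (cotangent0 U) g"
    by (rule smooth_on_cong[OF open_cotangent0[OF assms(1)] s(2)])
       (use h in \<open>auto simp: pos_homogeneous_def\<close>)
  ultimately show ?thesis unfolding pos_homogeneous_def by blast
qed

lemma leads_0: "leads U m (\<lambda>z. 0) (\<lambda>z. 0)"
  unfolding leads_def using classical_0 by blast

lemma leads_add: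
  assumes "open U" "leads U m f g" "leads U m f' g'"
  shows "leads U m (\<lambda>z. f z + f' z) (\<lambda>z. g z + g' z)"
proof -
  obtain s s' where "classical U m f s" "\<forall>z\<in>cotangent0 U. s 0 z = g z"
    "classical U m f' s'" "\<forall>z\<in>cotangent0 U. s' 0 z = g' z"
    using assms unfolding leads_def by blast
  then show ?thesis unfolding leads_def
    by (intro exI[of _ "\<lambda>i z. s i z + s' i z"]) (auto intro: classical_add assms)
qed

lemma leads_cmult:
  assumes "open U" "leads U m f g"
  shows "leads U m (\<lambda>z. c * f z) (\<lambda>z. c * g z)"
proof -
  obtain s where "classical U m f s" "\<forall>z\<in>cotangent0 U. s 0 z = g z"
    using assms unfolding leads_def by blast
  then show ?thesis unfolding leads_def
    by (intro exI[of _ "\<lambda>i z. c * s i z"]) (auto intro: classical_cmult assms)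
qed

lemma leads_sum:
  "open U \<Longrightarrow> (\<And>i. i \<in> I \<Longrightarrow> leads U m (f i) (g i)) \<Longrightarrow>
    leads U m (\<lambda>z. \<Sum>i\<in>I. f i z) (\<lambda>z. \<Sum>i\<in>I. g i z)"
  by (induction I rule: infinite_finite_induct) (auto intro: leads_0 leads_add)

lemma leads_mult:
  assumes "open U" "leads U m f g" "leads U m' f' g'"
  shows "leads U (m + m') (\<lambda>z. f z * f' z) (\<lambda>z. g z * g' z)"
proof -
  obtain s s' where "classical U m f s" "\<forall>z\<in>cotangent0 U. s 0 z = g z"
    "classical U m' f' s'" "\<forall>z\<in>cotangent0 U. s' 0 z = g' z"
    using assms unfolding leads_def by blast
  then show ?thesis unfolding leads_def
    by (intro exI[of _ "\<lambda>i z. \<Sum>k\<le>i. s k z * s' (i - k) z"]) (auto intro: classical_mult assms)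
qed

lemma leads_dderivs:
  assumes "open U" "leads U m f g" "set w \<subseteq> Basis"
  shows "leads U (m - of_nat (xi_count w)) (dderivs w f) (dderivs w g)"
proof -
  obtain s where s: "classical U m f s" "\<And>z. z \<in> cotangent0 U \<Longrightarrow> s 0 z = g z"
    using assms unfolding leads_def by blast
  have "dderivs w (s 0) z = dderivs w g z" if "z \<in> cotangent0 U" for z
    by (rule dderivs_cong[OF open_cotangent0[OF assms(1)] _ that]) (rule s(2))
  then show ?thesis unfolding leads_def
    using classical_dderivs[OF assms(1) s(1) assms(3)] by blast
qed

section \<open>Integrals over Euclidean spaces\<close>

lemma lborel_integral_shift:
  fixes f :: "'a::euclidean_space \<Rightarrow> complex"
  assumes "f \<in> borel_measurable borel"
  shows "(LINT x|lborel. f (c + x)) = (LINT x|lborel. f x)"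
  using integral_distr[of "(+) c" lborel borel f] assms by (simp add: lborel_distr_plus)

lemma lborel_integrable_shift:
  fixes f :: "'a::euclidean_space \<Rightarrow> complex"
  assumes "integrable lborel f"
  shows "integrable lborel (\<lambda>x. f (c + x))"
  using integrable_distr_eq[of "(+) c" lborel borel f] assms by (simp add: lborel_distr_plus)

lemma lborel_integral_scale:
  fixes f :: "'a::euclidean_space \<Rightarrow> complex"
  assumes "c > 0" "f \<in> borel_measurable borel"
  shows "(LINT x|lborel. f x) = of_real (c ^ DIM('a)) * (LINT x|lborel. f (c *\<^sub>R x))"
proof -
  have "(LINT x|lborel. f x)
      = (LINT x|density (distr lborel borel (\<lambda>x::'a. 0 + c *\<^sub>R x)) (\<lambda>_. \<bar>c\<bar> ^ DIM('a)). f x)"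
    using lborel_affine[of c "0::'a"] assms by simp
  also have "\<dots> = (LINT x|distr lborel borel (\<lambda>x::'a. 0 + c *\<^sub>R x). (\<bar>c\<bar> ^ DIM('a)) *\<^sub>R f x)"
    using assms by (intro integral_density) auto
  also have "\<dots> = (LINT x|lborel. (\<bar>c\<bar> ^ DIM('a)) *\<^sub>R f (0 + c *\<^sub>R x))"
    using assms by (intro integral_distr) auto
  finally show ?thesis using assms by (simp add: scaleR_conv_of_real)
qed

interpretation product_lborel: product_sigma_finite "\<lambda>_::'a::euclidean_space. lborel :: real measure"
  by standard

lemma
  fixes g :: "'a::euclidean_space \<Rightarrow> real \<Rightarrow> 'b::{real_normed_field, banach, second_countable_topology}"
  assumes g: "\<And>b. b \<in> Basis \<Longrightarrow> integrable lborel (g b)"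
  shows integrable_lborel_prod: "integrable lborel (\<lambda>x. \<Prod>b\<in>Basis. g b (x \<bullet> b))"
    and integral_lborel_prod: "(LINT x|lborel. (\<Prod>b\<in>Basis. g b (x \<bullet> b))) = (\<Prod>b\<in>Basis. LINT t|lborel. g b t)"
proof -
  let ?P = "\<Pi>\<^sub>M b\<in>(Basis :: 'a set). (lborel :: real measure)" and ?e = "\<lambda>f. \<Sum>b\<in>Basis. f b *\<^sub>R b :: 'a"
  have m [measurable]: "g b \<in> borel_measurable borel" if "b \<in> Basis" for b
    using borel_measurable_integrable[OF g[OF that]] by simp
  have L: "(lborel :: 'a measure) = distr ?P borel ?e" by (rule lborel_eq)
  have e: "?e \<in> measurable ?P borel" by measurable
  have f: "(\<lambda>x. \<Prod>b\<in>Basis. g b (x \<bullet> b)) \<in> borel_measurable borel"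
    by (intro borel_measurable_prod measurable_compose[OF _ m]) auto
  have c: "?e x \<bullet> b = x b" if "b \<in> Basis" for x b
    using that by (simp add: inner_sum_left inner_Basis if_distrib sum.delta cong: if_cong)
  have p: "integrable ?P (\<lambda>x. \<Prod>b\<in>Basis. g b (x b))"
    by (rule product_lborel.product_integrable_prod) (auto intro: g)
  show "integrable lborel (\<lambda>x. \<Prod>b\<in>Basis. g b (x \<bullet> b))"
    unfolding L integrable_distr_eq[OF e f] using p by (simp add: c cong: prod.cong)
  have "(LINT x|lborel. (\<Prod>b\<in>Basis. g b (x \<bullet> b))) = (LINT x|?P. (\<Prod>b\<in>Basis. g b (?e x \<bullet> b)))"
    unfolding L by (rule integral_distr[OF e f])
  also have "\<dots> = (LINT x|?P. (\<Prod>b\<in>Basis. g b (x b)))" by (simp add: c cong: prod.cong)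
  also have "\<dots> = (\<Prod>b\<in>Basis. LINT t|lborel. g b t)"
    by (rule product_lborel.product_integral_prod) (auto intro: g)
  finally show "(LINT x|lborel. (\<Prod>b\<in>Basis. g b (x \<bullet> b))) = (\<Prod>b\<in>Basis. LINT t|lborel. g b t)" .
qed

text \<open>The exponent is made for comparison with the product of the functions
  \<open>inverse (1 + (x \<bullet> b)\<^sup>2)\<close>: each coordinate uses up two powers of
  \<open>1 + norm x\<close>.\<close>

lemma integrable_inverse_power_norm:
  "integrable lborel (\<lambda>x::'a::euclidean_space. inverse ((1 + norm x) ^ (2 * DIM('a))))"
proof (rule Bochner_Integration.integrable_bound)
  have "integrable lborel (\<lambda>t::real. inverse (1 + t\<^sup>2))"
    using integrable_inverse_1_plus_square by (simp add: set_integrable_def)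
  then show "integrable lborel (\<lambda>x::'a. \<Prod>b\<in>Basis. inverse (1 + (x \<bullet> b)\<^sup>2))"
    by (intro integrable_lborel_prod)
  show "(\<lambda>x::'a. inverse ((1 + norm x) ^ (2 * DIM('a)))) \<in> borel_measurable lborel" by measurable
  have "inverse ((1 + norm x) ^ (2 * DIM('a))) \<le> (\<Prod>b\<in>Basis. inverse (1 + (x \<bullet> b)\<^sup>2))" for x :: 'a
  proof -
    have "inverse ((1 + norm x) ^ (2 * DIM('a))) = (\<Prod>b\<in>(Basis::'a set). inverse ((1 + norm x)\<^sup>2))"
      by (simp add: power_mult power_inverse)
    also have "\<dots> \<le> (\<Prod>b\<in>Basis. inverse (1 + (x \<bullet> b)\<^sup>2))"
    proof (intro prod_mono conjI le_imp_inverse_le)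
      fix b :: 'a assume "b \<in> Basis"
      then have "(x \<bullet> b)\<^sup>2 \<le> (norm x)\<^sup>2" using power_mono[OF Basis_le_norm[of b x], of 2] by simp
      then show "1 + (x \<bullet> b)\<^sup>2 \<le> (1 + norm x)\<^sup>2"
        by (simp add: power2_sum add_increasing2)
    qed (auto intro: add_pos_nonneg)
    finally show ?thesis .
  qed
  then show "AE x::'a in lborel. norm (inverse ((1 + norm x) ^ (2 * DIM('a))))
      \<le> norm (\<Prod>b\<in>Basis. inverse (1 + (x \<bullet> b)\<^sup>2))"
    by (auto simp: abs_of_nonneg prod_nonneg)
qed

lemma integrable_compact_support:
  fixes f :: "'a::euclidean_space \<Rightarrow> complex"
  assumes "continuous_on UNIV f" "\<And>x. norm x > R \<Longrightarrow> f x = 0"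
  shows "integrable lborel f"
proof -
  have "integrable lborel (\<lambda>x. indicator (cball 0 R) x *\<^sub>R f x)"
    by (rule borel_integrable_compact[OF compact_cball continuous_on_subset[OF assms(1) subset_UNIV]])
  moreover have "indicator (cball 0 R) x *\<^sub>R f x = f x" for x
    using assms(2)[of x] by (cases "norm x > R") (auto simp: indicator_def)
  ultimately show ?thesis by simp
qed

lemma continuous_on_compact_bound:
  fixes f :: "'a::topological_space \<Rightarrow> 'b::real_normed_vector"
  assumes "compact K" "continuous_on K f"
  obtains B where "B > 0" "\<And>x. x \<in> K \<Longrightarrow> norm (f x) \<le> B"
proof -
  have "bounded (f ` K)" using assms compact_continuous_image compact_imp_bounded by blast
  then show ?thesis using that unfolding bounded_pos by blast
qed

text \<open>The bound on the derivative gives, by the mean value inequality, the same bound on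
  difference quotients, so dominated convergence applies along every sequence tending to 0.\<close>

lemma has_derivative_parametric_integral:
  fixes F :: "'z::{real_normed_vector, perfect_space} \<Rightarrow> 'x \<Rightarrow> complex"
  assumes r: "r > 0"
    and int: "\<And>z. z \<in> ball z0 r \<Longrightarrow> integrable M (F z)"
    and der: "\<And>z x. z \<in> ball z0 r \<Longrightarrow> ((\<lambda>z. F z x) has_derivative F' z x) (at z)"
    and bound: "\<And>z x h. z \<in> ball z0 r \<Longrightarrow> norm (F' z x h) \<le> g x * norm h"
    and g: "integrable M g"
    and int': "\<And>h. integrable M (\<lambda>x. F' z0 x h)"
  shows "((\<lambda>z. LINT x|M. F z x) has_derivative (\<lambda>h. LINT x|M. F' z0 x h)) (at z0)"
  unfolding has_derivative_at
proof
  have z0: "z0 \<in> ball z0 r" using r by simp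
  have lin: "linear (F' z0 x)" for x using der[OF z0] has_derivative_linear by blast
  show "bounded_linear (\<lambda>h. LINT x|M. F' z0 x h)"
  proof (rule bounded_linear_intro)
    show "(LINT x|M. F' z0 x (h + k)) = (LINT x|M. F' z0 x h) + (LINT x|M. F' z0 x k)" for h k
      using int' by (simp add: linear_add[OF lin])
    show "(LINT x|M. F' z0 x (c *\<^sub>R h)) = c *\<^sub>R (LINT x|M. F' z0 x h)" for c h
      by (simp add: linear_cmul[OF lin])
    show "norm (LINT x|M. F' z0 x h) \<le> norm h * (LINT x|M. g x)" for h
    proof -
      have "norm (LINT x|M. F' z0 x h) \<le> (LINT x|M. norm (F' z0 x h))" by (rule integral_norm_bound)
      also have "\<dots> \<le> (LINT x|M. g x * norm h)"
        using int' g bound[OF z0] by (intro integral_mono) auto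
      finally have "norm (LINT x|M. F' z0 x h) \<le> (LINT x|M. g x * norm h)" .
      then show ?thesis by (simp add: mult.commute)
    qed
  qed
  have incr: "norm (F (z0 + h) x - F z0 x) \<le> g x * norm h" if "norm h < r" for h x
  proof -
    have "norm (F (z0 + h) x - F z0 x) \<le> g x * norm (z0 + h - z0)"
    proof (rule differentiable_bound[OF convex_ball[of z0 r]])
      show "((\<lambda>z. F z x) has_derivative F' z x) (at z within ball z0 r)" if "z \<in> ball z0 r" for z
        using der[OF that] has_derivative_at_withinI by blast
      show "onorm (F' z x) \<le> g x" if "z \<in> ball z0 r" for z
        using bound[OF that] by (intro onorm_le) auto
    qed (use r that in \<open>auto simp: dist_norm\<close>)
    then show ?thesis by simp
  qed
  show "((\<lambda>h. norm ((LINT x|M. F (z0 + h) x) - (LINT x|M. F z0 x) - (LINT x|M. F' z0 x h)) / norm h)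
      \<longlongrightarrow> 0) (at 0)"
    unfolding tendsto_at_iff_sequentially
  proof (intro allI impI)
    fix X :: "nat \<Rightarrow> 'z" assume X0: "\<forall>i. X i \<in> UNIV - {0}" and X: "X \<longlonglongrightarrow> 0"
    \<comment> \<open>Difference quotients are replaced by 0 where the increment leaves the ball,
      which happens for finitely many \<open>n\<close> only; the domination then holds for all
      \<open>n\<close>.\<close>
    define D where "D = (\<lambda>n x. if norm (X n) < r
      then (F (z0 + X n) x - F z0 x - F' z0 x (X n)) /\<^sub>R norm (X n) else 0)"
    have small: "\<forall>\<^sub>F n in sequentially. norm (X n) < r"
      using X r by (auto simp: tendsto_iff dist_norm)
    have lim: "(\<lambda>n. LINT x|M. D n x) \<longlonglongrightarrow> (LINT x|M. 0)"
    proof (rule integral_dominated_convergence)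
      show "D n \<in> borel_measurable M" for n
      proof (cases "norm (X n) < r")
        case True
        then have "integrable M (\<lambda>x. (F (z0 + X n) x - F z0 x - F' z0 x (X n)) /\<^sub>R norm (X n))"
          using int[of "z0 + X n"] int[OF z0] int' by (intro integrable_scaleR_right Bochner_Integration.integrable_diff) (auto simp: dist_norm)
        then show ?thesis using True unfolding D_def by simp
      qed (simp add: D_def)
      show "integrable M (\<lambda>x. 2 * g x)" using g by simp
      show "AE x in M. (\<lambda>n. D n x) \<longlonglongrightarrow> 0"
      proof (rule AE_I2)
        fix x
        have "((\<lambda>h. norm (F (z0 + h) x - F z0 x - F' z0 x h) / norm h) \<longlongrightarrow> 0) (at 0)"
          using der[OF z0, of x] unfolding has_derivative_at by blast
        then have "(\<lambda>n. norm (F (z0 + X n) x - F z0 x - F' z0 x (X n)) / norm (X n)) \<longlonglongrightarrow> 0"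
          using X0 X unfolding tendsto_at_iff_sequentially o_def by blast
        then have "(\<lambda>n. norm ((F (z0 + X n) x - F z0 x - F' z0 x (X n)) /\<^sub>R norm (X n))) \<longlonglongrightarrow> 0"
          by (simp add: divide_inverse mult.commute)
        then have "(\<lambda>n. (F (z0 + X n) x - F z0 x - F' z0 x (X n)) /\<^sub>R norm (X n)) \<longlonglongrightarrow> 0"
          by (rule tendsto_norm_zero_cancel)
        then show "(\<lambda>n. D n x) \<longlonglongrightarrow> 0"
          by (rule Lim_transform_eventually) (use small in \<open>auto simp: D_def elim: eventually_mono\<close>)
      qed
      show "AE x in M. norm (D n x) \<le> 2 * g x" for n
      proof (rule AE_I2)
        fix x
        have g0: "0 \<le> g x"
        proof -
          have "X n \<noteq> 0" using X0 by auto
          then have "0 < norm (X n)" by simp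
          moreover have "0 \<le> g x * norm (X n)" using bound[OF z0, of x "X n"] norm_ge_zero order_trans by blast
          ultimately show ?thesis by (simp add: zero_le_mult_iff)
        qed
        show "norm (D n x) \<le> 2 * g x"
        proof (cases "norm (X n) < r")
          case True
          have "norm (F (z0 + X n) x - F z0 x - F' z0 x (X n)) \<le> g x * norm (X n) + g x * norm (X n)"
            using incr[OF True, of x] bound[OF z0, of x "X n"] norm_triangle_ineq4 by (smt (verit))
          moreover have "norm (D n x) = norm (F (z0 + X n) x - F z0 x - F' z0 x (X n)) / norm (X n)"
            using True unfolding D_def by (simp add: divide_inverse mult.commute)
          ultimately show ?thesis using X0 by (simp add: pos_divide_le_eq)
        qed (use g0 in \<open>simp add: D_def\<close>)
      qed
    qed simp
    have "(\<lambda>n. norm (LINT x|M. D n x)) \<longlonglongrightarrow> 0"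
      using tendsto_norm_zero[of "\<lambda>n. LINT x|M. D n x"] lim by simp
    then show "((\<lambda>h. norm ((LINT x|M. F (z0 + h) x) - (LINT x|M. F z0 x) - (LINT x|M. F' z0 x h)) / norm h) \<circ> X)
        \<longlonglongrightarrow> 0"
    proof (rule Lim_transform_eventually)
      show "\<forall>\<^sub>F n in sequentially. norm (LINT x|M. D n x)
        = ((\<lambda>h. norm ((LINT x|M. F (z0 + h) x) - (LINT x|M. F z0 x) - (LINT x|M. F' z0 x h)) / norm h) \<circ> X) n"
        using small
      proof eventually_elim
        case (elim n)
        have "(LINT x|M. D n x)
            = ((LINT x|M. F (z0 + X n) x) - (LINT x|M. F z0 x) - (LINT x|M. F' z0 x (X n))) /\<^sub>R norm (X n)"
          using elim int[of "z0 + X n"] int[OF z0] int' unfolding D_def by (simp add: dist_norm)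
        then show ?case by (simp add: divide_inverse mult.commute)
      qed
    qed
  qed
qed

text \<open>The integral of \<open>u\<close> is invariant under the translations by \<open>t v\<close>.\<close>

lemma integral_directional_derivative_0:
  fixes u :: "'a::euclidean_space \<Rightarrow> complex"
  assumes u: "\<And>x. u differentiable (at x)" and cont: "continuous_on UNIV (\<lambda>x. frechet_derivative u (at x) v)"
    and R: "\<And>x. norm x > R \<Longrightarrow> u x = 0"
  shows "(LINT x|lborel. frechet_derivative u (at x) v) = 0"
proof -
  let ?u' = "\<lambda>x. frechet_derivative u (at x) v"
  have contu: "continuous_on UNIV u"
    using u differentiable_imp_continuous_within continuous_at_imp_continuous_on by blast
  have R': "?u' x = 0" if x: "norm x > R" for x
  proof -
    have "frechet_derivative u (at x) = frechet_derivative (\<lambda>_. 0) (at x)"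
      by (rule frechet_derivative_cong_open[of "{x. norm x > R}"])
         (use R x in \<open>auto intro!: open_Collect_less continuous_intros\<close>)
    then show ?thesis by (simp add: frechet_derivative_const)
  qed
  obtain B where B: "B > 0" "\<And>x. x \<in> cball 0 \<bar>R\<bar> \<Longrightarrow> norm (?u' x) \<le> B"
    using continuous_on_compact_bound[OF compact_cball continuous_on_subset[OF cont subset_UNIV]] by blast
  \<comment> \<open>For \<open>\<bar>t\<bar> < 1\<close> all translates of \<open>u\<close> by
    \<open>t *\<^sub>R v\<close> are supported in the ball of this radius.\<close>
  let ?L = "\<bar>R\<bar> + norm v"
  have "((\<lambda>t. LINT x|lborel. u (t *\<^sub>R v + x)) has_derivative
      (\<lambda>h. LINT x|lborel. h *\<^sub>R ?u' (0 *\<^sub>R v + x))) (at 0)"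
  proof (rule has_derivative_parametric_integral[where r = 1 and g = "\<lambda>x. B * indicator (cball 0 ?L) x"])
    show "integrable lborel (\<lambda>x. u (t *\<^sub>R v + x))" for t
      by (rule lborel_integrable_shift[OF integrable_compact_support[OF contu R]])
    show "((\<lambda>t. u (t *\<^sub>R v + x)) has_derivative (\<lambda>h. h *\<^sub>R ?u' (t *\<^sub>R v + x))) (at t)" for t x
    proof -
      have *: "(u has_derivative frechet_derivative u (at (t *\<^sub>R v + x))) (at (t *\<^sub>R v + x))"
        using u frechet_derivative_works by blast
      have "((\<lambda>t. u (t *\<^sub>R v + x)) has_derivative (\<lambda>h. frechet_derivative u (at (t *\<^sub>R v + x)) (h *\<^sub>R v))) (at t)"
        by (rule has_derivative_compose[of "\<lambda>t. t *\<^sub>R v + x" _ t, OF _ *])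
           (auto intro!: derivative_eq_intros)
      then show ?thesis using linear_cmul[OF has_derivative_linear[OF *]] by simp
    qed
    show "norm (h *\<^sub>R ?u' (t *\<^sub>R v + x)) \<le> B * indicator (cball 0 ?L) x * norm h"
      if t: "t \<in> ball 0 1" for t x h
    proof (cases "norm (t *\<^sub>R v + x) > R")
      case False
      have "norm (t *\<^sub>R v) \<le> norm v" using t by (auto intro: mult_left_le_one_le)
      then have "norm x \<le> ?L"
        using norm_triangle_ineq4[of "t *\<^sub>R v + x" "t *\<^sub>R v"] False by simp
      moreover have "norm (?u' (t *\<^sub>R v + x)) \<le> B" using False by (intro B) simp
      moreover from this have "\<bar>h\<bar> * norm (?u' (t *\<^sub>R v + x)) \<le> \<bar>h\<bar> * B" by (intro mult_left_mono) auto
      ultimately show ?thesis by (simp add: mult.commute)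
    qed (use R' B in auto)
    show "integrable lborel (\<lambda>x::'a. B * indicator (cball 0 ?L) x)"
      using emeasure_lborel_cball_finite[of "0::'a" ?L]
      by (intro integrable_mult_right integrable_real_indicator) auto
    show "integrable lborel (\<lambda>x. h *\<^sub>R ?u' (0 *\<^sub>R v + x))" for h
      using integrable_compact_support[OF cont R'] by simp
  qed simp
  moreover have "(LINT x|lborel. u (t *\<^sub>R v + x)) = (LINT x|lborel. u x)" for t
    by (rule lborel_integral_shift) (use contu borel_measurable_continuous_onI in auto)
  ultimately have "((\<lambda>t::real. LINT x|lborel. u x) has_derivative (\<lambda>h. h *\<^sub>R (LINT x|lborel. ?u' x))) (at 0)"
    by simp
  then have "(\<lambda>h::real. h *\<^sub>R (LINT x|lborel. ?u' x)) = (\<lambda>_. 0)"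
    using has_derivative_unique has_derivative_const by blast
  then show ?thesis by (metis scaleR_one)
qed

section \<open>Fourier inversion\<close>

text \<open>Without normalisation: the powers of 2 \<pi> appear in the inversion formula and are
  divided out in \<open>star_integral\<close>.\<close>

definition fourier :: "('a::euclidean_space \<Rightarrow> complex) \<Rightarrow> 'a \<Rightarrow> complex" where
  "fourier u \<zeta> = (LINT w|lborel. cis (- (w \<bullet> \<zeta>)) * u w)"

lemma continuous_on_compose_cis [continuous_intros]:
  "continuous_on S f \<Longrightarrow> continuous_on S (\<lambda>x. cis (f x))"
  unfolding cis_conv_exp by (intro continuous_intros)

lemma fourier_integrable:
  assumes "continuous_on UNIV u" "\<And>x. norm x > R \<Longrightarrow> u x = 0"
  shows "integrable lborel (\<lambda>w. cis (- (w \<bullet> \<zeta>)) * u w)"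
  by (rule integrable_compact_support[where R = R])
     (use assms in \<open>auto intro!: continuous_intros\<close>)

lemma fourier_measurable [measurable]:
  fixes u :: "'a::euclidean_space \<Rightarrow> complex"
  assumes [measurable]: "u \<in> borel_measurable borel"
  shows "fourier u \<in> borel_measurable borel"
proof -
  have "(\<lambda>x::'a \<times> 'a. cis (- (snd x \<bullet> fst x))) \<in> borel_measurable borel"
    by (intro borel_measurable_continuous_onI continuous_intros)
  then have [measurable]: "(\<lambda>x::'a \<times> 'a. cis (- (snd x \<bullet> fst x))) \<in> borel_measurable (borel \<Otimes>\<^sub>M lborel)"
    by (simp add: borel_prod measurable_cong_sets[OF sets_pair_measure_cong[OF refl sets_lborel] refl])
  have "(\<lambda>\<zeta>. LINT w|lborel. cis (- (w \<bullet> \<zeta>)) * u w) \<in> borel_measurable borel"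
    by (rule lborel.borel_measurable_lebesgue_integral) (simp add: case_prod_beta)
  then show ?thesis unfolding fourier_def[abs_def] .
qed

text \<open>Integration by parts: the derivative of the compactly supported function
  \<open>cis (- (w \<bullet> \<zeta>)) * u w\<close> has integral 0.\<close>

lemma fourier_derivative:
  fixes u :: "'a::euclidean_space \<Rightarrow> complex"
  assumes u: "\<And>x. u differentiable (at x)" and cont: "continuous_on UNIV (\<lambda>x. frechet_derivative u (at x) v)"
    and R: "\<And>x. norm x > R \<Longrightarrow> u x = 0"
  shows "fourier (\<lambda>x. frechet_derivative u (at x) v) \<zeta> = \<i> * of_real (v \<bullet> \<zeta>) * fourier u \<zeta>"
proof -
  let ?u' = "\<lambda>x. frechet_derivative u (at x) v" and ?c = "\<lambda>w. cis (- (w \<bullet> \<zeta>))"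
  have contu: "continuous_on UNIV u"
    using u differentiable_imp_continuous_within continuous_at_imp_continuous_on by blast
  have R': "?u' x = 0" if x: "norm x > R" for x
  proof -
    have "frechet_derivative u (at x) = frechet_derivative (\<lambda>_. 0) (at x)"
      by (rule frechet_derivative_cong_open[of "{x. norm x > R}"])
         (use R x in \<open>auto intro!: open_Collect_less continuous_intros\<close>)
    then show ?thesis by (simp add: frechet_derivative_const)
  qed
  have dc: "(?c has_derivative (\<lambda>h. - \<i> * of_real (h \<bullet> \<zeta>) * ?c w)) (at w)" for w
  proof -
    have "((\<lambda>w. \<i> * of_real (- (w \<bullet> \<zeta>))) has_derivative (\<lambda>h. \<i> * of_real (- (h \<bullet> \<zeta>)))) (at w)"
      by (auto intro!: derivative_eq_intros)
    from has_derivative_compose[OF this has_field_derivative_imp_has_derivative[OF DERIV_exp]]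
    show ?thesis unfolding cis_conv_exp by (simp add: mult_ac)
  qed
  have d: "((\<lambda>w. ?c w * u w) has_derivative (\<lambda>h. ?c w * frechet_derivative u (at w) h
      + - \<i> * of_real (h \<bullet> \<zeta>) * ?c w * u w)) (at w)" for w
    using has_derivative_mult[OF dc u[of w, unfolded frechet_derivative_works]] .
  have eq: "frechet_derivative (\<lambda>w. ?c w * u w) (at w) v
      = ?c w * ?u' w + - \<i> * of_real (v \<bullet> \<zeta>) * (?c w * u w)" for w
    unfolding frechet_derivative_at[OF d[of w], symmetric] by (simp add: mult.assoc)
  have "(LINT w|lborel. frechet_derivative (\<lambda>w. ?c w * u w) (at w) v) = 0"
  proof (rule integral_directional_derivative_0)
    show "(\<lambda>w. ?c w * u w) differentiable at x" for x using d differentiable_def by blast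
    show "continuous_on UNIV (\<lambda>x. frechet_derivative (\<lambda>w. ?c w * u w) (at x) v)"
      unfolding eq using cont contu by (intro continuous_intros)
  qed (use R in auto)
  moreover have "(LINT w|lborel. frechet_derivative (\<lambda>w. ?c w * u w) (at w) v)
      = fourier ?u' \<zeta> + - \<i> * of_real (v \<bullet> \<zeta>) * fourier u \<zeta>"
    unfolding eq fourier_def
    using fourier_integrable[OF cont R', where \<zeta> = \<zeta>] fourier_integrable[OF contu R, where \<zeta> = \<zeta>]
    by (subst Bochner_Integration.integral_add) auto
  ultimately show ?thesis by (simp add: eq_neg_iff_add_eq_0)
qed

section \<open>The Gaussian and inversion at the origin\<close>

definition gauss :: "'a::euclidean_space \<Rightarrow> real" where
  "gauss x = (\<Prod>b\<in>Basis. exp (- (x \<bullet> b)\<^sup>2 / 2))"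

text \<open>The characteristic function of the standard normal distribution, freed of its
  normalising factor.\<close>

lemma gauss_1:
  "integrable lborel (\<lambda>t::real. of_real (exp (- t\<^sup>2 / 2)) * cis (- (s * t)))"
  "(LINT t|lborel. of_real (exp (- t\<^sup>2 / 2)) * cis (- (s * t))) = of_real (sqrt (2 * pi) * exp (- s\<^sup>2 / 2))"
proof -
  have e: "complex_of_real (exp (- t\<^sup>2 / 2)) * cis (- (s * t))
      = of_real (sqrt (2 * pi)) * (std_normal_density t *\<^sub>R iexp (- s * t))" for t
    by (simp add: std_normal_density_def scaleR_conv_of_real cis_conv_exp mult_ac)
  have "integrable lborel std_normal_density" using integrable_std_normal_moment[of 0] by simp
  then have i: "integrable lborel (\<lambda>t. std_normal_density t *\<^sub>R iexp (- s * t))"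
    by (rule Bochner_Integration.integrable_bound) (auto simp: normal_density_nonneg)
  then show "integrable lborel (\<lambda>t::real. of_real (exp (- t\<^sup>2 / 2)) * cis (- (s * t)))"
    unfolding e by (intro integrable_mult_right)
  have "(LINT t|lborel. std_normal_density t *\<^sub>R iexp (- s * t)) = char std_normal_distribution (- s)"
    unfolding char_def by (subst integral_density) (auto simp: normal_density_nonneg)
  then show "(LINT t|lborel. of_real (exp (- t\<^sup>2 / 2)) * cis (- (s * t))) = of_real (sqrt (2 * pi) * exp (- s\<^sup>2 / 2))"
    unfolding e integral_mult_right_zero by (simp add: char_std_normal_distribution)
qed

lemma cis_sum: "finite I \<Longrightarrow> cis (\<Sum>i\<in>I. f i) = (\<Prod>i\<in>I. cis (f i))"
  by (induction I rule: finite_induct) (simp_all add: cis_mult[symmetric])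

text \<open>\<open>gauss\<close> is exp(-|x|^2/2) written as a product over the coordinates, so that
  the integral factors into those of \<open>gauss_1\<close>.\<close>

lemma fourier_gauss:
  fixes v :: "'a::euclidean_space"
  shows "integrable lborel (\<lambda>\<zeta>. of_real (gauss \<zeta>) * cis (- (v \<bullet> \<zeta>)))"
    "(LINT \<zeta>|lborel. of_real (gauss \<zeta>) * cis (- (v \<bullet> \<zeta>))) = of_real (sqrt (2 * pi) ^ DIM('a) * gauss v)"
proof -
  have e: "of_real (gauss \<zeta>) * cis (- (v \<bullet> \<zeta>))
      = (\<Prod>b\<in>Basis. of_real (exp (- (\<zeta> \<bullet> b)\<^sup>2 / 2)) * cis (- ((v \<bullet> b) * (\<zeta> \<bullet> b))))" for \<zeta>
  proof -
    have "- (v \<bullet> \<zeta>) = (\<Sum>b\<in>Basis. - ((v \<bullet> b) * (\<zeta> \<bullet> b)))"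
      by (simp add: euclidean_inner[of v \<zeta>] sum_negf)
    then show ?thesis by (simp add: gauss_def prod.distrib cis_sum)
  qed
  show "integrable lborel (\<lambda>\<zeta>. of_real (gauss \<zeta>) * cis (- (v \<bullet> \<zeta>)))"
    unfolding e by (intro integrable_lborel_prod gauss_1)
  have "(LINT \<zeta>|lborel. of_real (gauss \<zeta>) * cis (- (v \<bullet> \<zeta>)))
      = (\<Prod>b\<in>Basis. LINT t|lborel. of_real (exp (- t\<^sup>2 / 2)) * cis (- ((v \<bullet> b) * t)))"
    unfolding e by (rule integral_lborel_prod) (rule gauss_1)
  also have "\<dots> = of_real (sqrt (2 * pi) ^ DIM('a) * gauss v)"
    unfolding gauss_1(2) by (simp add: gauss_def prod.distrib)
  finally show "(LINT \<zeta>|lborel. of_real (gauss \<zeta>) * cis (- (v \<bullet> \<zeta>)))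
      = of_real (sqrt (2 * pi) ^ DIM('a) * gauss v)" .
qed

lemma gauss_integrable: "integrable lborel (\<lambda>x::'a::euclidean_space. complex_of_real (gauss x))"
  and gauss_integral: "(LINT x::'a|lborel. complex_of_real (gauss x)) = of_real (sqrt (2 * pi) ^ DIM('a))"
  using fourier_gauss[of "0::'a"] by (simp_all add: gauss_def)

lemma gauss_bounds: "0 \<le> gauss x" "gauss x \<le> 1"
  unfolding gauss_def by (auto intro: prod_nonneg prod_le_1)

lemma gauss_continuous: "continuous_on S gauss"
  unfolding gauss_def by (intro continuous_intros) auto

text \<open>With the Gaussian cutoff \<open>gauss (\<epsilon> \<zeta>)\<close>, inversion is Fubini's theorem; then let \<open>\<epsilon>\<close> tend to \<open>0\<close>.\<close>

lemma fourier_inversion_0: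
  fixes u :: "'a::euclidean_space \<Rightarrow> complex"
  assumes cont: "continuous_on UNIV u" and R: "\<And>x. norm x > R \<Longrightarrow> u x = 0"
    and int: "integrable lborel (fourier u)"
  shows "(LINT \<zeta>|lborel. fourier u \<zeta>) = of_real ((2 * pi) ^ DIM('a)) * u 0"
proof -
  have um [measurable]: "u \<in> borel_measurable borel" using cont borel_measurable_continuous_onI by blast
  have gm [measurable]: "(gauss :: 'a \<Rightarrow> real) \<in> borel_measurable borel"
    using gauss_continuous borel_measurable_continuous_onI by blast
  obtain B where B: "B > 0" "\<And>x. x \<in> cball 0 R \<Longrightarrow> norm (u x) \<le> B"
    using continuous_on_compact_bound[OF compact_cball continuous_on_subset[OF cont subset_UNIV]] by blast
  then have B': "norm (u x) \<le> B" for x using R[of x] by (cases "norm x > R") auto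
  \<comment> \<open>Substituting w = \<epsilon> v in the transform yields the power of \<epsilon>
    that the substitution \<epsilon> \<zeta> in the outer integral absorbs. After Fubini the
    Gaussian meets the exponential and becomes a Gaussian in v.\<close>
  have key: "(LINT \<zeta>|lborel. of_real (gauss (\<epsilon> *\<^sub>R \<zeta>)) * fourier u \<zeta>)
      = of_real (sqrt (2 * pi) ^ DIM('a)) * (LINT v|lborel. u (\<epsilon> *\<^sub>R v) * of_real (gauss v))"
    if \<epsilon>: "\<epsilon> > 0" for \<epsilon>
  proof -
    let ?f = "\<lambda>\<zeta> v. of_real (gauss \<zeta>) * (cis (- (v \<bullet> \<zeta>)) * u (\<epsilon> *\<^sub>R v))"
    have uc: "continuous_on UNIV (\<lambda>v. u (\<epsilon> *\<^sub>R v))"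
      by (rule continuous_on_compose2[OF cont]) (auto intro!: continuous_intros)
    have u0: "u (\<epsilon> *\<^sub>R v) = 0" if "R / \<epsilon> < norm v" for v
      using that \<epsilon> by (intro R) (simp add: pos_divide_less_eq mult.commute)
    have cm: "(\<lambda>x::'a \<times> 'a. cis (- (snd x \<bullet> fst x))) \<in> borel_measurable (lborel \<Otimes>\<^sub>M lborel)"
      unfolding lborel_prod by (simp add: borel_measurable_continuous_onI continuous_intros)
    have fint: "integrable (lborel \<Otimes>\<^sub>M lborel) (\<lambda>(\<zeta>, v). ?f \<zeta> v)"
    proof (rule lborel_pair.Fubini_integrable)
      show "(\<lambda>(\<zeta>, v). ?f \<zeta> v) \<in> borel_measurable (lborel \<Otimes>\<^sub>M lborel)"
        using cm unfolding case_prod_beta by measurable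
      have "integrable lborel (\<lambda>\<zeta>::'a. norm (complex_of_real (gauss \<zeta>)) * (LINT v|lborel. norm (u (\<epsilon> *\<^sub>R v))))"
        using gauss_integrable by (intro integrable_mult_left integrable_norm)
      then show "integrable lborel (\<lambda>\<zeta>. LINT v|lborel. norm (case (\<zeta>, v) of (\<zeta>, v) \<Rightarrow> ?f \<zeta> v))"
        by (simp add: norm_mult)
      show "AE \<zeta> in lborel. integrable lborel (\<lambda>v. case (\<zeta>, v) of (\<zeta>, v) \<Rightarrow> ?f \<zeta> v)"
        using fourier_integrable[OF uc u0] by simp
    qed
    have sc: "(LINT w|lborel. cis (- (w \<bullet> \<zeta>)) * u w)
        = of_real (\<epsilon> ^ DIM('a)) * (LINT v|lborel. cis (- (v \<bullet> (\<epsilon> *\<^sub>R \<zeta>))) * u (\<epsilon> *\<^sub>R v))" for \<zeta>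
      by (subst lborel_integral_scale[OF \<epsilon>])
         (auto intro!: borel_measurable_times borel_measurable_continuous_onI continuous_intros cont)
    have mm: "(\<lambda>\<zeta>. of_real (gauss \<zeta>) * (LINT v|lborel. cis (- (v \<bullet> \<zeta>)) * u (\<epsilon> *\<^sub>R v))) \<in> borel_measurable borel"
      using fourier_measurable[of "\<lambda>v. u (\<epsilon> *\<^sub>R v)"] unfolding fourier_def[abs_def] by measurable
    have "(LINT \<zeta>|lborel. of_real (gauss (\<epsilon> *\<^sub>R \<zeta>)) * fourier u \<zeta>)
        = of_real (\<epsilon> ^ DIM('a)) * (LINT \<zeta>|lborel. of_real (gauss (\<epsilon> *\<^sub>R \<zeta>)) *
          (LINT v|lborel. cis (- (v \<bullet> (\<epsilon> *\<^sub>R \<zeta>))) * u (\<epsilon> *\<^sub>R v)))"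
      unfolding fourier_def sc integral_mult_right_zero[symmetric]
      by (intro Bochner_Integration.integral_cong refl mult.left_commute)
    also have "\<dots> = (LINT \<zeta>|lborel. of_real (gauss \<zeta>) * (LINT v|lborel. cis (- (v \<bullet> \<zeta>)) * u (\<epsilon> *\<^sub>R v)))"
      by (rule lborel_integral_scale[OF \<epsilon> mm, symmetric])
    also have "\<dots> = (LINT \<zeta>|lborel. LINT v|lborel. ?f \<zeta> v)" by simp
    also have "\<dots> = (LINT v|lborel. LINT \<zeta>|lborel. ?f \<zeta> v)"
      by (rule lborel_pair.Fubini_integral[OF fint, symmetric])
    also have "\<dots> = (LINT v|lborel. u (\<epsilon> *\<^sub>R v) * (LINT \<zeta>|lborel. of_real (gauss \<zeta>) * cis (- (v \<bullet> \<zeta>))))"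
      by (simp flip: integral_mult_right_zero add: mult_ac)
    also have "\<dots> = (LINT v|lborel. of_real (sqrt (2 * pi) ^ DIM('a)) * (u (\<epsilon> *\<^sub>R v) * of_real (gauss v)))"
      unfolding fourier_gauss(2) by (simp add: mult_ac)
    finally show ?thesis by simp
  qed
  \<comment> \<open>Dominated convergence is applied along a sequence; the dominating functions are
    \<open>norm (fourier u \<zeta>)\<close> on one side and a multiple of the Gaussian on the
    other.\<close>
  define e where "e = (\<lambda>k::nat. inverse (real (Suc k)))"
  have e: "e k > 0" for k unfolding e_def by simp
  have e0: "e \<longlonglongrightarrow> 0" unfolding e_def by (rule LIMSEQ_inverse_real_of_nat)
  have l1: "(\<lambda>k. LINT \<zeta>|lborel. of_real (gauss (e k *\<^sub>R \<zeta>)) * fourier u \<zeta>) \<longlonglongrightarrow> (LINT \<zeta>|lborel. fourier u \<zeta>)"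
  proof (rule integral_dominated_convergence)
    show "integrable lborel (\<lambda>\<zeta>. norm (fourier u \<zeta>))" using int by simp
    show "AE \<zeta> in lborel. (\<lambda>k. of_real (gauss (e k *\<^sub>R \<zeta>)) * fourier u \<zeta>) \<longlonglongrightarrow> fourier u \<zeta>"
    proof (rule AE_I2)
      fix \<zeta> :: 'a
      have "(\<lambda>k. e k *\<^sub>R \<zeta>) \<longlonglongrightarrow> 0 *\<^sub>R \<zeta>" by (intro tendsto_intros e0)
      then have "(\<lambda>k. gauss (e k *\<^sub>R \<zeta>)) \<longlonglongrightarrow> gauss (0 *\<^sub>R \<zeta>)"
        using continuous_on_tendsto_compose[OF gauss_continuous[of UNIV]] by auto
      then have "(\<lambda>k. gauss (e k *\<^sub>R \<zeta>)) \<longlonglongrightarrow> 1" by (simp add: gauss_def)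
      then have "(\<lambda>k. of_real (gauss (e k *\<^sub>R \<zeta>)) * fourier u \<zeta>) \<longlonglongrightarrow> of_real 1 * fourier u \<zeta>"
        by (intro tendsto_intros)
      then show "(\<lambda>k. of_real (gauss (e k *\<^sub>R \<zeta>)) * fourier u \<zeta>) \<longlonglongrightarrow> fourier u \<zeta>" by simp
    qed
    show "AE \<zeta> in lborel. norm (of_real (gauss (e k *\<^sub>R \<zeta>)) * fourier u \<zeta>) \<le> norm (fourier u \<zeta>)" for k
      by (intro AE_I2) (simp add: norm_mult mult_left_le_one_le gauss_bounds)
  qed auto
  have l2: "(\<lambda>k. LINT v|lborel. u (e k *\<^sub>R v) * of_real (gauss v)) \<longlonglongrightarrow> (LINT v::'a|lborel. u 0 * of_real (gauss v))"
  proof (rule integral_dominated_convergence)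
    show "integrable lborel (\<lambda>v::'a. B * norm (complex_of_real (gauss v)))"
      using gauss_integrable by (intro integrable_mult_right integrable_norm)
    show "AE v in lborel. (\<lambda>k. u (e k *\<^sub>R v) * of_real (gauss v)) \<longlonglongrightarrow> u 0 * of_real (gauss v)"
    proof (rule AE_I2)
      fix v :: 'a
      have "(\<lambda>k. e k *\<^sub>R v) \<longlonglongrightarrow> 0 *\<^sub>R v" by (intro tendsto_intros e0)
      then have "(\<lambda>k. u (e k *\<^sub>R v)) \<longlonglongrightarrow> u (0 *\<^sub>R v)"
        using continuous_on_tendsto_compose[OF cont] by auto
      then have "(\<lambda>k. u (e k *\<^sub>R v)) \<longlonglongrightarrow> u 0" by simp
      then show "(\<lambda>k. u (e k *\<^sub>R v) * of_real (gauss v)) \<longlonglongrightarrow> u 0 * of_real (gauss v)"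
        by (intro tendsto_intros)
    qed
    show "AE v in lborel. norm (u (e k *\<^sub>R v) * of_real (gauss v)) \<le> B * norm (complex_of_real (gauss v))" for k
      using B' by (simp add: norm_mult mult_right_mono)
  qed auto
  have "(\<lambda>k. LINT \<zeta>|lborel. of_real (gauss (e k *\<^sub>R \<zeta>)) * fourier u \<zeta>)
      \<longlonglongrightarrow> of_real (sqrt (2 * pi) ^ DIM('a)) * (LINT v::'a|lborel. u 0 * of_real (gauss v))"
    unfolding key[OF e] by (intro tendsto_intros l2)
  then have "(LINT \<zeta>|lborel. fourier u \<zeta>)
      = of_real (sqrt (2 * pi) ^ DIM('a)) * (LINT v::'a|lborel. u 0 * of_real (gauss v))"
    using l1 LIMSEQ_unique by blast
  also have "\<dots> = of_real (sqrt (2 * pi) ^ DIM('a) * sqrt (2 * pi) ^ DIM('a)) * u 0"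
    using gauss_integral[where 'a = 'a] by simp
  \<comment> \<open>One power of sqrt(2 \<pi>) comes from the Fourier transform of the Gaussian, the
    other from its integral.\<close>
  also have "sqrt (2 * pi) ^ DIM('a) * sqrt (2 * pi) ^ DIM('a) = (sqrt (2 * pi) * sqrt (2 * pi)) ^ DIM('a)"
    by (rule power_mult_distrib[symmetric])
  also have "sqrt (2 * pi) * sqrt (2 * pi) = 2 * pi" by simp
  finally show ?thesis .
qed

section \<open>The composition formula\<close>

text \<open>The class of second factors after extension by zero: symbols over all of space, because
  the translated argument x + w leaves \<open>U\<close>, with support bounded in x uniformly in
  \<xi>.\<close>

definition comp_symbol :: "real \<Rightarrow> 'n::finite symb \<Rightarrow> bool" where
  "comp_symbol s b \<longleftrightarrow> symbol_on UNIV UNIV s b \<and> (\<exists>R. \<forall>x \<xi>. norm x > R \<longrightarrow> b (x, \<xi>) = 0)"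

lemma comp_symbol_dderiv_zero:
  fixes b :: "'n::finite symb"
  assumes "\<And>x \<xi>. norm x > R \<Longrightarrow> b (x, \<xi>) = 0" "norm x > R"
  shows "dderivs w b (x, \<xi>) = 0"
proof -
  have "dderivs w b (x, \<xi>) = dderivs w (\<lambda>_. 0) (x, \<xi>)"
    by (rule dderivs_cong[of "{x. R < norm x} \<times> UNIV"])
       (use assms in \<open>auto intro!: open_Times open_Collect_less continuous_intros\<close>)
  then show ?thesis by (simp add: dderivs_0)
qed

lemma comp_symbol_smooth: "comp_symbol s b \<Longrightarrow> smooth_on UNIV b"
  unfolding comp_symbol_def using symbol_on_smooth by fastforce

lemma comp_symbol_dderiv:
  assumes "comp_symbol s b"
  shows "comp_symbol s (dderivs [v] b)"
    and "v \<in> Basis \<Longrightarrow> comp_symbol (s - real (xi_count [v])) (dderivs [v] b)"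
proof -
  obtain R where R: "\<And>x \<xi>. norm x > R \<Longrightarrow> b (x, \<xi>) = 0" using assms unfolding comp_symbol_def by blast
  have R': "\<exists>R. \<forall>x \<xi>. norm x > R \<longrightarrow> dderivs [v] b (x, \<xi>) = 0"
    using comp_symbol_dderiv_zero[where w = "[v]" and b = b and R = R] R by blast
  have b: "symbol_on UNIV UNIV s b" using assms unfolding comp_symbol_def by blast
  have O: "open (UNIV \<times> UNIV :: ((real ^ 'a) \<times> (real ^ 'a)) set)" by simp
  show "comp_symbol s (dderivs [v] b)"
    unfolding comp_symbol_def using symbol_on_dderiv_any[OF O b] R' by blast
  show "v \<in> Basis \<Longrightarrow> comp_symbol (s - real (xi_count [v])) (dderivs [v] b)"
    unfolding comp_symbol_def using symbol_on_dderiv_basis[OF b] R' by blast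
qed

lemma comp_symbol_dderivs_x:
  assumes "comp_symbol s b"
  shows "comp_symbol s (dderivs (map (\<lambda>e. (e, 0)) J) b)"
proof (induction J)
  case (Cons e J)
  then show ?case using comp_symbol_dderiv(1)[OF Cons, of "(e, 0)"] by simp
qed (use assms in simp)

text \<open>Centring the Fourier integral at \<open>x\<close> makes \<open>z\<close> enter only through a translation of \<open>b\<close>, so that
  derivatives in \<open>z\<close> fall on \<open>b\<close>.\<close>

definition partial_fourier :: "'n::finite symb \<Rightarrow> 'n tpoint \<Rightarrow> real ^ 'n \<Rightarrow> complex" where
  "partial_fourier b z = fourier (\<lambda>w. b (z + (w, 0)))"

text \<open>What the Fourier lemmas require of a slice. Its support bound depends on
  \<open>z\<close>, since the slice is centred there.\<close>

lemma comp_symbol_slice: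
  fixes b :: "'n::finite symb"
  assumes b: "comp_symbol s b"
  shows "(\<lambda>w. b (z + (w, 0))) differentiable (at w)"
    and "frechet_derivative (\<lambda>w. b (z + (w, 0))) (at w) e = dderivs [(e, 0)] b (z + (w, 0))"
    and "continuous_on UNIV (\<lambda>w. b (z + (w, 0)))"
    and "\<exists>R. \<forall>w. norm w > R \<longrightarrow> b (z + (w, 0)) = 0"
proof -
  have d: "((\<lambda>w. b (z + (w, 0))) has_derivative
      (\<lambda>h. frechet_derivative b (at (z + (w, 0))) (h, 0))) (at w)" for w
  proof -
    have "b differentiable (at (z + (w, 0)))"
      using smooth_on_differentiable[OF comp_symbol_smooth[OF b]] by simp
    then have *: "(b has_derivative frechet_derivative b (at (z + (w, 0)))) (at (z + (w, 0)))"
      using frechet_derivative_works by blast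
    have "((\<lambda>w. z + (w, 0)) has_derivative (\<lambda>h. (h, 0))) (at w)"
      by (auto intro!: derivative_eq_intros)
    from has_derivative_compose[OF this *] show ?thesis .
  qed
  show diff: "(\<lambda>w. b (z + (w, 0))) differentiable (at w)" for w using d differentiable_def by blast
  show "frechet_derivative (\<lambda>w. b (z + (w, 0))) (at w) e = dderivs [(e, 0)] b (z + (w, 0))"
    unfolding frechet_derivative_at[OF d[of w], symmetric] by simp
  show "continuous_on UNIV (\<lambda>w. b (z + (w, 0)))"
    using diff differentiable_imp_continuous_within continuous_at_imp_continuous_on by blast
  obtain R where R: "\<And>x \<xi>. norm x > R \<Longrightarrow> b (x, \<xi>) = 0" using b unfolding comp_symbol_def by blast
  have "b (z + (w, 0)) = 0" if "norm w > R + norm (fst z)" for w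
  proof -
    have "norm (fst z + w) > R" using norm_triangle_ineq4[of "fst z + w" "fst z"] that by simp
    then show ?thesis using R[of "fst z + w" "snd z"] by (simp add: plus_prod_def)
  qed
  then show "\<exists>R. \<forall>w. norm w > R \<longrightarrow> b (z + (w, 0)) = 0" by blast
qed

section \<open>Estimates for the partial Fourier transform\<close>

lemma partial_fourier_measurable: "comp_symbol s b \<Longrightarrow> partial_fourier b z \<in> borel_measurable borel"
  unfolding partial_fourier_def
  using fourier_measurable borel_measurable_continuous_onI comp_symbol_slice(3) by blast

lemma partial_fourier_integrable:
  "comp_symbol s b \<Longrightarrow> integrable lborel (\<lambda>w. cis (- (w \<bullet> \<zeta>)) * b (z + (w, 0)))"
proof -
  assume b: "comp_symbol s b"
  obtain R where R: "\<And>w. norm w > R \<Longrightarrow> b (z + (w, 0)) = 0" using comp_symbol_slice(4)[OF b] by blast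
  show ?thesis by (rule fourier_integrable[OF comp_symbol_slice(3)[OF b] R])
qed

lemma partial_fourier_dderiv_x:
  assumes b: "comp_symbol s b"
  shows "partial_fourier (dderivs [(e, 0)] b) z \<zeta> = \<i> * of_real (e \<bullet> \<zeta>) * partial_fourier b z \<zeta>"
proof -
  obtain R where R: "\<And>w. norm w > R \<Longrightarrow> b (z + (w, 0)) = 0" using comp_symbol_slice(4)[OF b] by blast
  have "fourier (\<lambda>w. frechet_derivative (\<lambda>w. b (z + (w, 0))) (at w) e) \<zeta>
      = \<i> * of_real (e \<bullet> \<zeta>) * fourier (\<lambda>w. b (z + (w, 0))) \<zeta>"
  proof (rule fourier_derivative[OF comp_symbol_slice(1)[OF b] _ R])
    show "continuous_on UNIV (\<lambda>x. frechet_derivative (\<lambda>w. b (z + (w, 0))) (at x) e)"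
      unfolding comp_symbol_slice(2)[OF b] by (rule comp_symbol_slice(3)[OF comp_symbol_dderiv(1)[OF b]])
  qed
  then show ?thesis unfolding partial_fourier_def comp_symbol_slice(2)[OF b] .
qed

lemma partial_fourier_dderivs_x:
  fixes b :: "'n::finite symb"
  assumes b: "comp_symbol s b"
  shows "partial_fourier (dderivs (map (\<lambda>e. (e, 0)) J) b) z \<zeta> = \<i> ^ length J * of_real (\<Prod>e\<leftarrow>J. e \<bullet> \<zeta>) * partial_fourier b z \<zeta>"
proof (induction J)
  case (Cons e J)
  have "partial_fourier (dderivs (map (\<lambda>e. (e, 0)) (e # J)) b) z \<zeta>
      = partial_fourier (dderivs [(e, 0)] (dderivs (map (\<lambda>e. (e, 0)) J) b)) z \<zeta>" by simp
  also have "\<dots> = \<i> * of_real (e \<bullet> \<zeta>) * partial_fourier (dderivs (map (\<lambda>e. (e, 0)) J) b) z \<zeta>"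
    by (rule partial_fourier_dderiv_x[OF comp_symbol_dderivs_x[OF b]])
  finally show ?case using Cons by simp
qed simp

text \<open>In the uncentred form the support does not move with x, so that bounds become uniform in
  x.\<close>

lemma partial_fourier_shift:
  fixes b :: "'n::finite symb"
  assumes b: "comp_symbol s b"
  shows "partial_fourier b (x, \<xi>) \<zeta> = (LINT y|lborel. cis (- ((y - x) \<bullet> \<zeta>)) * b (y, \<xi>))"
proof -
  have "continuous_on UNIV (\<lambda>y. b (y, \<xi>))"
    using comp_symbol_slice(3)[OF b, of "(0, \<xi>)"] by simp
  then have "(\<lambda>y. cis (- ((y - x) \<bullet> \<zeta>)) * b (y, \<xi>)) \<in> borel_measurable borel"
    by (intro borel_measurable_continuous_onI continuous_intros)
  from lborel_integral_shift[OF this, of x] show ?thesis by (simp add: partial_fourier_def fourier_def)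
qed

lemma partial_fourier_bound:
  fixes b :: "'n::finite symb"
  assumes b: "comp_symbol s b"
  shows "\<exists>C\<ge>0. \<forall>z \<zeta>. norm (partial_fourier b z \<zeta>) \<le> C * (1 + norm (snd z)) powr s"
proof -
  obtain R where R: "\<And>x \<xi>. norm x > R \<Longrightarrow> b (x, \<xi>) = 0" using b unfolding comp_symbol_def by blast
  have bo: "bounded_order UNIV UNIV s b" using b symbol_on_bounded unfolding comp_symbol_def by blast
  obtain C where C: "C \<ge> 0" "\<And>x \<xi>. x \<in> cball 0 R \<Longrightarrow> \<xi> \<in> UNIV \<Longrightarrow> norm (b (x, \<xi>)) \<le> C * (1 + norm \<xi>) powr s"
    using bounded_orderE[OF bo compact_cball subset_UNIV] by blast
  let ?V = "measure lborel (cball 0 R :: (real ^ 'n) set)"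
  have "norm (partial_fourier b (x, \<xi>) \<zeta>) \<le> (?V * C) * (1 + norm \<xi>) powr s" for x \<xi> \<zeta>
  proof -
    have ib: "integrable lborel (\<lambda>y. b (y, \<xi>))"
      using partial_fourier_integrable[OF b, of 0 "(0, \<xi>)"] by simp
    have "norm (partial_fourier b (x, \<xi>) \<zeta>) \<le> (LINT y|lborel. norm (cis (- ((y - x) \<bullet> \<zeta>)) * b (y, \<xi>)))"
      unfolding partial_fourier_shift[OF b] by (rule integral_norm_bound)
    also have "\<dots> = (LINT y|lborel. norm (b (y, \<xi>)))" by (simp add: norm_mult)
    also have "\<dots> \<le> (LINT y::real ^ 'n|lborel. indicator (cball 0 R) y * (C * (1 + norm \<xi>) powr s))"
    proof (rule integral_mono)
      show "integrable lborel (\<lambda>y. norm (b (y, \<xi>)))" using ib by simp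
      show "integrable lborel (\<lambda>y::real ^ 'n. indicator (cball 0 R) y * (C * (1 + norm \<xi>) powr s))"
        using emeasure_lborel_cball_finite[of "0::real ^ 'n" R]
        by (intro integrable_mult_left integrable_real_indicator) auto
      show "norm (b (y, \<xi>)) \<le> indicator (cball 0 R) y * (C * (1 + norm \<xi>) powr s)" for y
        using C(2)[of y \<xi>] R[of y \<xi>] by (cases "norm y > R") auto
    qed
    also have "\<dots> = ?V * (C * (1 + norm \<xi>) powr s)" by simp
    finally show ?thesis by (simp add: mult.assoc)
  qed
  then show ?thesis using C(1) by (intro exI[of _ "?V * C"]) auto
qed

lemma norm_le_sum_Basis: "norm \<zeta> \<le> (\<Sum>e\<in>Basis. \<bar>e \<bullet> \<zeta>\<bar>)" for \<zeta> :: "'a::euclidean_space"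
  using norm_le_l1[of \<zeta>] by (simp add: inner_commute)

text \<open>A factor \<open>1 + norm \<zeta>\<close> is at most 1 plus the sum of the
  \<open>\<bar>e \<bullet> \<zeta>\<bar>\<close>, and each \<open>e \<bullet> \<zeta>\<close> is
  paid for by one x-derivative of \<open>b\<close>, which does not change the order
  \<open>s\<close>.\<close>

lemma partial_fourier_decay:
  fixes b :: "'n::finite symb"
  assumes "comp_symbol s b"
  shows "\<exists>C\<ge>0. \<forall>z \<zeta>. (1 + norm \<zeta>) ^ M * norm (partial_fourier b z \<zeta>) \<le> C * (1 + norm (snd z)) powr s"
  using assms
proof (induction M arbitrary: b)
  case 0 then show ?case using partial_fourier_bound by simp
next
  case (Suc M)
  obtain C where C: "C \<ge> 0" "\<And>z \<zeta>. (1 + norm \<zeta>) ^ M * norm (partial_fourier b z \<zeta>) \<le> C * (1 + norm (snd z)) powr s"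
    using Suc by blast
  have "\<forall>e\<in>Basis. \<exists>C\<ge>0. \<forall>z \<zeta>. (1 + norm \<zeta>) ^ M * norm (partial_fourier (dderivs [(e, 0)] b) z \<zeta>) \<le> C * (1 + norm (snd z)) powr s"
    using Suc.IH[OF comp_symbol_dderiv(1)[OF Suc.prems]] by blast
  from bchoice[OF this] obtain D where D: "\<And>e. e \<in> Basis \<Longrightarrow> D e \<ge> 0"
      "\<And>e z \<zeta>. e \<in> Basis \<Longrightarrow> (1 + norm \<zeta>) ^ M * norm (partial_fourier (dderivs [(e, 0)] b) z \<zeta>) \<le> D e * (1 + norm (snd z)) powr s"
    by blast
  have "(1 + norm \<zeta>) ^ Suc M * norm (partial_fourier b z \<zeta>) \<le> (C + (\<Sum>e\<in>Basis. D e)) * (1 + norm (snd z)) powr s" for z \<zeta>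
  proof -
    let ?p = "(1 + norm \<zeta>) ^ M"
    have p: "0 \<le> ?p" by simp
    have "(1 + norm \<zeta>) * norm (partial_fourier b z \<zeta>) \<le> (1 + (\<Sum>e\<in>Basis. \<bar>e \<bullet> \<zeta>\<bar>)) * norm (partial_fourier b z \<zeta>)"
      using norm_le_sum_Basis[of \<zeta>] by (intro mult_right_mono) auto
    also have "\<dots> = norm (partial_fourier b z \<zeta>) + (\<Sum>e\<in>Basis. norm (partial_fourier (dderivs [(e, 0)] b) z \<zeta>))"
      unfolding partial_fourier_dderiv_x[OF Suc.prems] by (simp add: norm_mult distrib_right sum_distrib_right)
    finally have "?p * ((1 + norm \<zeta>) * norm (partial_fourier b z \<zeta>))
        \<le> ?p * (norm (partial_fourier b z \<zeta>) + (\<Sum>e\<in>Basis. norm (partial_fourier (dderivs [(e, 0)] b) z \<zeta>)))"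
      by (rule mult_left_mono[OF _ p])
    also have "\<dots> = ?p * norm (partial_fourier b z \<zeta>) + (\<Sum>e\<in>Basis. ?p * norm (partial_fourier (dderivs [(e, 0)] b) z \<zeta>))"
      by (simp only: distrib_left sum_distrib_left)
    also have "\<dots> \<le> C * (1 + norm (snd z)) powr s + (\<Sum>e\<in>Basis. D e * (1 + norm (snd z)) powr s)"
      by (intro add_mono C sum_mono D)
    finally have F: "?p * ((1 + norm \<zeta>) * norm (partial_fourier b z \<zeta>))
        \<le> C * (1 + norm (snd z)) powr s + (\<Sum>e\<in>Basis. D e * (1 + norm (snd z)) powr s)" .
    have e1: "(1 + norm \<zeta>) ^ Suc M * norm (partial_fourier b z \<zeta>) = ?p * ((1 + norm \<zeta>) * norm (partial_fourier b z \<zeta>))"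
      by (simp only: power_Suc mult_ac)
    show ?thesis unfolding e1 distrib_right[of C] sum_distrib_right by (fact F)
  qed
  moreover have "0 \<le> C + (\<Sum>e\<in>(Basis :: (real ^ 'n) set). D e)" by (intro add_nonneg_nonneg sum_nonneg C(1) D(1))
  ultimately show ?case by blast
qed

lemma partial_fourier_weighted_bound:
  fixes b :: "'n::finite symb"
  assumes "comp_symbol s b"
  shows "\<exists>C\<ge>0. \<forall>z \<zeta>. (1 + norm \<zeta>) powr p * norm (partial_fourier b z \<zeta>)
    \<le> C * (1 + norm (snd z)) powr s * inverse ((1 + norm \<zeta>) ^ (2 * CARD('n)))"
proof -
  \<comment> \<open>The first summand absorbs the weight of exponent \<open>p\<close>, the second
    leaves an integrable function.\<close>
  define M where "M = nat \<lceil>\<bar>p\<bar>\<rceil> + 2 * CARD('n)"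
  obtain C where C: "C \<ge> 0" "\<And>z \<zeta>. (1 + norm \<zeta>) ^ M * norm (partial_fourier b z \<zeta>) \<le> C * (1 + norm (snd z)) powr s"
    using partial_fourier_decay[OF assms] by blast
  have "(1 + norm \<zeta>) powr p * norm (partial_fourier b z \<zeta>)
    \<le> C * (1 + norm (snd z)) powr s * inverse ((1 + norm \<zeta>) ^ (2 * CARD('n)))" for z \<zeta>
  proof -
    have pos: "0 < 1 + norm \<zeta>" by (rule add_pos_nonneg) auto
    have "p \<le> real (nat \<lceil>\<bar>p\<bar>\<rceil>)" by linarith
    then have "(1 + norm \<zeta>) powr p \<le> (1 + norm \<zeta>) powr real (nat \<lceil>\<bar>p\<bar>\<rceil>)" by (intro powr_mono) auto
    also have "\<dots> = (1 + norm \<zeta>) ^ nat \<lceil>\<bar>p\<bar>\<rceil>" by (rule powr_realpow[OF pos])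
    finally have "(1 + norm \<zeta>) powr p * (1 + norm \<zeta>) ^ (2 * CARD('n)) \<le> (1 + norm \<zeta>) ^ M"
      unfolding M_def power_add using pos by (intro mult_right_mono) auto
    then have "(1 + norm \<zeta>) powr p * (1 + norm \<zeta>) ^ (2 * CARD('n)) * norm (partial_fourier b z \<zeta>)
        \<le> (1 + norm \<zeta>) ^ M * norm (partial_fourier b z \<zeta>)" by (intro mult_right_mono) auto
    also have "\<dots> \<le> C * (1 + norm (snd z)) powr s" by (rule C)
    finally show ?thesis using pos by (simp add: field_simps)
  qed
  then show ?thesis using C(1) by blast
qed

lemma integrable_weight:
  "integrable lborel (\<lambda>\<zeta>::real ^ 'n::finite. c * inverse ((1 + norm \<zeta>) ^ (2 * CARD('n))))"
  using integrable_inverse_power_norm[where 'a = "real ^ 'n"] by simp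

text \<open>Because of the centring, inversion at the origin recovers the value at
  \<open>z\<close>.\<close>

lemma partial_fourier_inversion:
  fixes b :: "'n::finite symb"
  assumes b: "comp_symbol s b"
  shows "integrable lborel (partial_fourier b z)"
    and "(LINT \<zeta>|lborel. partial_fourier b z \<zeta>) = of_real ((2 * pi) ^ CARD('n)) * b z"
proof -
  obtain C where C: "C \<ge> 0" "\<And>z \<zeta>. (1 + norm \<zeta>) powr 0 * norm (partial_fourier b z \<zeta>)
    \<le> C * (1 + norm (snd z)) powr s * inverse ((1 + norm \<zeta>) ^ (2 * CARD('n)))"
    using partial_fourier_weighted_bound[OF b] by blast
  show int: "integrable lborel (partial_fourier b z)"
  proof (rule Bochner_Integration.integrable_bound[OF integrable_weight[of "C * (1 + norm (snd z)) powr s"]])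
    have "norm (partial_fourier b z \<zeta>) \<le> norm (C * (1 + norm (snd z)) powr s * inverse ((1 + norm \<zeta>) ^ (2 * CARD('n))))" for \<zeta>
    proof -
      have "1 + norm \<zeta> \<noteq> 0" by (smt (verit) norm_ge_zero)
      then have "norm (partial_fourier b z \<zeta>) \<le> C * (1 + norm (snd z)) powr s * inverse ((1 + norm \<zeta>) ^ (2 * CARD('n)))"
        using C(2)[of \<zeta> z] by simp
      then show ?thesis by simp
    qed
    then show "AE \<zeta> in lborel. norm (partial_fourier b z \<zeta>) \<le> norm (C * (1 + norm (snd z)) powr s * inverse ((1 + norm \<zeta>) ^ (2 * CARD('n))))"
      by simp
  qed (use partial_fourier_measurable[OF b] in simp)
  obtain R where R: "\<And>w. norm w > R \<Longrightarrow> b (z + (w, 0)) = 0" using comp_symbol_slice(4)[OF b] by blast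
  show "(LINT \<zeta>|lborel. partial_fourier b z \<zeta>) = of_real ((2 * pi) ^ CARD('n)) * b z"
    using fourier_inversion_0[OF comp_symbol_slice(3)[OF b] R] int unfolding partial_fourier_def
    by (simp flip: zero_prod_def)
qed

text \<open>An explicit substitute for the operator norm: bounds on the finitely many values on
  \<open>Basis\<close> give a dominating function for all directions.\<close>

lemma norm_dderiv_le:
  fixes f :: "'a::euclidean_space \<Rightarrow> complex"
  assumes "linear L"
  shows "norm (L h :: complex) \<le> (\<Sum>e\<in>Basis. norm (L e)) * norm (h :: 'a)"
proof -
  have "L h = (\<Sum>e\<in>Basis. (h \<bullet> e) *\<^sub>R L e)"
    using linear_sum[OF assms, of "\<lambda>e. (h \<bullet> e) *\<^sub>R e" Basis] by (simp add: euclidean_representation linear_cmul[OF assms])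
  then have "norm (L h) \<le> (\<Sum>e\<in>Basis. \<bar>h \<bullet> e\<bar> * norm (L e))"
    using norm_sum[of "\<lambda>e. (h \<bullet> e) *\<^sub>R L e" Basis] by simp
  also have "\<dots> \<le> (\<Sum>e\<in>Basis. norm h * norm (L e))"
    by (intro sum_mono mult_right_mono Basis_le_norm) auto
  finally show ?thesis by (simp add: mult.commute flip: sum_distrib_left)
qed

lemma smooth_on_has_derivative_shift:
  assumes "smooth_on S f" "z + c \<in> S"
  shows "((\<lambda>z. f (z + c)) has_derivative (\<lambda>h. dderivs [h] f (z + c))) (at z)"
proof -
  have "(f has_derivative frechet_derivative f (at (z + c))) (at (z + c))"
    using smooth_on_differentiable[OF assms] frechet_derivative_works by blast
  moreover have "((\<lambda>z. z + c) has_derivative (\<lambda>h. h)) (at z)" by (auto intro!: derivative_eq_intros)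
  ultimately show ?thesis using has_derivative_compose by fastforce
qed

lemma norm_fst_snd_le: "norm (fst z) \<le> norm z" "norm (snd z) \<le> norm z"
  by (metis norm_fst_le prod.collapse) (metis norm_snd_le prod.collapse)

lemma partial_fourier_has_derivative:
  fixes b :: "'n::finite symb"
  assumes b: "comp_symbol s b"
  shows "((\<lambda>z. partial_fourier b z \<zeta>) has_derivative (\<lambda>h. partial_fourier (dderivs [h] b) z \<zeta>)) (at z)"
proof -
  obtain R where R: "\<And>x \<xi>. norm x > R \<Longrightarrow> b (x, \<xi>) = 0" using b unfolding comp_symbol_def by blast
  note sm = comp_symbol_smooth[OF b]
  let ?G = "\<lambda>y. \<Sum>e\<in>Basis. norm (dderivs [e] b y)"
  have "continuous_on UNIV ?G"
    using smooth_on_continuous[OF smooth_on_dderivs[OF sm]] by (intro continuous_intros) blast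
  then obtain B where B: "B > 0" "\<And>y. y \<in> cball 0 \<bar>R\<bar> \<times> cball (snd z) 1 \<Longrightarrow> norm (?G y) \<le> B"
    using continuous_on_compact_bound[OF compact_Times[OF compact_cball compact_cball]
      continuous_on_subset[OF _ subset_UNIV]] by blast
  \<comment> \<open>For every z' within distance 1 of \<open>z\<close> the slice at z' is supported
    in the ball of this radius.\<close>
  let ?L = "\<bar>R\<bar> + norm (fst z) + 1"
  show ?thesis unfolding partial_fourier_def fourier_def
  proof (rule has_derivative_parametric_integral[where r = 1 and g = "\<lambda>w. B * indicator (cball 0 ?L) w"])
    show "integrable lborel (\<lambda>w. cis (- (w \<bullet> \<zeta>)) * b (z' + (w, 0)))" for z'
      by (rule partial_fourier_integrable[OF b])
    show "integrable lborel (\<lambda>w. cis (- (w \<bullet> \<zeta>)) * dderivs [h] b (z + (w, 0)))" for h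
      by (rule partial_fourier_integrable[OF comp_symbol_dderiv(1)[OF b]])
    show "((\<lambda>z. cis (- (w \<bullet> \<zeta>)) * b (z + (w, 0))) has_derivative
        (\<lambda>h. cis (- (w \<bullet> \<zeta>)) * dderivs [h] b (z' + (w, 0)))) (at z')" for z' w
      by (intro has_derivative_mult_right smooth_on_has_derivative_shift[OF sm]) simp
    show "integrable lborel (\<lambda>w::real ^ 'n. B * indicator (cball 0 ?L) w)"
      using emeasure_lborel_cball_finite[of "0::real ^ 'n" ?L]
      by (intro integrable_mult_right integrable_real_indicator) auto
    fix z' w h assume z': "z' \<in> ball z 1"
    have fs: "norm (fst z' - fst z) < 1" "norm (snd z' - snd z) < 1"
      using z' norm_fst_snd_le[of "z' - z"]
      by (simp_all add: dist_norm norm_minus_commute)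
    have "linear (frechet_derivative b (at (z' + (w, 0))))"
      using smooth_on_differentiable[OF sm UNIV_I] frechet_derivative_works has_derivative_linear by blast
    from norm_dderiv_le[OF this, of h]
    have le: "norm (dderivs [h] b (z' + (w, 0))) \<le> ?G (z' + (w, 0)) * norm h" by simp
    show "norm (cis (- (w \<bullet> \<zeta>)) * dderivs [h] b (z' + (w, 0))) \<le> B * indicator (cball 0 ?L) w * norm h"
    proof (cases "norm (fst z' + w) > R")
      case True
      then have "dderivs [h] b (fst z' + w, snd z') = 0" using comp_symbol_dderiv_zero[where w = "[h]" and b = b and R = R] R by blast
      then have "dderivs [h] b (z' + (w, 0)) = 0" by (simp add: plus_prod_def)
      then show ?thesis using B(1) by simp
    next
      case False
      have "norm w \<le> norm (fst z' + w) + norm (fst z')"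
        using norm_triangle_ineq4[of "fst z' + w" "fst z'"] by simp
      also have "norm (fst z') \<le> norm (fst z) + 1"
        using fs(1) norm_triangle_sub[of "fst z'" "fst z"] by simp
      finally have w: "norm w \<le> ?L" using False by simp
      have "z' + (w, 0) \<in> cball 0 \<bar>R\<bar> \<times> cball (snd z) 1"
      proof -
        have "norm (fst z' + w) \<le> \<bar>R\<bar>" "dist (snd z) (snd z') \<le> 1"
          using False fs(2) by (simp_all add: dist_norm norm_minus_commute)
        then show ?thesis by (simp add: plus_prod_def)
      qed
      then have "?G (z' + (w, 0)) \<le> B" using B(2) by fastforce
      then have "?G (z' + (w, 0)) * norm h \<le> B * norm h" by (rule mult_right_mono) simp
      then show ?thesis using le w by (simp add: norm_mult)
    qed
  qed simp
qed

section \<open>The left product as an absolutely convergent integral\<close>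

definition star_integral :: "'n::finite symb \<Rightarrow> 'n symb \<Rightarrow> 'n symb" where
  "star_integral a b z = (LINT \<zeta>|lborel. a (z + (0, \<zeta>)) * partial_fourier b z \<zeta>) / of_real ((2 * pi) ^ CARD('n))"

definition ext :: "(real ^ 'n) set \<Rightarrow> 'n::finite symb \<Rightarrow> 'n symb" where
  "ext U b z = (if fst z \<in> U then b z else 0)"

text \<open>\<open>U\<close> and the complement of \<open>K\<close> are open and cover the space; on
  the former the extension is \<open>b\<close>, on the latter 0. Hence it is smooth, and the bounds
  over \<open>K\<close> are bounds everywhere.\<close>

lemma comp_symbol_ext:
  fixes b :: "'n::finite symb"
  assumes U: "open U" and b: "symbol_on U UNIV s b" "compact_x_support U b"
  shows "comp_symbol s (ext U b)"
proof -
  obtain K where K: "compact K" "K \<subseteq> U" "\<And>x \<xi>. x \<in> U - K \<Longrightarrow> b (x, \<xi>) = 0"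
    using b unfolding compact_x_support_def by blast
  have O1: "open (U \<times> (UNIV :: (real ^ 'n) set))" and O2: "open ((- K) \<times> (UNIV :: (real ^ 'n) set))"
    using U K(1) by (simp_all add: open_Times compact_imp_closed open_Compl)
  have z: "ext U b z = 0" if "z \<in> (- K) \<times> UNIV" for z
    using that K(3) unfolding ext_def by (cases z) auto
  have "smooth_on (U \<times> UNIV) (ext U b)"
    by (rule smooth_on_cong[OF O1 _ symbol_on_smooth[OF b(1)]]) (auto simp: ext_def)
  moreover have "smooth_on ((- K) \<times> UNIV) (ext U b)"
    by (rule smooth_on_cong[OF O2 _ smooth_on_const[of _ 0]]) (simp add: z)
  ultimately have "smooth_on (U \<times> UNIV \<union> (- K) \<times> UNIV) (ext U b)" by (rule smooth_on_Un)
  then have sm: "smooth_on (UNIV \<times> UNIV) (ext U b)" by (rule smooth_on_subset) (use K in auto)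
  have "bounded_order UNIV UNIV (s - real (xi_count w)) (dderivs w (ext U b))" if w: "set w \<subseteq> Basis" for w
  proof (rule bounded_orderI)
    have "bounded_order U UNIV (s - real (xi_count w)) (dderivs w b)"
      using b(1) w unfolding symbol_on_def by blast
    from bounded_orderE[OF this K(1,2)] obtain C where C: "C \<ge> 0" "\<And>x \<xi>. x \<in> K \<Longrightarrow> \<xi> \<in> UNIV \<Longrightarrow>
        norm (dderivs w b (x, \<xi>)) \<le> C * (1 + norm \<xi>) powr (s - real (xi_count w))" by blast
    have "norm (dderivs w (ext U b) (x, \<xi>)) \<le> C * (1 + norm \<xi>) powr (s - real (xi_count w))" for x \<xi>
    proof (cases "x \<in> K")
      case True
      have "dderivs w (ext U b) (x, \<xi>) = dderivs w b (x, \<xi>)"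
        by (rule dderivs_cong[OF O1]) (use True K in \<open>auto simp: ext_def\<close>)
      then show ?thesis using C(2)[OF True] by simp
    next
      case False
      have "dderivs w (ext U b) (x, \<xi>) = dderivs w (\<lambda>_. 0) (x, \<xi>)"
        by (rule dderivs_cong[OF O2 z]) (use False in auto)
      then show ?thesis using C(1) by (simp add: dderivs_0)
    qed
    then show "\<exists>C. \<forall>x\<in>L. \<forall>\<xi>\<in>UNIV. norm (dderivs w (ext U b) (x, \<xi>)) \<le> C * (1 + norm \<xi>) powr (s - real (xi_count w))" for L
      by blast
  qed
  moreover obtain R where "\<And>x. x \<in> K \<Longrightarrow> norm x \<le> R" using K(1) compact_imp_bounded bounded_iff by metis
  then have "ext U b (x, \<xi>) = 0" if "norm x > R" for x \<xi> using z that by fastforce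
  ultimately show ?thesis unfolding comp_symbol_def symbol_on_def using sm by blast
qed

lemma symbol_on_continuous_xi:
  fixes a :: "'n::finite symb"
  assumes "symbol_on U UNIV r a" "fst z \<in> U"
  shows "continuous_on UNIV (\<lambda>\<zeta>. a (z + (0, \<zeta>)))"
  by (rule continuous_on_compose2[OF smooth_on_continuous[OF symbol_on_smooth[OF assms(1)]]])
     (use assms(2) in \<open>auto intro!: continuous_intros simp: plus_prod_def\<close>)

text \<open>Substitution of \<eta> = \<xi> + \<zeta>. Centring the inner integral at x splits off a
  phase that cancels against the two outer ones, so \<open>z\<close> is left only in translations of
  \<open>a\<close> and \<open>b\<close>.\<close>

lemma star_eq_starK:
  fixes a b :: "'n::finite symb"
  assumes U: "open U" and a: "symbol_on U UNIV r a" and b: "symbol_on U UNIV s b" "compact_x_support U b"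
    and x: "x \<in> U"
  shows "star U a b (x, \<xi>) = star_integral a (ext U b) (x, \<xi>)"
proof -
  note B = comp_symbol_ext[OF U b]
  let ?T = "partial_fourier (ext U b) (x, \<xi>)"
  have inner: "(LINT y:U|lborel. cis (- (y \<bullet> \<eta>)) * (cis (y \<bullet> \<xi>) * b (y, \<xi>)))
      = cis (- (x \<bullet> (\<eta> - \<xi>))) * ?T (\<eta> - \<xi>)" for \<eta>
  proof -
    have "(LINT y:U|lborel. cis (- (y \<bullet> \<eta>)) * (cis (y \<bullet> \<xi>) * b (y, \<xi>)))
        = (LINT y|lborel. cis (- (x \<bullet> (\<eta> - \<xi>))) * (cis (- ((y - x) \<bullet> (\<eta> - \<xi>))) * ext U b (y, \<xi>)))"
      unfolding set_lebesgue_integral_def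
    proof (intro Bochner_Integration.integral_cong refl)
      fix y
      have "cis (- (y \<bullet> \<eta>)) * cis (y \<bullet> \<xi>) = cis (- (x \<bullet> (\<eta> - \<xi>))) * cis (- ((y - x) \<bullet> (\<eta> - \<xi>)))"
        by (simp add: cis_mult inner_diff_left inner_diff_right)
      then show "indicator U y *\<^sub>R (cis (- (y \<bullet> \<eta>)) * (cis (y \<bullet> \<xi>) * b (y, \<xi>)))
          = cis (- (x \<bullet> (\<eta> - \<xi>))) * (cis (- ((y - x) \<bullet> (\<eta> - \<xi>))) * ext U b (y, \<xi>))"
        by (simp add: ext_def mult.assoc[symmetric])
    qed
    then show ?thesis by (simp add: partial_fourier_shift[OF B])
  qed
  have m: "(\<lambda>\<eta>. a (x, \<eta>) * ?T (\<eta> - \<xi>)) \<in> borel_measurable borel"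
  proof -
    have "(\<lambda>\<eta>. a (x, \<eta>)) \<in> borel_measurable borel"
      using symbol_on_continuous_xi[OF a, of "(x, 0)"] x by (simp add: borel_measurable_continuous_onI)
    moreover have "(\<lambda>\<eta>. ?T (\<eta> - \<xi>)) \<in> borel_measurable borel"
      by (rule measurable_compose[OF _ partial_fourier_measurable[OF B]]) simp
    ultimately show ?thesis by simp
  qed
  have "(LINT \<eta>|lborel. cis (x \<bullet> \<eta>) * a (x, \<eta>) * (cis (- (x \<bullet> (\<eta> - \<xi>))) * ?T (\<eta> - \<xi>)))
      = (LINT \<eta>|lborel. cis (x \<bullet> \<xi>) * (a (x, \<eta>) * ?T (\<eta> - \<xi>)))"
  proof (intro Bochner_Integration.integral_cong refl)
    fix \<eta>
    have "cis (x \<bullet> \<xi>) = cis (x \<bullet> \<eta>) * cis (- (x \<bullet> (\<eta> - \<xi>)))" by (simp add: cis_mult inner_diff_right)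
    then show "cis (x \<bullet> \<eta>) * a (x, \<eta>) * (cis (- (x \<bullet> (\<eta> - \<xi>))) * ?T (\<eta> - \<xi>))
        = cis (x \<bullet> \<xi>) * (a (x, \<eta>) * ?T (\<eta> - \<xi>))" by (simp only: mult_ac)
  qed
  also have "\<dots> = cis (x \<bullet> \<xi>) * (LINT \<zeta>|lborel. a (x, \<xi> + \<zeta>) * ?T \<zeta>)"
    using lborel_integral_shift[OF m, of \<xi>] by simp
  finally have outer: "(LINT \<eta>|lborel. cis (x \<bullet> \<eta>) * a (x, \<eta>) * (cis (- (x \<bullet> (\<eta> - \<xi>))) * ?T (\<eta> - \<xi>)))
      = cis (x \<bullet> \<xi>) * (LINT \<zeta>|lborel. a (x, \<xi> + \<zeta>) * ?T \<zeta>)" .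
  show ?thesis
    unfolding star_def Op_def star_integral_def prod.case inner outer
    by (simp add: mult.assoc[symmetric] cis_mult)
qed

text \<open>The weight \<open>1 + norm u\<close> is submultiplicative; for negative \<open>r\<close>
  this is applied to \<xi> = (\<xi> + \<zeta>) - \<zeta>.\<close>

lemma peetre:
  fixes \<xi> \<zeta> :: "'a::real_normed_vector"
  shows "(1 + norm (\<xi> + \<zeta>)) powr r \<le> (1 + norm \<xi>) powr r * (1 + norm \<zeta>) powr \<bar>r\<bar>"
proof -
  have le: "1 + norm (u + v) \<le> (1 + norm u) * (1 + norm v)" for u v :: 'a
    using norm_triangle_ineq[of u v] by (simp add: ring_distribs) (smt (verit) mult_nonneg_nonneg norm_ge_zero)
  have pos: "0 < 1 + norm u" for u :: 'a by (smt (verit) norm_ge_zero)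
  show ?thesis
  proof (cases "r \<ge> 0")
    case True
    then have "(1 + norm (\<xi> + \<zeta>)) powr r \<le> ((1 + norm \<xi>) * (1 + norm \<zeta>)) powr r"
      using le by (intro powr_mono2) auto
    then show ?thesis using True by (simp add: powr_mult)
  next
    case False
    have "1 + norm \<xi> \<le> (1 + norm (\<xi> + \<zeta>)) * (1 + norm \<zeta>)" using le[of "\<xi> + \<zeta>" "- \<zeta>"] by simp
    then have "((1 + norm (\<xi> + \<zeta>)) * (1 + norm \<zeta>)) powr r \<le> (1 + norm \<xi>) powr r"
      using False pos by (intro powr_mono2') auto
    then have "(1 + norm (\<xi> + \<zeta>)) powr r * (1 + norm \<zeta>) powr r \<le> (1 + norm \<xi>) powr r"
      by (simp add: powr_mult)
    then have "(1 + norm (\<xi> + \<zeta>)) powr r * (1 + norm \<zeta>) powr r * (1 + norm \<zeta>) powr (- r)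
        \<le> (1 + norm \<xi>) powr r * (1 + norm \<zeta>) powr (- r)" by (intro mult_right_mono) auto
    then show ?thesis using False pos[of \<zeta>] by (simp add: mult.assoc flip: powr_add)
  qed
qed

text \<open>Moving the base point from \<xi> + \<zeta> to \<xi> costs
  \<open>(1 + norm \<zeta>) powr \<bar>r\<bar>\<close>, which the rapid decay of
  \<open>partial_fourier\<close> absorbs.\<close>

lemma star_integrand_bound:
  fixes a b :: "'n::finite symb"
  assumes a: "symbol_on U UNIV r a" and b: "comp_symbol s b" and K: "compact K" "K \<subseteq> U"
  shows "\<exists>C\<ge>0. \<forall>z \<zeta>. fst z \<in> K \<longrightarrow> norm (a (z + (0, \<zeta>)) * partial_fourier b z \<zeta>)
    \<le> C * (1 + norm (snd z)) powr (r + s) * inverse ((1 + norm \<zeta>) ^ (2 * CARD('n)))"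
proof -
  obtain C where C: "C \<ge> 0" "\<And>x \<xi>. x \<in> K \<Longrightarrow> \<xi> \<in> UNIV \<Longrightarrow> norm (a (x, \<xi>)) \<le> C * (1 + norm \<xi>) powr r"
    using bounded_orderE[OF symbol_on_bounded[OF a] K] by blast
  obtain D where D: "D \<ge> 0" "\<And>z \<zeta>. (1 + norm \<zeta>) powr \<bar>r\<bar> * norm (partial_fourier b z \<zeta>)
    \<le> D * (1 + norm (snd z)) powr s * inverse ((1 + norm \<zeta>) ^ (2 * CARD('n)))"
    using partial_fourier_weighted_bound[OF b] by blast
  have "norm (a (z + (0, \<zeta>)) * partial_fourier b z \<zeta>)
    \<le> (C * D) * (1 + norm (snd z)) powr (r + s) * inverse ((1 + norm \<zeta>) ^ (2 * CARD('n)))" if "fst z \<in> K" for z \<zeta>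
  proof -
    have "norm (a (fst z, snd z + \<zeta>)) \<le> C * (1 + norm (snd z + \<zeta>)) powr r" using C(2) that by blast
    also have "\<dots> \<le> C * ((1 + norm (snd z)) powr r * (1 + norm \<zeta>) powr \<bar>r\<bar>)"
      by (intro mult_left_mono peetre C)
    finally have "norm (a (z + (0, \<zeta>))) \<le> C * (1 + norm (snd z)) powr r * (1 + norm \<zeta>) powr \<bar>r\<bar>"
      by (simp add: plus_prod_def mult.assoc)
    then have "norm (a (z + (0, \<zeta>)) * partial_fourier b z \<zeta>)
        \<le> C * (1 + norm (snd z)) powr r * (1 + norm \<zeta>) powr \<bar>r\<bar> * norm (partial_fourier b z \<zeta>)"
      unfolding norm_mult by (rule mult_right_mono) simp
    also have "\<dots> = C * (1 + norm (snd z)) powr r * ((1 + norm \<zeta>) powr \<bar>r\<bar> * norm (partial_fourier b z \<zeta>))" by simp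
    also have "\<dots> \<le> C * (1 + norm (snd z)) powr r *
        (D * (1 + norm (snd z)) powr s * inverse ((1 + norm \<zeta>) ^ (2 * CARD('n))))"
      using C(1) by (intro mult_left_mono D) auto
    finally show ?thesis by (simp add: powr_add mult_ac)
  qed
  then show ?thesis using C(1) D(1) by (intro exI[of _ "C * D"]) auto
qed

lemma star_integrand_measurable:
  fixes a b :: "'n::finite symb"
  assumes "symbol_on U UNIV r a" "comp_symbol s b" "fst z \<in> U"
  shows "(\<lambda>\<zeta>. a (z + (0, \<zeta>)) * partial_fourier b z \<zeta>) \<in> borel_measurable lborel"
  using borel_measurable_continuous_onI[OF symbol_on_continuous_xi[OF assms(1,3)]] partial_fourier_measurable[OF assms(2)]
  by simp

lemma star_integrand_integrable:
  fixes a b :: "'n::finite symb"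
  assumes a: "symbol_on U UNIV r a" and b: "comp_symbol s b" and z: "fst z \<in> U"
  shows "integrable lborel (\<lambda>\<zeta>. a (z + (0, \<zeta>)) * partial_fourier b z \<zeta>)"
proof -
  obtain C where C: "C \<ge> 0" "\<And>z' \<zeta>. fst z' \<in> {fst z} \<Longrightarrow> norm (a (z' + (0, \<zeta>)) * partial_fourier b z' \<zeta>)
    \<le> C * (1 + norm (snd z')) powr (r + s) * inverse ((1 + norm \<zeta>) ^ (2 * CARD('n)))"
    using star_integrand_bound[OF a b, of "{fst z}"] z by auto
  show ?thesis
  proof (rule Bochner_Integration.integrable_bound[OF integrable_weight[of "C * (1 + norm (snd z)) powr (r + s)"]
        star_integrand_measurable[OF a b z]], rule AE_I2)
    show "norm (a (z + (0, \<zeta>)) * partial_fourier b z \<zeta>)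
      \<le> norm (C * (1 + norm (snd z)) powr (r + s) * inverse ((1 + norm \<zeta>) ^ (2 * CARD('n))))" for \<zeta>
      using order_trans[OF C(2)[of z \<zeta>] abs_ge_self] by simp
  qed
qed

text \<open>The Leibniz rule holds under the integral because \<open>z\<close> enters only through a
  translate of \<open>a\<close> and through \<open>partial_fourier b z\<close>, whose derivative is
  the transform of a derivative of \<open>b\<close>.\<close>

lemma star_integral_has_derivative:
  fixes a b :: "'n::finite symb"
  assumes U: "open U" and a: "symbol_on U UNIV r a" and b: "comp_symbol s b" and z0: "z0 \<in> U \<times> UNIV"
  shows "(star_integral a b has_derivative (\<lambda>h. star_integral (dderivs [h] a) b z0 + star_integral a (dderivs [h] b) z0)) (at z0)"
proof -
  have O: "open (U \<times> (UNIV :: (real ^ 'n) set))" using U by (intro open_Times) auto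
  note sa = symbol_on_smooth[OF a]
  define F' where "F' = (\<lambda>z \<zeta> h. dderivs [h] a (z + (0, \<zeta>)) * partial_fourier b z \<zeta> + a (z + (0, \<zeta>)) * partial_fourier (dderivs [h] b) z \<zeta>)"
  have "fst z0 \<in> U" using z0 by auto
  then obtain \<rho>0 where \<rho>0: "\<rho>0 > 0" "cball (fst z0) \<rho>0 \<subseteq> U" using U open_contains_cball by blast
  \<comment> \<open>The closed ball stays in \<open>U\<close>, which makes the symbol bounds uniform
    in x, and a radius of at most 1 controls \<xi>.\<close>
  define \<rho> where "\<rho> = min \<rho>0 1"
  define K where "K = cball (fst z0) \<rho>"
  have \<rho>: "\<rho> > 0" "\<rho> \<le> 1" and K: "compact K" "K \<subseteq> U" using \<rho>0 unfolding \<rho>_def K_def by auto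
  have inK: "fst z \<in> K" "norm (snd z) \<le> norm (snd z0) + 1" if "z \<in> ball z0 \<rho>" for z
  proof -
    have "norm (z - z0) < \<rho>" using that by (simp add: dist_norm norm_minus_commute)
    then have "norm (fst (z - z0)) < \<rho>" "norm (snd (z - z0)) < \<rho>"
      using norm_fst_snd_le[of "z - z0"] by simp_all
    then show "fst z \<in> K" "norm (snd z) \<le> norm (snd z0) + 1"
      unfolding K_def using \<rho>(2) norm_triangle_sub[of "snd z" "snd z0"]
      by (auto simp: dist_norm norm_minus_commute)
  qed
  have der: "((\<lambda>z. a (z + (0, \<zeta>)) * partial_fourier b z \<zeta>) has_derivative F' z \<zeta>) (at z)" if "fst z \<in> U" for z \<zeta>
  proof -
    have "((\<lambda>z. a (z + (0, \<zeta>))) has_derivative (\<lambda>h. dderivs [h] a (z + (0, \<zeta>)))) (at z)"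
      by (rule smooth_on_has_derivative_shift[OF sa]) (use that in \<open>auto simp: mem_Times_iff\<close>)
    from has_derivative_mult[OF this partial_fourier_has_derivative[OF b]] show ?thesis
      unfolding F'_def by (simp add: add.commute)
  qed
  have "\<exists>C\<ge>0. \<forall>z \<zeta>. z \<in> ball z0 \<rho> \<longrightarrow> norm (F' z \<zeta> e) \<le> C * inverse ((1 + norm \<zeta>) ^ (2 * CARD('n)))" for e
  proof -
    obtain C where C: "C \<ge> 0" "\<And>z \<zeta>. fst z \<in> K \<Longrightarrow> norm (dderivs [e] a (z + (0, \<zeta>)) * partial_fourier b z \<zeta>)
        \<le> C * (1 + norm (snd z)) powr (r + s) * inverse ((1 + norm \<zeta>) ^ (2 * CARD('n)))"
      using star_integrand_bound[OF symbol_on_dderiv_any[OF O a] b K] by blast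
    obtain D where D: "D \<ge> 0" "\<And>z \<zeta>. fst z \<in> K \<Longrightarrow> norm (a (z + (0, \<zeta>)) * partial_fourier (dderivs [e] b) z \<zeta>)
        \<le> D * (1 + norm (snd z)) powr (r + s) * inverse ((1 + norm \<zeta>) ^ (2 * CARD('n)))"
      using star_integrand_bound[OF a comp_symbol_dderiv(1)[OF b] K] by blast
    \<comment> \<open>On the ball \<open>1 + norm (snd z)\<close> is at most
      \<open>2 + norm (snd z0)\<close>; the absolute value covers both signs of the
      exponent.\<close>
    let ?E = "(C + D) * (2 + norm (snd z0)) powr \<bar>r + s\<bar>"
    have "norm (F' z \<zeta> e) \<le> ?E * inverse ((1 + norm \<zeta>) ^ (2 * CARD('n)))" if z: "z \<in> ball z0 \<rho>" for z \<zeta>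
    proof -
      let ?w = "inverse ((1 + norm \<zeta>) ^ (2 * CARD('n)))"
      have "(1 + norm (snd z)) powr (r + s) \<le> (1 + norm (snd z)) powr \<bar>r + s\<bar>" by (intro powr_mono) auto
      also have "\<dots> \<le> (2 + norm (snd z0)) powr \<bar>r + s\<bar>" using inK(2)[OF z] by (intro powr_mono2) auto
      finally have p: "(1 + norm (snd z)) powr (r + s) \<le> (2 + norm (snd z0)) powr \<bar>r + s\<bar>" .
      have "norm (F' z \<zeta> e) \<le> C * (1 + norm (snd z)) powr (r + s) * ?w + D * (1 + norm (snd z)) powr (r + s) * ?w"
        unfolding F'_def by (rule order_trans[OF norm_triangle_ineq]) (intro add_mono C D inK(1)[OF z])
      also have "\<dots> = (C + D) * (1 + norm (snd z)) powr (r + s) * ?w" by (simp add: algebra_simps)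
      also have "\<dots> \<le> (C + D) * (2 + norm (snd z0)) powr \<bar>r + s\<bar> * ?w"
        using C(1) D(1) p by (intro mult_right_mono mult_left_mono) auto
      finally show ?thesis .
    qed
    then show ?thesis using C(1) D(1) by (intro exI[of _ ?E]) auto
  qed
  then have "\<forall>e. \<exists>C. C \<ge> 0 \<and> (\<forall>z \<zeta>. z \<in> ball z0 \<rho> \<longrightarrow> norm (F' z \<zeta> e) \<le> C * inverse ((1 + norm \<zeta>) ^ (2 * CARD('n))))"
    by blast
  from choice[OF this] obtain C where C: "\<And>e. C e \<ge> 0" "\<And>e z \<zeta>. z \<in> ball z0 \<rho> \<Longrightarrow>
      norm (F' z \<zeta> e) \<le> C e * inverse ((1 + norm \<zeta>) ^ (2 * CARD('n)))" by blast
  have ia: "integrable lborel (\<lambda>\<zeta>. dderivs [h] a (z0 + (0, \<zeta>)) * partial_fourier b z0 \<zeta>)"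
    and ib: "integrable lborel (\<lambda>\<zeta>. a (z0 + (0, \<zeta>)) * partial_fourier (dderivs [h] b) z0 \<zeta>)" for h
    using z0 by (auto intro!: star_integrand_integrable[OF symbol_on_dderiv_any[OF O a] b]
      star_integrand_integrable[OF a comp_symbol_dderiv(1)[OF b]] simp del: dderivs.simps)
  have "((\<lambda>z. LINT \<zeta>|lborel. a (z + (0, \<zeta>)) * partial_fourier b z \<zeta>) has_derivative (\<lambda>h. LINT \<zeta>|lborel. F' z0 \<zeta> h)) (at z0)"
  proof (rule has_derivative_parametric_integral[OF \<rho>(1), where
        g = "\<lambda>\<zeta>. (\<Sum>e\<in>Basis. C e) * inverse ((1 + norm \<zeta>) ^ (2 * CARD('n)))"])
    show "integrable lborel (\<lambda>\<zeta>. a (z + (0, \<zeta>)) * partial_fourier b z \<zeta>)" if "z \<in> ball z0 \<rho>" for z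
      using inK(1)[OF that] K by (intro star_integrand_integrable[OF a b]) auto
    show "((\<lambda>z. a (z + (0, \<zeta>)) * partial_fourier b z \<zeta>) has_derivative F' z \<zeta>) (at z)" if "z \<in> ball z0 \<rho>" for z \<zeta>
      using inK(1)[OF that] K by (intro der) auto
    show "norm (F' z \<zeta> h) \<le> (\<Sum>e\<in>Basis. C e) * inverse ((1 + norm \<zeta>) ^ (2 * CARD('n))) * norm h"
      if z: "z \<in> ball z0 \<rho>" for z \<zeta> h
    proof -
      have "linear (F' z \<zeta>)" using der[of z] inK(1)[OF z] K has_derivative_linear by blast
      then have "norm (F' z \<zeta> h) \<le> (\<Sum>e\<in>Basis. norm (F' z \<zeta> e)) * norm h" by (rule norm_dderiv_le)
      also have "\<dots> \<le> (\<Sum>e\<in>Basis. C e * inverse ((1 + norm \<zeta>) ^ (2 * CARD('n)))) * norm h"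
        by (intro mult_right_mono sum_mono C z) auto
      finally show ?thesis by (simp add: sum_distrib_right)
    qed
    show "integrable lborel (\<lambda>\<zeta>. (\<Sum>e\<in>Basis. C e) * inverse ((1 + norm (\<zeta> :: real ^ 'n)) ^ (2 * CARD('n))))"
      by (rule integrable_weight)
    show "integrable lborel (\<lambda>\<zeta>. F' z0 \<zeta> h)" for h
      unfolding F'_def using ia ib by (rule Bochner_Integration.integrable_add)
  qed
  then have "((\<lambda>z. (LINT \<zeta>|lborel. a (z + (0, \<zeta>)) * partial_fourier b z \<zeta>) / of_real ((2 * pi) ^ CARD('n))) has_derivative
      (\<lambda>h. (LINT \<zeta>|lborel. F' z0 \<zeta> h) / of_real ((2 * pi) ^ CARD('n)))) (at z0)"
    by (rule bounded_linear.has_derivative[OF bounded_linear_divide])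
  moreover have "(LINT \<zeta>|lborel. F' z0 \<zeta> h) / of_real ((2 * pi) ^ CARD('n))
      = star_integral (dderivs [h] a) b z0 + star_integral a (dderivs [h] b) z0" for h
    unfolding F'_def star_integral_def Bochner_Integration.integral_add[OF ia ib] by (simp add: add_divide_distrib)
  ultimately show ?thesis unfolding star_integral_def[abs_def] by simp
qed

section \<open>Terms and remainder of the composition formula\<close>

definition words :: "nat \<Rightarrow> 'a::euclidean_space list set" where
  "words k = {J. set J \<subseteq> Basis \<and> length J = k}"

lemma words_0: "words 0 = {[]}"
  unfolding words_def by auto

lemma sum_words_Suc: "(\<Sum>J\<in>words (Suc k). f J) = (\<Sum>e\<in>Basis. \<Sum>J\<in>words k. f (e # J))"
proof -
  have "(\<Sum>J\<in>words (Suc k). f J) = (\<Sum>(e, J)\<in>Basis \<times> words k. f (e # J))"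
    by (rule sum.reindex_bij_witness[of _ "\<lambda>(e, J). e # J" "\<lambda>J. (hd J, tl J)"])
       (auto simp: words_def length_Suc_conv)
  then show ?thesis by (simp add: sum.cartesian_product)
qed

text \<open>The terms with |\<alpha>| = k of the composition formula. A multi-index \<alpha> is
  represented by k!/\<alpha>! words, so the coefficient 1/\<alpha>! becomes
  \<open>1 / fact k\<close>.\<close>

definition star_term :: "nat \<Rightarrow> 'n::finite symb \<Rightarrow> 'n symb \<Rightarrow> 'n symb" where
  "star_term k a b z = (- \<i>) ^ k / fact k *
     (\<Sum>J\<in>words k. dderivs (map (Pair 0) J) a z * dderivs (map (\<lambda>e. (e, 0)) J) b z)"

definition star_rem :: "nat \<Rightarrow> 'n::finite symb \<Rightarrow> 'n symb \<Rightarrow> 'n symb" where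
  "star_rem N a b z = star_integral a b z - (\<Sum>k<N. star_term k a b z)"

lemma star_term_smooth:
  assumes "open S" "smooth_on S a" "smooth_on S b"
  shows "smooth_on S (star_term k a b)"
  unfolding star_term_def[abs_def]
  by (intro smooth_on_cmult smooth_on_sum smooth_on_mult smooth_on_dderivs assms)

lemma star_term_dderiv:
  assumes S: "open S" and a: "smooth_on S a" and b: "smooth_on S b" and z: "z \<in> S"
  shows "dderivs [v] (star_term k a b) z = star_term k (dderivs [v] a) b z + star_term k a (dderivs [v] b) z"
proof -
  let ?A = "\<lambda>J. dderivs (map (Pair 0) J)" and ?B = "\<lambda>J. dderivs (map (\<lambda>e. (e, 0)) J)"
  have sm: "smooth_on S (\<lambda>z. ?A J a z * ?B J b z)" for J
    by (intro smooth_on_mult smooth_on_dderivs assms)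
  have "dderivs [v] (star_term k a b) z
      = (- \<i>) ^ k / fact k * dderivs [v] (\<lambda>z. \<Sum>J\<in>words k. ?A J a z * ?B J b z) z"
    unfolding star_term_def[abs_def] by (intro dderivs_cmult[OF S _ z] smooth_on_sum S sm)
  also have "dderivs [v] (\<lambda>z. \<Sum>J\<in>words k. ?A J a z * ?B J b z) z
      = (\<Sum>J\<in>words k. dderivs [v] (\<lambda>z. ?A J a z * ?B J b z) z)"
    by (intro dderivs_sum[OF S _ z] sm)
  also have "\<dots> = (\<Sum>J\<in>words k. ?A J (dderivs [v] a) z * ?B J b z + ?A J a z * ?B J (dderivs [v] b) z)"
    by (intro sum.cong refl)
       (simp only: dderivs_1_mult[OF S smooth_on_dderivs[OF a] smooth_on_dderivs[OF b] z]
          dderivs_1_swap[OF S a z] dderivs_1_swap[OF S b z])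
  finally show ?thesis by (rule trans) (simp only: star_term_def sum.distrib distrib_left)
qed

text \<open>Integral and terms both obey the Leibniz rule, hence so does their difference; by
  \<open>symbol_on_bilinear\<close> an estimate of the remainder itself then gives those of its
  derivatives.\<close>

lemma star_rem_dderiv:
  fixes a b :: "'n::finite symb"
  assumes U: "open U" and a: "symbol_on U UNIV r a" and b: "comp_symbol s b" and z: "z \<in> U \<times> UNIV"
  shows "star_rem N a b differentiable (at z)"
    and "dderivs [v] (star_rem N a b) z = star_rem N (dderivs [v] a) b z + star_rem N a (dderivs [v] b) z"
proof -
  have O: "open (U \<times> (UNIV :: (real ^ 'n) set))" using U by (intro open_Times) auto
  have sb: "smooth_on (U \<times> UNIV) b" by (rule smooth_on_subset[OF comp_symbol_smooth[OF b]]) simp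
  note sa = symbol_on_smooth[OF a]
  have st: "smooth_on (U \<times> UNIV) (star_term k a b)" for k by (rule star_term_smooth[OF O sa sb])
  have sums: "(\<lambda>z. \<Sum>k<N. star_term k a b z) differentiable (at z)"
    by (rule smooth_on_differentiable[OF smooth_on_sum[OF O] z]) (rule st)
  have d: "(star_integral a b has_derivative (\<lambda>h. star_integral (dderivs [h] a) b z + star_integral a (dderivs [h] b) z)) (at z)"
    by (rule star_integral_has_derivative[OF U a b z])
  have e: "(star_rem N a b has_derivative (\<lambda>h. (star_integral (dderivs [h] a) b z + star_integral a (dderivs [h] b) z)
      - frechet_derivative (\<lambda>z. \<Sum>k<N. star_term k a b z) (at z) h)) (at z)"
    unfolding star_rem_def[abs_def]
    by (intro has_derivative_diff d) (use sums frechet_derivative_works in blast)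
  then show "star_rem N a b differentiable (at z)" using differentiable_def by blast
  have "dderivs [v] (star_rem N a b) z = (star_integral (dderivs [v] a) b z + star_integral a (dderivs [v] b) z)
      - dderivs [v] (\<lambda>z. \<Sum>k<N. star_term k a b z) z"
    using frechet_derivative_at[OF e, symmetric] by simp
  also have "dderivs [v] (\<lambda>z. \<Sum>k<N. star_term k a b z) z = (\<Sum>k<N. dderivs [v] (star_term k a b) z)"
    by (intro dderivs_sum[OF O _ z] st)
  also have "\<dots> = (\<Sum>k<N. star_term k (dderivs [v] a) b z + star_term k a (dderivs [v] b) z)"
    by (intro sum.cong refl star_term_dderiv[OF O sa sb z])
  finally show "dderivs [v] (star_rem N a b) z
      = star_rem N (dderivs [v] a) b z + star_rem N a (dderivs [v] b) z"
    by (rule trans) (simp only: star_rem_def sum.distrib add_diff_add)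
qed

text \<open>Here \<open>d k\<close> is the k-th derivative of \<open>d 0\<close>. The derivative of
  the remainder is the remainder of \<open>d 1\<close> with one term less, and the remainder
  vanishes at 0; the interval has length 1, so the bound \<open>M\<close> is inherited.\<close>

lemma taylor_bound:
  fixes d :: "nat \<Rightarrow> real \<Rightarrow> complex"
  assumes "\<And>k t. k < N \<Longrightarrow> t \<in> {0..1} \<Longrightarrow> (d k has_vector_derivative d (Suc k) t) (at t)"
    "\<And>t. t \<in> {0..1} \<Longrightarrow> norm (d N t) \<le> M" "t \<in> {0..1}"
  shows "norm (d 0 t - (\<Sum>k<N. (t ^ k / fact k) *\<^sub>R d k 0)) \<le> M"
  using assms
proof (induction N arbitrary: d t)
  case (Suc N)
  define p where "p = (\<lambda>t. d 0 t - (\<Sum>k<Suc N. (t ^ k / fact k) *\<^sub>R d k 0))"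
  define p' where "p' = (\<lambda>t. d 1 t - (\<Sum>k<N. (t ^ k / fact k) *\<^sub>R d (Suc k) 0))"
  have b: "norm (p' t) \<le> M" if "t \<in> {0..1}" for t
    using Suc.IH[of "\<lambda>k. d (Suc k)" t] Suc.prems that unfolding p'_def by simp
  have der: "(p has_derivative (\<lambda>h. h *\<^sub>R p' t)) (at t)" if t: "t \<in> {0..1}" for t
  proof -
    have 0: "(d 0 has_vector_derivative d 1 t) (at t)" using Suc.prems(1)[of 0 t] t by simp
    have *: "((\<lambda>t. (t ^ Suc k / fact (Suc k)) *\<^sub>R d (Suc k) 0) has_vector_derivative
        (t ^ k / fact k) *\<^sub>R d (Suc k) 0) (at t)" for k
    proof -
      have "((\<lambda>t. t ^ Suc k / fact (Suc k)) has_real_derivative (t ^ k / fact k)) (at t)"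
        by (rule derivative_eq_intros refl | simp add: divide_simps)+
      then show ?thesis
        using has_vector_derivative_scaleR[OF _ has_vector_derivative_const] by fastforce
    qed
    have "((\<lambda>t. \<Sum>k<Suc N. (t ^ k / fact k) *\<^sub>R d k 0) has_vector_derivative
        (\<Sum>k<N. (t ^ k / fact k) *\<^sub>R d (Suc k) 0)) (at t)"
      unfolding sum.lessThan_Suc_shift
      using has_vector_derivative_add[OF has_vector_derivative_const
          has_vector_derivative_sum[of "{..<N}", OF *]] by simp
    from has_vector_derivative_diff[OF 0 this] show ?thesis
      unfolding p_def p'_def has_vector_derivative_def .
  qed
  have "norm (p t - p 0) \<le> M * norm (t - 0)"
  proof (rule differentiable_bound[of "{0..1}"])
    show "(p has_derivative (\<lambda>h. h *\<^sub>R p' x)) (at x within {0..1})" if "x \<in> {0..1}" for x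
      using der[OF that] has_derivative_at_withinI by blast
    show "onorm (\<lambda>h. h *\<^sub>R p' x) \<le> M" if "x \<in> {0..1}" for x
    proof (rule onorm_le)
      fix h :: real
      show "norm (h *\<^sub>R p' x) \<le> M * norm h"
        using mult_left_mono[OF b[OF that], of "\<bar>h\<bar>"] by (simp add: mult.commute)
    qed
  qed (use Suc.prems in auto)
  also have "\<dots> \<le> M" using Suc.prems(3) order_trans[OF norm_ge_zero b[of 0]] by (simp add: mult_left_le)
  finally show ?case unfolding p_def by (simp add: sum.lessThan_Suc_shift del: sum.lessThan_Suc)
qed simp

text \<open>Multilinearity in \<zeta>: the Taylor coefficient becomes a polynomial in \<zeta>, which
  the Fourier transform converts into x-derivatives of \<open>b\<close>.\<close>

lemma dderivs_replicate:
  fixes a :: "'n::finite symb"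
  assumes S: "open S" and a: "smooth_on S a"
  shows "z \<in> S \<Longrightarrow> dderivs (replicate k (0, \<zeta>)) a z
    = (\<Sum>J\<in>words k. of_real (\<Prod>e\<leftarrow>J. e \<bullet> \<zeta>) * dderivs (map (Pair 0) J) a z)"
proof (induction k arbitrary: z)
  case 0 then show ?case by (simp add: words_0)
next
  case (Suc k)
  let ?A = "\<lambda>J. dderivs (map (Pair 0) J) a"
  have sm: "smooth_on S (?A J)" for J using smooth_on_dderivs[OF a] .
  have "dderivs (replicate (Suc k) (0, \<zeta>)) a z = dderivs [(0, \<zeta>)] (dderivs (replicate k (0, \<zeta>)) a) z"
    by simp
  also have "\<dots> = dderivs [(0, \<zeta>)] (\<lambda>z. \<Sum>J\<in>words k. of_real (\<Prod>e\<leftarrow>J. e \<bullet> \<zeta>) * ?A J z) z"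
    by (rule dderivs_cong[OF S Suc.IH Suc.prems])
  also have "\<dots> = (\<Sum>J\<in>words k. of_real (\<Prod>e\<leftarrow>J. e \<bullet> \<zeta>) * dderivs [(0, \<zeta>)] (?A J) z)"
    using dderivs_sum[OF S smooth_on_cmult[OF S sm] Suc.prems] dderivs_cmult[OF S sm Suc.prems]
    by (simp del: dderivs.simps)
  also have "\<dots> = (\<Sum>J\<in>words k. of_real (\<Prod>e\<leftarrow>J. e \<bullet> \<zeta>) * (\<Sum>e\<in>Basis. of_real (e \<bullet> \<zeta>) * ?A (e # J) z))"
  proof (intro sum.cong refl arg_cong2[where f = "(*)"])
    fix J
    have "linear (frechet_derivative (?A J) (at z))"
      using smooth_on_differentiable[OF sm Suc.prems] frechet_derivative_works has_derivative_linear by blast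
    then have l: "linear (\<lambda>\<zeta>. frechet_derivative (?A J) (at z) (0, \<zeta>))"
      by (rule linear_compose[of "\<lambda>\<zeta>. (0, \<zeta>)", unfolded o_def, rotated]) (simp add: linear_iff)
    have "frechet_derivative (?A J) (at z) (0, \<Sum>e\<in>Basis. (\<zeta> \<bullet> e) *\<^sub>R e)
        = (\<Sum>e\<in>Basis. (\<zeta> \<bullet> e) *\<^sub>R frechet_derivative (?A J) (at z) (0, e))"
      using linear_sum[OF l, of "\<lambda>e. (\<zeta> \<bullet> e) *\<^sub>R e" Basis] linear_cmul[OF l] by simp
    then have "frechet_derivative (?A J) (at z) (0, \<zeta>)
        = (\<Sum>e\<in>Basis. (\<zeta> \<bullet> e) *\<^sub>R frechet_derivative (?A J) (at z) (0, e))"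
      by (simp only: euclidean_representation)
    then show "dderivs [(0, \<zeta>)] (?A J) z = (\<Sum>e\<in>Basis. of_real (e \<bullet> \<zeta>) * ?A (e # J) z)"
      by (simp add: scaleR_conv_of_real inner_commute)
  qed
  also have "\<dots> = (\<Sum>e\<in>Basis. \<Sum>J\<in>words k. of_real (\<Prod>e\<leftarrow>e # J. e \<bullet> \<zeta>) * ?A (e # J) z)"
    unfolding sum_distrib_left by (subst sum.swap) (simp add: mult_ac)
  finally show ?case by (simp add: sum_words_Suc)
qed

lemma prod_list_inner_le:
  assumes "J \<in> words k"
  shows "\<bar>\<Prod>e\<leftarrow>J. e \<bullet> \<zeta>\<bar> \<le> norm \<zeta> ^ k"
proof -
  have "set J \<subseteq> Basis \<Longrightarrow> \<bar>\<Prod>e\<leftarrow>J. e \<bullet> \<zeta>\<bar> \<le> norm \<zeta> ^ length J" for J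
  proof (induction J)
    case (Cons e J)
    then have "\<bar>e \<bullet> \<zeta>\<bar> * \<bar>\<Prod>e\<leftarrow>J. e \<bullet> \<zeta>\<bar> \<le> norm \<zeta> * norm \<zeta> ^ length J"
      by (intro mult_mono) (auto simp: inner_commute Basis_le_norm)
    then show ?case by (simp add: abs_mult)
  qed simp
  then show ?thesis using assms unfolding words_def by blast
qed

text \<open>Peetre's inequality moves the base point from \<open>\<xi> + t \<zeta>\<close> to \<open>\<xi>\<close>.\<close>

lemma symbol_taylor:
  fixes a :: "'n::finite symb"
  assumes U: "open U" and a: "symbol_on U UNIV r a" and K: "compact K" "K \<subseteq> U"
  shows "\<exists>C\<ge>0. \<forall>z \<zeta>. fst z \<in> K \<longrightarrow>
    norm (a (z + (0, \<zeta>)) - (\<Sum>k<N. dderivs (replicate k (0, \<zeta>)) a z / fact k))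
    \<le> C * (1 + norm (snd z)) powr (r - real N) * (1 + norm \<zeta>) powr (real N + \<bar>r - real N\<bar>)"
proof -
  have O: "open (U \<times> (UNIV :: (real ^ 'n) set))" using U by (intro open_Times) auto
  note sa = symbol_on_smooth[OF a]
  let ?q = "r - real N"
  have "\<forall>J\<in>words N. \<exists>C. C \<ge> 0 \<and> (\<forall>x\<in>K. \<forall>\<xi>. norm (dderivs (map (Pair 0) J) a (x, \<xi>)) \<le> C * (1 + norm \<xi>) powr ?q)"
  proof
    fix J :: "(real ^ 'n) list" assume J: "J \<in> words N"
    then have "set (map (Pair 0) J) \<subseteq> (Basis :: 'n tpoint set)" "xi_count (map (Pair 0) J :: 'n tpoint list) = N"
      unfolding words_def by (auto simp: Basis_prod_def xi_count_def filter_map o_def)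
    then have "bounded_order U UNIV ?q (dderivs (map (Pair 0) J) a)"
      using a unfolding symbol_on_def by metis
    from bounded_orderE[OF this K]
    show "\<exists>C. C \<ge> 0 \<and> (\<forall>x\<in>K. \<forall>\<xi>. norm (dderivs (map (Pair 0) J) a (x, \<xi>)) \<le> C * (1 + norm \<xi>) powr ?q)"
      by (metis UNIV_I)
  qed
  from bchoice[OF this] obtain C where C: "\<And>J. J \<in> words N \<Longrightarrow> C J \<ge> 0"
    "\<And>J x \<xi>. J \<in> words N \<Longrightarrow> x \<in> K \<Longrightarrow> norm (dderivs (map (Pair 0) J) a (x, \<xi>)) \<le> C J * (1 + norm \<xi>) powr ?q"
    by blast
  let ?C = "\<Sum>J\<in>words N. C J"
  have C0: "?C \<ge> 0" using C(1) by (rule sum_nonneg)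
  have "norm (a (z + (0, \<zeta>)) - (\<Sum>k<N. dderivs (replicate k (0, \<zeta>)) a z / fact k))
    \<le> ?C * (1 + norm (snd z)) powr ?q * (1 + norm \<zeta>) powr (real N + \<bar>?q\<bar>)" if z: "fst z \<in> K" for z \<zeta>
  proof -
    \<comment> \<open>The k-th derivative of \<open>a\<close> along the segment from \<xi> to \<xi>
      + \<zeta>, parametrised by [0, 1].\<close>
    define d where "d = (\<lambda>k t. dderivs (replicate k (0, \<zeta>)) a (z + t *\<^sub>R (0, \<zeta>)))"
    have inU: "z + t *\<^sub>R (0, \<zeta>) \<in> U \<times> UNIV" for t
      using z K by (auto simp: mem_Times_iff)
    have 1: "(d k has_vector_derivative d (Suc k) t) (at t)" for k t
    proof -
      let ?f = "dderivs (replicate k (0, \<zeta>)) a"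
      have *: "(?f has_derivative frechet_derivative ?f (at (z + t *\<^sub>R (0, \<zeta>)))) (at (z + t *\<^sub>R (0, \<zeta>)))"
        using smooth_on_differentiable[OF smooth_on_dderivs[OF sa] inU] frechet_derivative_works by blast
      have "((\<lambda>t. ?f (z + t *\<^sub>R (0, \<zeta>))) has_derivative
          (\<lambda>h. frechet_derivative ?f (at (z + t *\<^sub>R (0, \<zeta>))) (h *\<^sub>R (0, \<zeta>)))) (at t)"
        by (rule has_derivative_compose[of "\<lambda>t. z + t *\<^sub>R (0, \<zeta>)" _ t, OF _ *])
           (rule derivative_eq_intros refl | simp)+
      then show ?thesis unfolding d_def has_vector_derivative_def
        by (simp only: linear_cmul[OF has_derivative_linear[OF *]] replicate_Suc dderivs.simps)
    qed
    have 2: "norm (d N t) \<le> ?C * (1 + norm (snd z)) powr ?q * (1 + norm \<zeta>) powr (real N + \<bar>?q\<bar>)"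
      if t: "t \<in> {0..1}" for t
    proof -
      have pos: "0 < 1 + norm \<zeta>" by (smt (verit) norm_ge_zero)
      have "(1 + norm (snd z + t *\<^sub>R \<zeta>)) powr ?q \<le> (1 + norm (snd z)) powr ?q * (1 + norm (t *\<^sub>R \<zeta>)) powr \<bar>?q\<bar>"
        by (rule peetre)
      also have "\<dots> \<le> (1 + norm (snd z)) powr ?q * (1 + norm \<zeta>) powr \<bar>?q\<bar>"
        using t by (intro mult_left_mono powr_mono2) (auto intro: mult_left_le_one_le)
      finally have p: "(1 + norm (snd z + t *\<^sub>R \<zeta>)) powr ?q \<le> (1 + norm (snd z)) powr ?q * (1 + norm \<zeta>) powr \<bar>?q\<bar>" .
      have n: "norm \<zeta> ^ N \<le> (1 + norm \<zeta>) powr real N"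
        unfolding powr_realpow[OF pos] by (intro power_mono) auto
      have "d N t = (\<Sum>J\<in>words N. of_real (\<Prod>e\<leftarrow>J. e \<bullet> \<zeta>) * dderivs (map (Pair 0) J) a (fst z, snd z + t *\<^sub>R \<zeta>))"
        unfolding d_def dderivs_replicate[OF O sa inU] by (simp add: plus_prod_def)
      then have "norm (d N t) \<le> (\<Sum>J\<in>words N. norm (of_real (\<Prod>e\<leftarrow>J. e \<bullet> \<zeta>) * dderivs (map (Pair 0) J) a (fst z, snd z + t *\<^sub>R \<zeta>)))"
        by (simp only: norm_sum)
      also have "\<dots> \<le> (\<Sum>J\<in>words N. (1 + norm \<zeta>) powr real N * (C J * ((1 + norm (snd z)) powr ?q * (1 + norm \<zeta>) powr \<bar>?q\<bar>)))"
      proof (intro sum_mono)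
        fix J :: "(real ^ 'n) list" assume J: "J \<in> words N"
        have A: "norm (dderivs (map (Pair 0) J) a (fst z, snd z + t *\<^sub>R \<zeta>)) \<le> C J * ((1 + norm (snd z)) powr ?q * (1 + norm \<zeta>) powr \<bar>?q\<bar>)"
          by (rule order_trans[OF C(2)[OF J z] mult_left_mono[OF p C(1)[OF J]]])
        have B: "\<bar>\<Prod>e\<leftarrow>J. e \<bullet> \<zeta>\<bar> \<le> (1 + norm \<zeta>) powr real N"
          by (rule order_trans[OF prod_list_inner_le[OF J] n])
        show "norm (of_real (\<Prod>e\<leftarrow>J. e \<bullet> \<zeta>) * dderivs (map (Pair 0) J) a (fst z, snd z + t *\<^sub>R \<zeta>))
            \<le> (1 + norm \<zeta>) powr real N * (C J * ((1 + norm (snd z)) powr ?q * (1 + norm \<zeta>) powr \<bar>?q\<bar>))"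
          unfolding norm_mult norm_of_real by (rule mult_mono[OF B A]) auto
      qed
      also have "\<dots> = ?C * (1 + norm (snd z)) powr ?q * (1 + norm \<zeta>) powr (real N + \<bar>?q\<bar>)"
        by (simp add: powr_add sum_distrib_left sum_distrib_right mult_ac)
      finally show ?thesis .
    qed
    have "norm (d 0 1 - (\<Sum>k<N. (1 ^ k / fact k) *\<^sub>R d k 0))
        \<le> ?C * (1 + norm (snd z)) powr ?q * (1 + norm \<zeta>) powr (real N + \<bar>?q\<bar>)"
      by (rule taylor_bound[OF 1 2]) auto
    moreover have "d 0 1 - (\<Sum>k<N. (1 ^ k / fact k) *\<^sub>R d k 0)
        = a (z + (0, \<zeta>)) - (\<Sum>k<N. dderivs (replicate k (0, \<zeta>)) a z / fact k)"
      unfolding d_def by (simp add: scaleR_conv_of_real zero_prod_def[symmetric])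
    ultimately show ?thesis by simp
  qed
  then show ?thesis using C0 by blast
qed

text \<open>A monomial in \<zeta> times the transform of \<open>b\<close> is, up to
  \<open>(- \<i>) ^ k\<close>, the transform of an x-derivative of \<open>b\<close>, and integrating
  that over \<zeta> is inversion at \<open>z\<close>.\<close>

lemma star_term_integral:
  fixes a b :: "'n::finite symb"
  assumes U: "open U" and a: "symbol_on U UNIV r a" and b: "comp_symbol s b" and z: "z \<in> U \<times> UNIV"
  shows "integrable lborel (\<lambda>\<zeta>. dderivs (replicate k (0, \<zeta>)) a z / fact k * partial_fourier b z \<zeta>)"
    and "(LINT \<zeta>|lborel. dderivs (replicate k (0, \<zeta>)) a z / fact k * partial_fourier b z \<zeta>)
      = of_real ((2 * pi) ^ CARD('n)) * star_term k a b z"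
proof -
  have O: "open (U \<times> (UNIV :: (real ^ 'n) set))" using U by (intro open_Times) auto
  let ?A = "\<lambda>J. dderivs (map (Pair 0) J) a z" and ?B = "\<lambda>J. dderivs (map (\<lambda>e. (e, 0)) J) b"
  have eq: "dderivs (replicate k (0, \<zeta>)) a z / fact k * partial_fourier b z \<zeta>
      = (\<Sum>J\<in>words k. (- \<i>) ^ k / fact k * ?A J * partial_fourier (?B J) z \<zeta>)" for \<zeta>
  proof -
    have "of_real (\<Prod>e\<leftarrow>J. e \<bullet> \<zeta>) * partial_fourier b z \<zeta> = (- \<i>) ^ k * partial_fourier (?B J) z \<zeta>" if "J \<in> words k" for J
    proof -
      have "(- \<i>) ^ k * \<i> ^ k = 1" by (simp flip: power_mult_distrib)
      moreover have "length J = k" using that unfolding words_def by simp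
      ultimately show ?thesis unfolding partial_fourier_dderivs_x[OF b] by (simp add: mult.assoc[symmetric])
    qed
    then have *: "of_real (\<Prod>e\<leftarrow>J. e \<bullet> \<zeta>) * ?A J / fact k * partial_fourier b z \<zeta> = (- \<i>) ^ k / fact k * ?A J * partial_fourier (?B J) z \<zeta>"
      if J: "J \<in> words k" for J
    proof -
      have "of_real (\<Prod>e\<leftarrow>J. e \<bullet> \<zeta>) * ?A J / fact k * partial_fourier b z \<zeta>
          = ?A J / fact k * (of_real (\<Prod>e\<leftarrow>J. e \<bullet> \<zeta>) * partial_fourier b z \<zeta>)" by simp
      also have "of_real (\<Prod>e\<leftarrow>J. e \<bullet> \<zeta>) * partial_fourier b z \<zeta> = (- \<i>) ^ k * partial_fourier (?B J) z \<zeta>"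
        using J \<open>\<And>J. J \<in> words k \<Longrightarrow> of_real (\<Prod>e\<leftarrow>J. e \<bullet> \<zeta>) * partial_fourier b z \<zeta> = (- \<i>) ^ k * partial_fourier (?B J) z \<zeta>\<close> by blast
      finally show ?thesis by simp
    qed
    show ?thesis
      unfolding dderivs_replicate[OF O symbol_on_smooth[OF a] z] sum_divide_distrib sum_distrib_right
      by (rule sum.cong[OF refl *])
  qed
  note inv = partial_fourier_inversion[OF comp_symbol_dderivs_x[OF b]]
  show "integrable lborel (\<lambda>\<zeta>. dderivs (replicate k (0, \<zeta>)) a z / fact k * partial_fourier b z \<zeta>)"
    unfolding eq by (intro Bochner_Integration.integrable_sum integrable_mult_right inv)
  have "(LINT \<zeta>|lborel. dderivs (replicate k (0, \<zeta>)) a z / fact k * partial_fourier b z \<zeta>)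
      = (\<Sum>J\<in>words k. (- \<i>) ^ k / fact k * ?A J * (of_real ((2 * pi) ^ CARD('n)) * ?B J z))"
    unfolding eq
    by (subst Bochner_Integration.integral_sum)
       (auto intro!: integrable_mult_right inv(1) simp: inv(2) simp del: of_real_power)
  then show "(LINT \<zeta>|lborel. dderivs (replicate k (0, \<zeta>)) a z / fact k * partial_fourier b z \<zeta>)
      = of_real ((2 * pi) ^ CARD('n)) * star_term k a b z"
    by (simp add: star_term_def sum_distrib_left mult_ac)
qed

text \<open>By \<open>star_term_integral\<close> the remainder is the integral of the Taylor
  remainder of \<open>a\<close> against the transform of \<open>b\<close>. The orders r - N and s in
  \<xi> add up, and the decay of the transform beats the growth in \<zeta>.\<close>

lemma star_rem_bounded:
  fixes a b :: "'n::finite symb"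
  assumes U: "open U" and a: "symbol_on U UNIV r a" and b: "comp_symbol s b"
  shows "bounded_order U UNIV (r + s - real N) (star_rem N a b)"
proof (rule bounded_orderI)
  fix K assume K: "compact K" "K \<subseteq> U"
  let ?P = "of_real ((2 * pi) ^ CARD('n)) :: complex"
  have P: "?P \<noteq> 0" by simp
  obtain C where C: "C \<ge> 0" "\<And>z \<zeta>. fst z \<in> K \<Longrightarrow>
    norm (a (z + (0, \<zeta>)) - (\<Sum>k<N. dderivs (replicate k (0, \<zeta>)) a z / fact k))
    \<le> C * (1 + norm (snd z)) powr (r - real N) * (1 + norm \<zeta>) powr (real N + \<bar>r - real N\<bar>)"
    using symbol_taylor[OF U a K, of N] by blast
  obtain D where D: "D \<ge> 0" "\<And>z \<zeta>. (1 + norm \<zeta>) powr (real N + \<bar>r - real N\<bar>) * norm (partial_fourier b z \<zeta>)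
    \<le> D * (1 + norm (snd z)) powr s * inverse ((1 + norm \<zeta>) ^ (2 * CARD('n)))"
    using partial_fourier_weighted_bound[OF b] by blast
  let ?W = "LINT \<zeta>::real ^ 'n|lborel. inverse ((1 + norm \<zeta>) ^ (2 * CARD('n)))"
  have "norm (star_rem N a b (x, \<xi>)) \<le> (C * D * ?W / norm ?P) * (1 + norm \<xi>) powr (r + s - real N)"
    if x: "x \<in> K" for x \<xi>
  proof -
    let ?z = "(x, \<xi>)"
    have z: "?z \<in> U \<times> UNIV" "fst ?z \<in> U" "fst ?z \<in> K" using x K by auto
    note i1 = star_integrand_integrable[OF a b z(2)] and i2 = star_term_integral[OF U a b z(1)]
    let ?R = "\<lambda>\<zeta>. a (?z + (0, \<zeta>)) - (\<Sum>k<N. dderivs (replicate k (0, \<zeta>)) a ?z / fact k)"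
    have eqR: "?R \<zeta> * partial_fourier b ?z \<zeta> = a (?z + (0, \<zeta>)) * partial_fourier b ?z \<zeta>
        - (\<Sum>k<N. dderivs (replicate k (0, \<zeta>)) a ?z / fact k * partial_fourier b ?z \<zeta>)" for \<zeta>
      by (simp only: left_diff_distrib sum_distrib_right)
    have iR: "integrable lborel (\<lambda>\<zeta>. ?R \<zeta> * partial_fourier b ?z \<zeta>)"
      unfolding eqR by (intro Bochner_Integration.integrable_diff i1 Bochner_Integration.integrable_sum i2)
    have "(LINT \<zeta>|lborel. ?R \<zeta> * partial_fourier b ?z \<zeta>) = (LINT \<zeta>|lborel. a (?z + (0, \<zeta>)) * partial_fourier b ?z \<zeta>)
        - (\<Sum>k<N. ?P * star_term k a b ?z)"
      unfolding eqR
      by (subst Bochner_Integration.integral_diff[OF i1 Bochner_Integration.integrable_sum[OF i2(1)]],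
          subst Bochner_Integration.integral_sum[OF i2(1)], simp only: i2(2))
    also have "\<dots> = ?P * star_rem N a b ?z"
      using P unfolding star_rem_def star_integral_def by (simp add: right_diff_distrib sum_distrib_left)
    finally have "norm ?P * norm (star_rem N a b ?z) = norm (LINT \<zeta>|lborel. ?R \<zeta> * partial_fourier b ?z \<zeta>)"
      by (simp add: norm_mult)
    also have "\<dots> \<le> (LINT \<zeta>|lborel. norm (?R \<zeta> * partial_fourier b ?z \<zeta>))" by (rule integral_norm_bound)
    also have "\<dots> \<le> (LINT \<zeta>::real ^ 'n|lborel. (C * D * (1 + norm \<xi>) powr (r + s - real N)) * inverse ((1 + norm \<zeta>) ^ (2 * CARD('n))))"
    proof (rule integral_mono)
      show "integrable lborel (\<lambda>\<zeta>. norm (?R \<zeta> * partial_fourier b ?z \<zeta>))" using iR by (rule integrable_norm)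
      show "integrable lborel (\<lambda>\<zeta>::real ^ 'n. (C * D * (1 + norm \<xi>) powr (r + s - real N)) * inverse ((1 + norm \<zeta>) ^ (2 * CARD('n))))"
        by (rule integrable_weight)
      fix \<zeta> :: "real ^ 'n"
      let ?w = "inverse ((1 + norm \<zeta>) ^ (2 * CARD('n)))" and ?p = "(1 + norm \<zeta>) powr (real N + \<bar>r - real N\<bar>)"
      have "norm (?R \<zeta> * partial_fourier b ?z \<zeta>) \<le> C * (1 + norm \<xi>) powr (r - real N) * ?p * norm (partial_fourier b ?z \<zeta>)"
        unfolding norm_mult using C(2)[OF z(3), of \<zeta>] by (intro mult_right_mono) auto
      also have "\<dots> = C * (1 + norm \<xi>) powr (r - real N) * (?p * norm (partial_fourier b ?z \<zeta>))" by simp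
      also have "\<dots> \<le> C * (1 + norm \<xi>) powr (r - real N) * (D * (1 + norm \<xi>) powr s * ?w)"
        using D(2)[of \<zeta> ?z] C(1) by (intro mult_left_mono) auto
      also have "\<dots> = C * D * ((1 + norm \<xi>) powr (r - real N) * (1 + norm \<xi>) powr s) * ?w" by (simp add: mult_ac)
      also have "(1 + norm \<xi>) powr (r - real N) * (1 + norm \<xi>) powr s = (1 + norm \<xi>) powr (r + s - real N)"
        by (simp flip: powr_add add: algebra_simps)
      finally show "norm (?R \<zeta> * partial_fourier b ?z \<zeta>) \<le> (C * D * (1 + norm \<xi>) powr (r + s - real N)) * ?w" .
    qed
    also have "\<dots> = (C * D * (1 + norm \<xi>) powr (r + s - real N)) * ?W" by (rule integral_mult_right_zero)
    finally show ?thesis using P by (simp add: field_simps)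
  qed
  then show "\<exists>C. \<forall>x\<in>K. \<forall>\<xi>\<in>UNIV. norm (star_rem N a b (x, \<xi>)) \<le> C * (1 + norm \<xi>) powr (r + s - real N)"
    by blast
qed

lemma star_rem_symbol:
  fixes a b :: "'n::finite symb"
  assumes U: "open U" and a: "symbol_on U UNIV r a" and b: "comp_symbol s b"
  shows "symbol_on U UNIV (r + s - real N) (star_rem N a b)"
proof (rule symbol_on_bilinear[where P = "symbol_on U UNIV" and Q = comp_symbol and \<Phi> = "star_rem N"
      and a = a and b = b])
  show O: "open (U \<times> (UNIV :: (real ^ 'n) set))" using U by (intro open_Times) auto
  show "symbol_on U UNIV r (dderivs [v] a)" if "symbol_on U UNIV r a" for r v and a :: "'n symb"
    by (rule symbol_on_dderiv_any[OF O that])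
qed (fact a b | erule (1) symbol_on_dderiv_basis | erule (1) comp_symbol_dderiv(2) | erule comp_symbol_dderiv(1)
    | erule (2) star_rem_dderiv[OF U] | erule (1) star_rem_bounded[OF U])+

section \<open>The product of classical symbols\<close>

text \<open>All k derivatives of \<open>a\<close> are in \<xi> and lower the order by k; those of
  \<open>b\<close> are in x and leave it unchanged.\<close>

lemma classical_star_term:
  fixes a b :: "'n::finite symb"
  assumes U: "open U" and a: "classical U m a sa" and b: "classical U n b sb"
  shows "\<exists>u. classical U (m + n - of_nat k) (star_term k a b) u \<and> (\<forall>z. u 0 z = star_term k (sa 0) (sb 0) z)"
proof -
  let ?A = "\<lambda>J. dderivs (map (Pair 0) J)" and ?B = "\<lambda>J. dderivs (map (\<lambda>e. (e, 0)) J)"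
  let ?u = "\<lambda>i z. (- \<i>) ^ k / fact k * (\<Sum>J\<in>words k. \<Sum>l\<le>i. ?A J (sa l) z * ?B J (sb (i - l)) z)"
  have "classical U (m + n - of_nat k) (\<lambda>z. ?A J a z * ?B J b z) (\<lambda>i z. \<Sum>l\<le>i. ?A J (sa l) z * ?B J (sb (i - l)) z)"
    if J: "J \<in> words k" for J
  proof -
    have 1: "set (map (Pair 0) J) \<subseteq> (Basis :: 'n tpoint set)" "xi_count (map (Pair 0) J :: 'n tpoint list) = k"
      "set (map (\<lambda>e. (e, 0)) J) \<subseteq> (Basis :: 'n tpoint set)"
      using J unfolding words_def by (auto simp: Basis_prod_def xi_count_def filter_map o_def)
    have 2: "xi_count (map (\<lambda>e. (e, 0)) J :: 'n tpoint list) = 0"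
      using J unfolding words_def xi_count_def by (auto simp: filter_empty_conv dest: nonzero_Basis)
    have "classical U ((m - of_nat k) + (n - of_nat 0)) (\<lambda>z. ?A J a z * ?B J b z)
        (\<lambda>i z. \<Sum>l\<le>i. ?A J (sa l) z * ?B J (sb (i - l)) z)"
      using classical_mult[OF U classical_dderivs[OF U a 1(1)] classical_dderivs[OF U b 1(3)]]
      unfolding 1(2) 2 .
    then show ?thesis by (simp add: algebra_simps)
  qed
  then have "classical U (m + n - of_nat k) (\<lambda>z. (- \<i>) ^ k / fact k * (\<Sum>J\<in>words k. ?A J a z * ?B J b z)) ?u"
    by (intro classical_cmult[OF U] classical_sum[OF U])
  then show ?thesis unfolding star_term_def[abs_def] by (intro exI[of _ ?u]) simp
qed

lemma dderivs_ext:
  fixes b :: "'n::finite symb"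
  assumes "open U" "z \<in> U \<times> UNIV"
  shows "dderivs w (ext U b) z = dderivs w b z"
  by (rule dderivs_cong[OF open_Times[OF assms(1) open_UNIV] _ assms(2)]) (auto simp: ext_def)

text \<open>Over \<open>U\<close> the extension by zero has the same derivatives as
  \<open>b\<close>, so the remainder estimate for the extension is one for \<open>b\<close>.\<close>

lemma star_expansion:
  fixes a b :: "'n::finite symb"
  assumes U: "open U" and a: "classical U m a sa" and b: "classical U n b sb"
  shows "symbol_on U UNIV (Re (m + n) - real N) (\<lambda>z. star U a b z - (\<Sum>k<N. star_term k a b z))"
proof -
  have O: "open (U \<times> (UNIV :: (real ^ 'n) set))" using U by (intro open_Times) auto
  note a' = classical_symbol_on[OF U a] and b' = classical_symbol_on[OF U b]
  have cb: "compact_x_support U b" using b unfolding classical_def by blast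
  note B = comp_symbol_ext[OF U b' cb]
  show ?thesis
  proof (rule symbol_on_cong[OF O])
    show "symbol_on U UNIV (Re (m + n) - real N) (star_rem N a (ext U b))"
      using star_rem_symbol[OF U a' B] by simp
    fix z :: "'n tpoint" assume z: "z \<in> U \<times> UNIV"
    then have "star U a b z = star_integral a (ext U b) z" using star_eq_starK[OF U a' b' cb] by auto
    moreover have "star_term k a (ext U b) z = star_term k a b z" for k
      unfolding star_term_def dderivs_ext[OF U z] ..
    ultimately show "star_rem N a (ext U b) z = star U a b z - (\<Sum>k<N. star_term k a b z)"
      unfolding star_rem_def by simp
  qed
qed

lemma compact_x_support_star:
  assumes "compact_x_support U a"
  shows "compact_x_support U (star U a b)"
proof -
  obtain K where K: "compact K" "K \<subseteq> U" "\<And>x \<xi>. x \<in> U - K \<Longrightarrow> a (x, \<xi>) = 0"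
    using assms unfolding compact_x_support_def by blast
  then have "star U a b (x, \<xi>) = 0" if "x \<in> U - K" for x \<xi>
    using that by (simp add: star_def Op_def)
  then show ?thesis unfolding compact_x_support_def using K by blast
qed

text \<open>Component i of the resummed expansion collects the terms with \<open>k \<le> i\<close>;
  for i = 0 only the empty word is left, which gives the pointwise product.\<close>

lemma leads_star:
  fixes a b :: "'n::finite symb"
  assumes U: "open U" and a: "leads U m a f" and b: "leads U n b g"
  shows "leads U (m + n) (star U a b) (\<lambda>z. f z * g z)"
proof -
  obtain sa sb where sa: "classical U m a sa" "\<And>z. z \<in> cotangent0 U \<Longrightarrow> sa 0 z = f z"
    and sb: "classical U n b sb" "\<And>z. z \<in> cotangent0 U \<Longrightarrow> sb 0 z = g z"
    using a b unfolding leads_def by blast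
  note star = star_expansion[OF U sa(1) sb(1)]
  obtain u where u: "\<And>k. classical U (m + n - of_nat k) (star_term k a b) (u k)"
      "\<And>k z. u k 0 z = star_term k (sa 0) (sb 0) z"
    using classical_star_term[OF U sa(1) sb(1)] by metis
  have "classical U (m + n) (star U a b) (\<lambda>i z. \<Sum>k\<le>i. u k (i - k) z)"
  proof (rule classical_asymptotic_sum[OF U _ _ u(1)])
    show "smooth_on (U \<times> UNIV) (star U a b)" using symbol_on_smooth[OF star[of 0]] by simp
    show "compact_x_support U (star U a b)"
      using compact_x_support_star sa(1) unfolding classical_def by blast
    show "symbol_on U far (Re (m + n) - real N) (\<lambda>z. star U a b z - (\<Sum>k<N. star_term k a b z))" for N
      by (rule symbol_on_subset[OF star]) simp
  qed
  then show ?thesis unfolding leads_def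
    by (intro exI[of _ "\<lambda>i z. \<Sum>k\<le>i. u k (i - k) z"]) (auto simp: u(2) star_term_def words_0 sa(2) sb(2))
qed

text \<open>Subtracting the pointwise product removes the term with k = 0, so the expansion starts
  with k = 1 and the order drops by one.\<close>

lemma leads_theta:
  fixes a b :: "'n::finite symb"
  assumes U: "open U" and a: "leads U m a f" and b: "leads U n b g"
  shows "leads U (m + n - 1) (theta U a b) (\<lambda>z. - \<i> * (\<Sum>e\<in>Basis. dderivs [(0, e)] f z * dderivs [(e, 0)] g z))"
proof -
  obtain sa sb where sa: "classical U m a sa" "\<And>z. z \<in> cotangent0 U \<Longrightarrow> sa 0 z = f z"
    and sb: "classical U n b sb" "\<And>z. z \<in> cotangent0 U \<Longrightarrow> sb 0 z = g z"
    using a b unfolding leads_def by blast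
  note star = star_expansion[OF U sa(1) sb(1)]
  obtain u where u: "\<And>k. classical U (m + n - of_nat k) (star_term k a b) (u k)"
      "\<And>k z. u k 0 z = star_term k (sa 0) (sb 0) z"
    using classical_star_term[OF U sa(1) sb(1)] by metis
  have th: "theta U a b z - (\<Sum>k<N. star_term (Suc k) a b z) = star U a b z - (\<Sum>k<Suc N. star_term k a b z)" for N z
    unfolding sum.lessThan_Suc_shift by (simp add: theta_def star_term_def words_0)
  have "symbol_on U UNIV (Re (m + n - 1) - real N) (\<lambda>z. theta U a b z - (\<Sum>k<N. star_term (Suc k) a b z))" for N
    unfolding th using star[of "Suc N"] by (simp add: algebra_simps del: sum.lessThan_Suc)
  note theta = this
  have "classical U (m + n - 1) (theta U a b) (\<lambda>i z. \<Sum>k\<le>i. u (Suc k) (i - k) z)"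
  proof (rule classical_asymptotic_sum[OF U])
    show "smooth_on (U \<times> UNIV) (theta U a b)" using symbol_on_smooth[OF theta[of 0]] by simp
    show "compact_x_support U (theta U a b)"
    proof -
      have "compact_x_support U a" using sa(1) unfolding classical_def by blast
      from compact_x_support_add[OF compact_x_support_star[OF this]
          compact_x_support_cmult[OF compact_x_support_mult[OF this], of "- 1" b]]
      show ?thesis unfolding theta_def[abs_def] by simp
    qed
    show "symbol_on U far (Re (m + n - 1) - real N) (\<lambda>z. theta U a b z - (\<Sum>k<N. star_term (Suc k) a b z))" for N
      by (rule symbol_on_subset[OF theta]) simp
    show "classical U (m + n - 1 - of_nat k) (star_term (Suc k) a b) (u (Suc k))" for k
      using u(1)[of "Suc k"] by (simp add: algebra_simps)
  qed
  moreover have "u (Suc 0) 0 z = - \<i> * (\<Sum>e\<in>Basis. dderivs [(0, e)] f z * dderivs [(e, 0)] g z)"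
    if z: "z \<in> cotangent0 U" for z
  proof -
    have "dderivs w (sa 0) z = dderivs w f z" for w
      by (rule dderivs_cong[OF open_cotangent0[OF U] _ z]) (rule sa(2))
    moreover have "dderivs w (sb 0) z = dderivs w g z" for w
      by (rule dderivs_cong[OF open_cotangent0[OF U] _ z]) (rule sb(2))
    ultimately have "u (Suc 0) 0 z = star_term (Suc 0) f g z" unfolding u(2) star_term_def by simp
    then show ?thesis unfolding star_term_def sum_words_Suc words_0 by simp
  qed
  ultimately show ?thesis unfolding leads_def
    by (intro exI[of _ "\<lambda>i z. \<Sum>k\<le>i. u (Suc k) (i - k) z"]) auto
qed

section \<open>Determinants\<close>

text \<open>Two forms of one determinant: a wedge product permutes the vectors, the
  antisymmetrisation permutes the symbols.\<close>

lemma det_mat_rows: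
  "(\<Sum>\<pi> | \<pi> permutes {..<n}. of_int (sign \<pi>) * (\<Prod>k<n. M k (\<pi> k)))
    = (Determinant.det (Matrix.mat n n (\<lambda>(k, i). M k i)) :: 'a::comm_ring_1)"
  by (subst det_def'[of _ n], simp)
     (auto simp: atLeast0LessThan permutes_in_image[of _ "{..<n}"] intro!: sum.cong prod.cong)

lemma det_mat_columns:
  "(\<Sum>\<pi> | \<pi> permutes {..<n}. of_int (sign \<pi>) * (\<Prod>k<n. M (\<pi> k) k))
    = (Determinant.det (Matrix.mat n n (\<lambda>(k, i). M k i)) :: 'a::comm_ring_1)"
  by (subst det_col[of _ n], simp)
     (auto simp: atLeast0LessThan permutes_in_image[of _ "{..<n}"] intro!: sum.cong prod.cong)

text \<open>Either two of the vectors coincide, or they are distinct and dependent, both with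
  \<open>r = 0\<close>; or they form a basis, in which \<open>X\<close> itself is expanded with
  \<open>r = 1\<close>.\<close>

lemma nontrivial_combination_in_line:
  fixes v :: "nat \<Rightarrow> 'a::euclidean_space"
  assumes "X \<noteq> 0"
  obtains c i r where "i < DIM('a)" "c i \<noteq> 0" "(\<Sum>j<DIM('a). c j *\<^sub>R v j) = r *\<^sub>R X"
proof (cases "inj_on v {..<DIM('a)}")
  case inj: True
  let ?S = "v ` {..<DIM('a)}"
  have sum: "(\<Sum>w\<in>?S. u w *\<^sub>R w) = (\<Sum>j<DIM('a). u (v j) *\<^sub>R v j)" for u
    by (simp only: sum.reindex[OF inj] o_def)
  show ?thesis
  proof (cases "dependent ?S")
    case True
    have fin: "finite ?S" by simp
    from iffD1[OF real_vector.dependent_finite[OF fin] True]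
    obtain u where u: "\<exists>w\<in>?S. u w \<noteq> 0" "(\<Sum>w\<in>?S. u w *\<^sub>R w) = 0" by (elim exE conjE)
    then obtain i where "i < DIM('a)" "u (v i) \<noteq> 0" by auto
    then show ?thesis using that[of i "u \<circ> v" 0] sum[of u] u(2) by simp
  next
    case False
    have "card ?S = DIM('a)" using inj by (simp add: card_image)
    then have "UNIV \<subseteq> span ?S" using False by (intro card_ge_dim_independent) auto
    moreover have "span ?S = range (\<lambda>u. \<Sum>w\<in>?S. u w *\<^sub>R w)" by (rule span_finite) simp
    ultimately have "X \<in> range (\<lambda>u. \<Sum>w\<in>?S. u w *\<^sub>R w)" by blast
    then obtain u where u: "X = (\<Sum>w\<in>?S. u w *\<^sub>R w)" by (rule rangeE)
    have "\<exists>i<DIM('a). u (v i) \<noteq> 0"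
    proof (rule ccontr)
      assume "\<not> ?thesis"
      then have "(\<Sum>j<DIM('a). u (v j) *\<^sub>R v j) = 0" by (intro sum.neutral) auto
      then show False using assms u sum[of u] by simp
    qed
    then obtain i where "i < DIM('a)" "u (v i) \<noteq> 0" by blast
    then show ?thesis using that[of i "u \<circ> v" 1] u sum[of u] by simp
  qed
next
  case False
  then obtain i j where ij: "i < DIM('a)" "j < DIM('a)" "i \<noteq> j" "v i = v j" unfolding inj_on_def by auto
  let ?c = "\<lambda>k. if k = i then 1 else if k = j then - 1 else (0::real)"
  have "(\<Sum>k<DIM('a). ?c k *\<^sub>R v k) = (\<Sum>k\<in>{i, j}. ?c k *\<^sub>R v k)"
    using ij by (intro sum.mono_neutral_right) auto
  also have "\<dots> = 0" using ij by simp
  finally show ?thesis using that[of i ?c 0] ij by simp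
qed

text \<open>The columns are dependent: some nontrivial combination of the \<open>v i\<close> is a multiple of \<open>X\<close>.\<close>

lemma det_common_kernel:
  fixes L :: "nat \<Rightarrow> 'a::euclidean_space \<Rightarrow> complex"
  assumes L: "\<And>k. k < DIM('a) \<Longrightarrow> linear (L k)" and X: "X \<noteq> 0" "\<And>k. k < DIM('a) \<Longrightarrow> L k X = 0"
  shows "Determinant.det (Matrix.mat DIM('a) DIM('a) (\<lambda>(k, i). L k (v i))) = 0"
proof -
  let ?n = "DIM('a)"
  let ?A = "Matrix.mat ?n ?n (\<lambda>(k, i). L k (v i))"
  obtain c i r where c: "i < ?n" "c i \<noteq> 0" "(\<Sum>j<?n. c j *\<^sub>R v j) = r *\<^sub>R X"
    using nontrivial_combination_in_line[OF X(1)] by metis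
  \<comment> \<open>The maps \<open>L k\<close> are only real linear, so the coefficients have to be
    real; embedded into the complex numbers they form a kernel vector of the complex matrix.\<close>
  let ?c = "Matrix.vec ?n (\<lambda>j. complex_of_real (c j))"
  have "(\<Sum>j<?n. L k (v j) * of_real (c j)) = 0" if k: "k < ?n" for k
  proof -
    have "(\<Sum>j<?n. L k (v j) * of_real (c j)) = L k (\<Sum>j<?n. c j *\<^sub>R v j)"
    proof -
      have "L k (\<Sum>j<?n. c j *\<^sub>R v j) = (\<Sum>j<?n. c j *\<^sub>R L k (v j))"
        by (simp only: linear_sum[OF L[OF k]] linear_cmul[OF L[OF k]])
      then show ?thesis by (simp add: scaleR_conv_of_real mult.commute)
    qed
    then show ?thesis unfolding c(3) using linear_cmul[OF L[OF k]] X(2)[OF k] by simp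
  qed
  then have "?A *\<^sub>v ?c = 0\<^sub>v ?n"
    by (intro eq_vecI) (auto simp: scalar_prod_def atLeast0LessThan)
  moreover have "?c \<noteq> 0\<^sub>v ?n" using c(1,2) by (metis index_vec index_zero_vec(1) of_real_eq_0_iff)
  moreover have "?c \<in> carrier_vec ?n" by simp
  ultimately show ?thesis
    by (subst det_0_iff_vec_prod_zero[of _ ?n], simp) (intro exI[of _ ?c] conjI)
qed

section \<open>Wedge products of one-forms as determinants\<close>

lemma pw_mult_apply: "pw_mult f g z = f z * g z"
  by (simp add: pw_mult_def)

text \<open>A permutation \<rho> of the first p slots is absorbed by replacing \<pi> with
  \<open>\<pi> \<circ> \<rho>\<close>, which changes the sign accordingly and leaves slot p alone.
  The p! equal sums cancel the denominator \<open>fact p\<close>.\<close>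

lemma iterated_wedge_pw_mult:
  assumes \<omega>: "\<And>k z u. k < p \<Longrightarrow> \<omega> k z u = L k z (u 0)"
  shows "iterated_wedge pw_mult f \<omega> p z v
    = f z * (\<Sum>\<pi> | \<pi> permutes {..<p}. of_int (sign \<pi>) * (\<Prod>k<p. L k z (v (\<pi> k))))"
  using assms
proof (induction p arbitrary: v)
  case 0
  have "{\<pi>. \<pi> permutes ({} :: nat set)} = {id}" by auto
  then show ?case by simp
next
  case (Suc p)
  let ?g = "\<lambda>\<pi>. of_int (sign \<pi>) * (\<Prod>k<Suc p. L k z (v (\<pi> k)))"
  let ?P = "\<lambda>p. {\<pi>. \<pi> permutes {..<p::nat}}"
  have "iterated_wedge pw_mult f \<omega> (Suc p) z v
      = (\<Sum>\<pi>\<in>?P (Suc p). of_int (sign \<pi>) * (f z * (\<Sum>\<rho>\<in>?P p. of_int (sign \<rho>) * (\<Prod>k<p. L k z (v (\<pi> (\<rho> k)))))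
        * L p z (v (\<pi> p)))) / fact p"
  proof -
    have "iterated_wedge pw_mult f \<omega> p z (\<lambda>k. v (\<pi> k))
        = f z * (\<Sum>\<rho>\<in>?P p. of_int (sign \<rho>) * (\<Prod>k<p. L k z (v (\<pi> (\<rho> k)))))" for \<pi>
      using Suc.IH[of "\<lambda>k. v (\<pi> k)"] Suc.prems by simp
    then show ?thesis using Suc.prems by (simp add: wedge_with_def pw_mult_apply)
  qed
  also have "\<dots> = f z * (\<Sum>\<rho>\<in>?P p. \<Sum>\<pi>\<in>?P (Suc p). of_int (sign \<pi>) * (of_int (sign \<rho>) * (\<Prod>k<p. L k z (v (\<pi> (\<rho> k)))) * L p z (v (\<pi> p)))) / fact p"
    unfolding sum_distrib_left sum_distrib_right by (subst sum.swap) (simp add: mult_ac)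
  also have "(\<Sum>\<rho>\<in>?P p. \<Sum>\<pi>\<in>?P (Suc p). of_int (sign \<pi>) * (of_int (sign \<rho>) * (\<Prod>k<p. L k z (v (\<pi> (\<rho> k)))) * L p z (v (\<pi> p))))
      = (\<Sum>\<rho>\<in>?P p. \<Sum>\<pi>\<in>?P (Suc p). ?g \<pi>)"
  proof (rule sum.cong[OF refl])
    fix \<rho> assume "\<rho> \<in> ?P p"
    then have \<rho>: "\<rho> permutes {..<p}" "\<rho> permutes {..<Suc p}" by (auto intro: permutes_subset)
    have "(\<Sum>\<pi>\<in>?P (Suc p). ?g \<pi>) = (\<Sum>\<pi>\<in>?P (Suc p). ?g (\<pi> \<circ> \<rho>))"
      by (rule sum_permutations_compose_right[OF \<rho>(2)])
    also have "\<dots> = (\<Sum>\<pi>\<in>?P (Suc p). of_int (sign \<pi>) * (of_int (sign \<rho>) * (\<Prod>k<p. L k z (v (\<pi> (\<rho> k)))) * L p z (v (\<pi> p))))"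
    proof (intro sum.cong refl)
      fix \<pi> assume "\<pi> \<in> ?P (Suc p)"
      then have "sign (\<pi> \<circ> \<rho>) = sign \<pi> * sign \<rho>"
        using \<rho>(2) permutes_imp_permutation[OF finite_lessThan] by (intro sign_compose) auto
      moreover have "\<rho> p = p" using \<rho>(1) by (simp add: permutes_def)
      ultimately show "?g (\<pi> \<circ> \<rho>) = of_int (sign \<pi>) * (of_int (sign \<rho>) * (\<Prod>k<p. L k z (v (\<pi> (\<rho> k)))) * L p z (v (\<pi> p)))"
        by simp
    qed
    finally show "(\<Sum>\<pi>\<in>?P (Suc p). of_int (sign \<pi>) * (of_int (sign \<rho>) * (\<Prod>k<p. L k z (v (\<pi> (\<rho> k)))) * L p z (v (\<pi> p))))
        = (\<Sum>\<pi>\<in>?P (Suc p). ?g \<pi>)" by simp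
  qed
  also have "\<dots> = fact p * (\<Sum>\<pi>\<in>?P (Suc p). ?g \<pi>)"
    by (simp add: card_permutations[of "{..<p}" p])
  finally show ?case by simp
qed

lemma iterated_wedge_det:
  assumes "\<And>k z u. k < p \<Longrightarrow> \<omega> k z u = L k z (u 0)"
  shows "iterated_wedge pw_mult f \<omega> p z v
    = f z * Determinant.det (Matrix.mat p p (\<lambda>(k, i). L k z (v i)))"
  using iterated_wedge_pw_mult[of p \<omega> L f z v, OF assms] det_mat_rows[where n = p and M = "\<lambda>k i. L k z (v i)"] by simp

section \<open>The residue\<close>

text \<open>Gives the choice in \<open>hypersurface_integral\<close> its meaning; \<nu> is completed
  to an orthonormal basis.\<close>

lemma tangent_frame_exists:
  fixes \<nu> :: "'a::euclidean_space"
  assumes "norm \<nu> = 1"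
  shows "\<exists>e. tangent_frame \<nu> e"
proof -
  obtain S where S: "\<nu> \<in> S" "pairwise real_inner_class.orthogonal S" "\<And>x. x \<in> S \<Longrightarrow> norm x = 1" "independent S" "card S = DIM('a)"
    using vector_in_orthonormal_basis[OF assms] by metis
  have "finite S" using S(4) independent_imp_finite by blast
  then have "card (S - {\<nu>}) = DIM('a) - 1" "finite (S - {\<nu>})" using S by auto
  then obtain e where e: "bij_betw e {..<DIM('a) - 1} (S - {\<nu>})"
    using ex_bij_betw_nat_finite[of "S - {\<nu>}"] by (auto simp: atLeast0LessThan)
  have eS: "e k \<in> S - {\<nu>}" if "k < DIM('a) - 1" for k using e that bij_betwE by blast
  have "e j \<bullet> e k = (if j = k then 1 else 0)" if jk: "j < DIM('a) - 1" "k < DIM('a) - 1" for j k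
  proof (cases "j = k")
    case True
    then show ?thesis using S(3)[of "e k"] eS[OF jk(2)] by (simp add: dot_square_norm)
  next
    case False
    then have "e j \<noteq> e k" using bij_betw_imp_inj_on[OF e] jk by (auto simp: inj_on_def)
    then show ?thesis using False S(2) eS[OF jk(1)] eS[OF jk(2)] unfolding pairwise_def real_inner_class.orthogonal_def by auto
  qed
  moreover have "e k \<bullet> \<nu> = 0" if "k < DIM('a) - 1" for k
    using S(1,2) eS[OF that] unfolding pairwise_def real_inner_class.orthogonal_def by auto
  ultimately show ?thesis unfolding tangent_frame_def by blast
qed

text \<open>Both factors are the determinant of the orthogonal matrix with columns \<xi>,
  \<open>e 0\<close>, \<open>e 1\<close>, ...: the first by definition, the second by Laplace
  expansion along the column of \<xi>. Its square is 1, which makes the integrand independent of the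
  chosen frame.\<close>

lemma dS_tangent_frame:
  fixes \<xi> :: "real ^ 'n::finite"
  assumes "norm \<xi> = 1" "tangent_frame \<xi> e"
  shows "of_real (det_form std_frame (case_nat \<xi> e)) * dS \<xi> e = 1"
proof -
  let ?n = "CARD('n)" and ?v = "case_nat \<xi> e"
  define A where "A = Matrix.mat ?n ?n (\<lambda>(k, i). complex_of_real (?v i \<bullet> std_frame k))"
  have A: "A \<in> carrier_mat ?n ?n" unfolding A_def by simp
  have n: "?n > 0" by simp
  have "of_real (det_form std_frame ?v) = Determinant.det A"
    unfolding A_def det_mat_rows[symmetric] det_form_def by simp
  moreover have "dS \<xi> e = Determinant.det A"
  proof -
    have "dS \<xi> e = (\<Sum>i<?n. A $$ (i, 0) * cofactor A i 0)"
      unfolding dS_def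
    proof (intro sum.cong refl)
      fix i assume "i \<in> {..<?n}"
      then have i: "i < ?n" by simp
      have B: "mat_delete A i 0 = Matrix.mat (?n - 1) (?n - 1)
          (\<lambda>(k, j). complex_of_real (e j \<bullet> std_frame (if k < i then k else Suc k)))"
        unfolding mat_delete_def using A by (intro eq_matI) (auto simp: A_def)
      have "iterated_wedge pw_mult (\<lambda>_. 1) (\<lambda>k _ w. of_real (Finite_Cartesian_Product.vec_nth (w 0) (coord (if k < i then k else Suc k)))) (?n - 1) \<xi> e
          = Determinant.det (mat_delete A i 0)"
        unfolding B by (subst iterated_wedge_det[where L = "\<lambda>k _ w. of_real (w \<bullet> std_frame (if k < i then k else Suc k))"])
          (simp_all add: std_frame_def inner_axis)
      moreover have "A $$ (i, 0) = of_real (Finite_Cartesian_Product.vec_nth \<xi> (coord i))"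
        using i n by (simp add: A_def std_frame_def inner_axis)
      ultimately show "(- 1) ^ i * of_real (Finite_Cartesian_Product.vec_nth \<xi> (coord i)) *
          iterated_wedge pw_mult (\<lambda>_. 1) (\<lambda>k _ w. of_real (Finite_Cartesian_Product.vec_nth (w 0) (coord (if k < i then k else Suc k)))) (?n - 1) \<xi> e
          = A $$ (i, 0) * cofactor A i 0"
        by (simp add: cofactor_def)
    qed
    also have "\<dots> = Determinant.det A" by (rule laplace_expansion_column[OF A n, symmetric])
    finally show ?thesis .
  qed
  moreover have "Determinant.det A * Determinant.det A = 1"
  proof -
    have on: "?v i \<bullet> ?v j = (if i = j then 1 else 0)" if "i < ?n" "j < ?n" for i j
      using assms that unfolding tangent_frame_def
      by (cases i; cases j) (auto simp: dot_square_norm inner_commute)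
    have "A\<^sup>T * A = 1\<^sub>m ?n"
    proof (intro eq_matI)
      fix i j assume "i < dim_row (1\<^sub>m ?n)" "j < dim_col (1\<^sub>m ?n)"
      then have ij: "i < ?n" "j < ?n" by auto
      have "(A\<^sup>T * A) $$ (i, j) = (\<Sum>k<?n. complex_of_real (?v i \<bullet> std_frame k) * of_real (?v j \<bullet> std_frame k))"
        using ij by (simp add: A_def scalar_prod_def atLeast0LessThan)
      also have "\<dots> = of_real (\<Sum>k<?n. Finite_Cartesian_Product.vec_nth (?v i) (coord k) * Finite_Cartesian_Product.vec_nth (?v j) (coord k))"
        by (simp add: std_frame_def inner_axis)
      also have "(\<Sum>k<?n. Finite_Cartesian_Product.vec_nth (?v i) (coord k) * Finite_Cartesian_Product.vec_nth (?v j) (coord k)) = ?v i \<bullet> ?v j"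
        unfolding inner_vec_def inner_real_def by (rule sum.reindex_bij_betw[OF bij_betw_coord])
      finally show "(A\<^sup>T * A) $$ (i, j) = 1\<^sub>m ?n $$ (i, j)" using on[OF ij] ij by simp
    qed (use A in auto)
    then have "Determinant.det (A\<^sup>T * A) = 1" by simp
    then show ?thesis using det_mult[of "A\<^sup>T" ?n A] det_transpose[OF A] A by simp
  qed
  ultimately show ?thesis by simp
qed

lemma residue_integrand:
  "hypersurface_integral std_frame (sphere 0 1) sphere_measure (\<lambda>\<xi>. \<xi>) (\<lambda>\<xi> v. h \<xi> * dS \<xi> v)
    = (LINT \<xi>:sphere (0 :: real ^ 'n::finite) 1|sphere_measure. h \<xi>)"
  unfolding hypersurface_integral_def set_lebesgue_integral_def Let_def
proof (intro Bochner_Integration.integral_cong refl)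
  fix \<xi> :: "real ^ 'n"
  let ?e = "SOME e. tangent_frame \<xi> e"
  show "indicator (sphere 0 1) \<xi> *\<^sub>R (of_real (det_form std_frame (case_nat \<xi> ?e)) * (h \<xi> * dS \<xi> ?e))
      = indicator (sphere 0 1) \<xi> *\<^sub>R h \<xi>"
  proof (cases "\<xi> \<in> sphere 0 1")
    case True
    then have "norm \<xi> = 1" by simp
    moreover from this have "tangent_frame \<xi> ?e" by (rule someI_ex[OF tangent_frame_exists])
    ultimately have "of_real (det_form std_frame (case_nat \<xi> ?e)) * dS \<xi> ?e = 1" by (rule dS_tangent_frame)
    then show ?thesis by (simp add: mult.left_commute)
  qed simp
qed

section \<open>Integrability of leading components over the cosphere bundle\<close>

lemma sphere_measure_sets [simp]: "sets sphere_measure = sets borel" "space sphere_measure = UNIV"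
  by (simp_all add: sphere_measure_def)

lemma finite_sphere_measure: "finite_measure (sphere_measure :: 'a::euclidean_space measure)"
proof -
  let ?D = "density lborel (\<lambda>\<xi>::'a. of_nat DIM('a) * indicator (cball 0 1) \<xi>)"
  have "emeasure ?D (space ?D) = of_nat DIM('a) * emeasure lborel (cball (0::'a) 1)"
  proof -
    have "emeasure ?D UNIV = (\<integral>\<^sup>+ \<xi>. of_nat DIM('a) * indicator (cball 0 1) \<xi> * indicator UNIV \<xi> \<partial>(lborel :: 'a measure))"
      by (rule emeasure_density)
        (auto intro!: borel_measurable_times_ennreal borel_measurable_indicator)
    then show ?thesis by (simp add: nn_integral_cmult_indicator)
  qed
  also have "\<dots> < \<infinity>" using emeasure_lborel_cball_finite[of "0::'a" 1] by (simp add: ennreal_mult_less_top of_nat_less_top)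
  finally have "finite_measure ?D" by (intro finite_measureI) simp
  moreover have "(sgn :: 'a \<Rightarrow> 'a) \<in> measurable ?D borel" unfolding sgn_div_norm[abs_def] by simp
  ultimately show ?thesis unfolding sphere_measure_def by (rule finite_measure.finite_measure_distr)
qed

interpretation sphere_measure: finite_measure sphere_measure
  by (rule finite_sphere_measure)

text \<open>\<open>g\<close> is continuous off the zero section and supported in x in a compact set,
  hence bounded on the cosphere bundle, whose fibres have finite measure.\<close>

lemma leads_residue_integrable:
  fixes f g :: "'n::finite symb"
  assumes U: "open U" and fg: "leads U m f g"
  shows "x \<in> U \<Longrightarrow> set_integrable sphere_measure (sphere 0 1) (\<lambda>\<xi>. g (x, \<xi>))"
    and "set_integrable lborel U (\<lambda>x. LINT \<xi>:sphere 0 1|sphere_measure. g (x, \<xi>))"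
proof -
  obtain s where s: "classical U m f s" "\<And>z. z \<in> cotangent0 U \<Longrightarrow> s 0 z = g z"
    using fg unfolding leads_def by blast
  have cont: "continuous_on (cotangent0 U) g"
    using leads_homogeneous[OF U fg] smooth_on_continuous unfolding pos_homogeneous_def by blast
  obtain K where K: "compact K" "K \<subseteq> U" "\<And>x \<xi>. x \<in> U - K \<Longrightarrow> f (x, \<xi>) = 0"
    using s(1) unfolding classical_def compact_x_support_def by blast
  have g0: "g (x, \<xi>) = 0" if x: "x \<in> U - K" "\<xi> \<noteq> 0" for x \<xi>
  proof -
    \<comment> \<open>The leading component inherits the x-support of \<open>f\<close> by
      uniqueness: along a ray on which \<open>f\<close> vanishes, the expansion with the single
      summand \<open>f\<close> has leading coefficient 0.\<close>
    have "(\<Sum>j\<in>{()}. 1 * (\<Sum>i | m - of_nat i = m. s i (x, \<xi>))) = 0"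
      by (rule homogeneous_coefficient_zero[where fs = "\<lambda>_. f" and U = U]) (use s(1) x K(3) in auto)
    moreover have "{i. m - of_nat i = m} = {0}" by auto
    ultimately show ?thesis using s(2)[of "(x, \<xi>)"] x by (simp add: cotangent0_def)
  qed
  have cs: "continuous_on (K \<times> sphere 0 1) g"
    by (rule continuous_on_subset[OF cont]) (use K in \<open>auto simp: cotangent0_def\<close>)
  obtain B where B: "B > 0" "\<And>z. z \<in> K \<times> sphere 0 1 \<Longrightarrow> norm (g z) \<le> B"
    using continuous_on_compact_bound[OF compact_Times[OF K(1) compact_sphere] cs] by blast
  have gB: "norm (g (x, \<xi>)) \<le> indicator K x * B" if "x \<in> U" "\<xi> \<in> sphere 0 1" for x \<xi>
  proof -
    have "\<xi> \<noteq> 0" using that by auto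
    then show ?thesis using B(2)[of "(x, \<xi>)"] g0[of x \<xi>] that by (cases "x \<in> K") auto
  qed
  \<comment> \<open>Extended by 0 to a jointly Borel function, so that the integral over the sphere
    is measurable in x.\<close>
  define G where "G = (\<lambda>z. indicator (cotangent0 U) z *\<^sub>R g z)"
  have "G \<in> borel_measurable borel"
    unfolding G_def using cont open_cotangent0[OF U] by (intro borel_measurable_continuous_on_indicator) auto
  then have Gm: "G \<in> borel_measurable (borel \<Otimes>\<^sub>M borel)" by (simp add: borel_prod)
  have GI: "indicator (sphere 0 1) \<xi> *\<^sub>R g (x, \<xi>) = indicator (sphere 0 1) \<xi> *\<^sub>R G (x, \<xi>)" if "x \<in> U" for x \<xi>
    using that unfolding G_def cotangent0_def by (auto simp: indicator_def)
  have Gx: "(\<lambda>\<xi>. G (x, \<xi>)) \<in> borel_measurable borel" for x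
    using measurable_compose_Pair1[of x borel G borel borel] Gm by simp
  have bd: "norm (indicator (sphere 0 1) \<xi> *\<^sub>R G (x, \<xi>)) \<le> indicator K x * B" for x \<xi>
  proof (cases "x \<in> U \<and> \<xi> \<in> sphere 0 1")
    case True then show ?thesis using gB[of x \<xi>] GI[of x \<xi>] by simp
  next
    case False
    then have Z: "indicator (sphere 0 1) \<xi> *\<^sub>R G (x, \<xi>) = 0" by (auto simp: G_def cotangent0_def indicator_def)
    show ?thesis unfolding Z using B(1) by simp
  qed
  have mS: "(\<lambda>\<xi>. indicator (sphere 0 1) \<xi> *\<^sub>R G (x, \<xi>)) \<in> borel_measurable sphere_measure" for x
    unfolding measurable_cong_sets[OF sphere_measure_sets(1) refl]
    by (intro borel_measurable_scaleR borel_measurable_indicator Gx) auto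
  have iS: "integrable sphere_measure (\<lambda>\<xi>. indicator (sphere 0 1) \<xi> *\<^sub>R G (x, \<xi>))" for x
    by (rule sphere_measure.integrable_const_bound[where B = "indicator K x * B"]) (use bd mS in auto)
  show "set_integrable sphere_measure (sphere 0 1) (\<lambda>\<xi>. g (x, \<xi>))" if "x \<in> U" for x
    unfolding set_integrable_def GI[OF that] by (rule iS)
  have eq: "indicator U x *\<^sub>R (LINT \<xi>:sphere 0 1|sphere_measure. g (x, \<xi>))
      = indicator U x *\<^sub>R (LINT \<xi>|sphere_measure. indicator (sphere 0 1) \<xi> *\<^sub>R G (x, \<xi>))" for x
  proof (cases "x \<in> U")
    case True
    have "(LINT \<xi>:sphere 0 1|sphere_measure. g (x, \<xi>))
        = (LINT \<xi>|sphere_measure. indicator (sphere 0 1) \<xi> *\<^sub>R G (x, \<xi>))"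
      unfolding set_lebesgue_integral_def by (intro Bochner_Integration.integral_cong refl GI[OF True])
    then show ?thesis by (rule arg_cong)
  qed simp
  let ?V = "measure sphere_measure (UNIV :: (real ^ 'n) set)"
  show "set_integrable lborel U (\<lambda>x. LINT \<xi>:sphere 0 1|sphere_measure. g (x, \<xi>))"
    unfolding set_integrable_def eq
  proof (rule Bochner_Integration.integrable_bound)
    show "integrable lborel (\<lambda>x. indicator K x * (B * ?V))"
      using K(1) emeasure_compact_finite by (intro integrable_mult_left integrable_real_indicator) (auto intro: borel_compact)
    have "(\<lambda>x. LINT \<xi>|sphere_measure. indicator (sphere 0 1) \<xi> *\<^sub>R G (x, \<xi>)) \<in> borel_measurable borel"
    proof (rule sphere_measure.borel_measurable_lebesgue_integral)
      have "(\<lambda>p::'n tpoint. indicator (sphere 0 1) (snd p) *\<^sub>R G p) \<in> borel_measurable (borel \<Otimes>\<^sub>M borel)"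
        using Gm by (intro borel_measurable_scaleR measurable_compose[OF measurable_snd] borel_measurable_indicator) auto
      then show "(\<lambda>(x, \<xi>). indicator (sphere 0 1) \<xi> *\<^sub>R G (x, \<xi>)) \<in> borel_measurable (borel \<Otimes>\<^sub>M sphere_measure)"
        by (simp add: case_prod_beta' measurable_cong_sets[OF sets_pair_measure_cong[OF refl sphere_measure_sets(1)] refl])
    qed
    then show "(\<lambda>x. indicator U x *\<^sub>R (LINT \<xi>|sphere_measure. indicator (sphere 0 1) \<xi> *\<^sub>R G (x, \<xi>))) \<in> borel_measurable lborel"
      using U by (intro borel_measurable_scaleR borel_measurable_indicator) auto
    show "AE x in lborel. norm (indicator U x *\<^sub>R (LINT \<xi>|sphere_measure. indicator (sphere 0 1) \<xi> *\<^sub>R G (x, \<xi>)))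
        \<le> norm (indicator K x * (B * ?V))"
    proof (rule AE_I2)
      fix x
      have "norm (LINT \<xi>|sphere_measure. indicator (sphere 0 1) \<xi> *\<^sub>R G (x, \<xi>))
          \<le> (LINT \<xi>|sphere_measure. norm (indicator (sphere 0 1) \<xi> *\<^sub>R G (x, \<xi>)))"
        by (rule integral_norm_bound)
      also have "\<dots> \<le> (LINT \<xi>::real ^ 'n|sphere_measure. indicator K x * B)"
        by (intro integral_mono integrable_norm iS bd) auto
      also have "\<dots> = indicator K x * (B * ?V)" by (simp add: mult_ac)
      finally show "norm (indicator U x *\<^sub>R (LINT \<xi>|sphere_measure. indicator (sphere 0 1) \<xi> *\<^sub>R G (x, \<xi>)))
          \<le> norm (indicator K x * (B * ?V))"
        using B(1) by (cases "x \<in> U") auto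
    qed
  qed
qed

lemma res_leads:
  fixes f g :: "'n::finite symb"
  assumes "open U" "cutoff U \<psi>" "leads U (- of_nat CARD('n)) f g"
  shows "res \<psi> U f = (LINT x:U|lborel. LINT \<xi>:sphere 0 1|sphere_measure. g (x, \<xi>))"
  unfolding res_def residue_integrand hom_component_leads[OF assms] set_lebesgue_integral_def
proof (intro Bochner_Integration.integral_cong refl)
  fix x :: "real ^ 'n"
  have "indicator (sphere 0 1) \<xi> *\<^sub>R (if (x, \<xi>) \<in> cotangent0 U then g (x, \<xi>) else 0)
      = indicator (sphere 0 1) \<xi> *\<^sub>R g (x, \<xi>)" if "x \<in> U" for \<xi>
    using that by (auto simp: cotangent0_def indicator_def)
  then have "(LINT \<xi>|sphere_measure. indicator (sphere 0 1) \<xi> *\<^sub>R (if (x, \<xi>) \<in> cotangent0 U then g (x, \<xi>) else 0))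
      = (LINT \<xi>|sphere_measure. indicator (sphere 0 1) \<xi> *\<^sub>R g (x, \<xi>))" if "x \<in> U"
    using that by (intro Bochner_Integration.integral_cong refl)
  then show "indicator U x *\<^sub>R (LINT \<xi>|sphere_measure. indicator (sphere 0 1) \<xi> *\<^sub>R
        (if (x, \<xi>) \<in> cotangent0 U then g (x, \<xi>) else 0))
      = indicator U x *\<^sub>R (LINT \<xi>|sphere_measure. indicator (sphere 0 1) \<xi> *\<^sub>R g (x, \<xi>))"
    by (cases "x \<in> U") (simp_all only: indicator_simps scaleR_one scaleR_zero_left not_False_eq_True)
qed

lemma sum_set_integral:
  fixes f :: "'i \<Rightarrow> 'a \<Rightarrow> complex"
  assumes "\<And>i. i \<in> I \<Longrightarrow> set_integrable M A (f i)"
  shows "(\<Sum>i\<in>I. c i * (LINT x:A|M. f i x)) = (LINT x:A|M. (\<Sum>i\<in>I. c i * f i x))"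
proof -
  have "(LINT x:A|M. (\<Sum>i\<in>I. c i * f i x)) = (LINT x|M. (\<Sum>i\<in>I. c i * (indicator A x *\<^sub>R f i x)))"
    unfolding set_lebesgue_integral_def scaleR_sum_right by (simp only: mult_scaleR_right)
  also have "\<dots> = (\<Sum>i\<in>I. LINT x|M. c i * (indicator A x *\<^sub>R f i x))"
    using assms unfolding set_integrable_def
    by (intro Bochner_Integration.integral_sum integrable_mult_right)
  also have "\<dots> = (\<Sum>i\<in>I. c i * (LINT x:A|M. f i x))"
    unfolding set_lebesgue_integral_def by (simp only: integral_mult_right_zero)
  finally show ?thesis ..
qed

text \<open>Linearity of the residue is obtained from its integral form: each term is integrable, so
  the sum may be taken inside both integrals, where it vanishes pointwise.\<close>

lemma sum_res_leads_0:
  fixes f g :: "'i \<Rightarrow> 'n::finite symb"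
  assumes U: "open U" "cutoff U \<psi>" and fg: "\<And>i. i \<in> I \<Longrightarrow> leads U (- of_nat CARD('n)) (f i) (g i)"
    and zero: "\<And>z. z \<in> cotangent0 U \<Longrightarrow> (\<Sum>i\<in>I. c i * g i z) = 0"
  shows "(\<Sum>i\<in>I. c i * res \<psi> U (f i)) = 0"
proof -
  note int = leads_residue_integrable[OF U(1) fg]
  have inner: "(\<Sum>i\<in>I. c i * (LINT \<xi>:sphere 0 1|sphere_measure. g i (x, \<xi>))) = 0" if x: "x \<in> U" for x
  proof -
    have "(\<Sum>i\<in>I. c i * (LINT \<xi>:sphere 0 1|sphere_measure. g i (x, \<xi>)))
        = (LINT \<xi>:sphere 0 1|sphere_measure. (\<Sum>i\<in>I. c i * g i (x, \<xi>)))"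
      by (rule sum_set_integral) (rule int(1)[OF _ x])
    also have "\<dots> = (LINT \<xi>:(sphere 0 1 :: (real ^ 'n) set)|sphere_measure. 0)"
      unfolding set_lebesgue_integral_def
    proof (intro Bochner_Integration.integral_cong refl)
      fix \<xi> :: "real ^ 'n"
      have "\<xi> \<in> sphere 0 1 \<Longrightarrow> (x, \<xi>) \<in> cotangent0 U" using x by (auto simp: cotangent0_def)
      then show "indicator (sphere 0 1) \<xi> *\<^sub>R (\<Sum>i\<in>I. c i * g i (x, \<xi>)) = indicator (sphere 0 1) \<xi> *\<^sub>R (0 :: complex)"
        using zero by (cases "\<xi> \<in> sphere 0 1") auto
    qed
    finally show ?thesis by simp
  qed
  have "(\<Sum>i\<in>I. c i * res \<psi> U (f i))
      = (\<Sum>i\<in>I. c i * (LINT x:U|lborel. LINT \<xi>:sphere 0 1|sphere_measure. g i (x, \<xi>)))"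
    using res_leads[OF U fg] by simp
  also have "\<dots> = (LINT x:U|lborel. (\<Sum>i\<in>I. c i * (LINT \<xi>:sphere 0 1|sphere_measure. g i (x, \<xi>))))"
    by (rule sum_set_integral) (rule int(2))
  also have "\<dots> = (LINT x:U|lborel. 0)"
    unfolding set_lebesgue_integral_def[of lborel]
    using inner by (intro Bochner_Integration.integral_cong refl) (auto simp: indicator_def)
  finally show ?thesis by simp
qed

section \<open>Vanishing of the integrands\<close>

text \<open>Euler's relation in degree 0: \<open>L\<close> is constant along rays.\<close>

lemma frechet_derivative_radial:
  fixes L :: "'n::finite symb"
  assumes "pos_homogeneous U 0 L" "x \<in> U" "\<xi> \<noteq> 0"
  shows "frechet_derivative L (at (x, \<xi>)) (0, \<xi>) = 0"
proof -
  have sm: "smooth_on (cotangent0 U) L"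
    and hom: "\<And>t. t > 0 \<Longrightarrow> L (x, t *\<^sub>R \<xi>) = of_real t powr 0 * L (x, \<xi>)"
    using assms unfolding pos_homogeneous_def by auto
  have "(x, \<xi>) \<in> cotangent0 U" using assms unfolding cotangent0_def by auto
  then have *: "(L has_derivative frechet_derivative L (at (x, \<xi>))) (at (x, 1 *\<^sub>R \<xi>))"
    using iffD1[OF frechet_derivative_works smooth_on_differentiable[OF sm]] by simp
  have "((\<lambda>t::real. (x, t *\<^sub>R \<xi>)) has_derivative (\<lambda>h. (0, h *\<^sub>R \<xi>))) (at 1)"
    by (auto intro!: derivative_eq_intros)
  from has_derivative_compose[OF this *]
  have "((\<lambda>t. L (x, t *\<^sub>R \<xi>)) has_derivative (\<lambda>h. frechet_derivative L (at (x, \<xi>)) (0, h *\<^sub>R \<xi>))) (at 1)" .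
  then have "((\<lambda>t::real. L (x, \<xi>)) has_derivative (\<lambda>h. frechet_derivative L (at (x, \<xi>)) (0, h *\<^sub>R \<xi>))) (at 1)"
    by (rule has_derivative_transform_within_open[of _ _ _ _ "{0<..}"]) (auto simp: hom)
  then have "(\<lambda>h::real. frechet_derivative L (at (x, \<xi>)) (0, h *\<^sub>R \<xi>)) = (\<lambda>h. 0)"
    using has_derivative_unique has_derivative_const by blast
  from fun_cong[OF this, of 1] show ?thesis by simp
qed

lemma wedge_with_alt:
  "wedge_with prd p q \<alpha> \<beta> z v = 1 / (fact p * fact q) * (\<Sum>\<pi> | \<pi> permutes {..<p + q}. of_int (sign \<pi>) *
    prd (\<lambda>w. \<alpha> w (\<lambda>k. v (\<pi> k))) (\<lambda>w. \<beta> w (\<lambda>k. v (\<pi> (p + k)))) z)"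
  by (simp add: wedge_with_def)

text \<open>The product is kept abstract to cover the pointwise and the left product together:
  either one multiplies leading components, and a differential evaluated on a basis vector is a
  first derivative.\<close>

lemma leads_iterated_wedge:
  fixes a :: "'n::finite symb"
  assumes U: "open U"
    and prd: "\<And>m n a b f g. leads U m a f \<Longrightarrow> leads U n b g \<Longrightarrow> leads U (m + n) (prd a b) (\<lambda>z. f z * g z)"
    and a: "leads U 0 a f" and s: "\<And>k. k < p \<Longrightarrow> leads U 0 (s k) (l k)" and v: "\<And>k. v k \<in> Basis"
  shows "leads U (- of_nat (\<Sum>k<p. xi_count [v k])) (\<lambda>z. iterated_wedge prd a (\<lambda>k. diff_form (s k)) p z v)
    (\<lambda>z. iterated_wedge pw_mult f (\<lambda>k. diff_form (l k)) p z v)"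
  using s v
proof (induction p arbitrary: v)
  case 0 then show ?case using a by simp
next
  case (Suc p)
  let ?A = "iterated_wedge prd a (\<lambda>k. diff_form (s k)) p" and ?F = "iterated_wedge pw_mult f (\<lambda>k. diff_form (l k)) p"
  have "leads U (- of_nat (\<Sum>k<Suc p. xi_count [v k])) (\<lambda>z. of_int (sign \<pi>) *
        prd (\<lambda>w. ?A w (\<lambda>k. v (\<pi> k))) (\<lambda>w. diff_form (s p) w (\<lambda>k. v (\<pi> (p + k)))) z)
      (\<lambda>z. of_int (sign \<pi>) * (?F z (\<lambda>k. v (\<pi> k)) * diff_form (l p) z (\<lambda>k. v (\<pi> (p + k)))))"
    if \<pi>: "\<pi> permutes {..<Suc p}" for \<pi>
  proof (rule leads_cmult[OF U])
    have 1: "leads U (- of_nat (\<Sum>k<p. xi_count [v (\<pi> k)])) (\<lambda>z. ?A z (\<lambda>k. v (\<pi> k))) (\<lambda>z. ?F z (\<lambda>k. v (\<pi> k)))"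
      using Suc.prems by (intro Suc.IH) auto
    have 2: "leads U (0 - of_nat (xi_count [v (\<pi> p)])) (\<lambda>z. diff_form (s p) z (\<lambda>k. v (\<pi> (p + k))))
        (\<lambda>z. diff_form (l p) z (\<lambda>k. v (\<pi> (p + k))))"
      using leads_dderivs[OF U Suc.prems(1)[of p], of "[v (\<pi> p)]"] Suc.prems(2) by (simp add: diff_form_def)
    \<comment> \<open>Permuting the vectors does not change the number of \<xi>-directions, so all
      summands of the wedge product have the same order and may be added.\<close>
    have "(\<Sum>k<Suc p. xi_count [v k]) = (\<Sum>k<Suc p. xi_count [v (\<pi> k)])"
      using sum.permute[OF \<pi>, of "\<lambda>k. xi_count [v k]"] by (simp only: o_def)
    then have e: "- of_nat (\<Sum>k<Suc p. xi_count [v k])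
        = - of_nat (\<Sum>k<p. xi_count [v (\<pi> k)]) + (0 - of_nat (xi_count [v (\<pi> p)]) :: complex)" by simp
    show "leads U (- of_nat (\<Sum>k<Suc p. xi_count [v k]))
        (prd (\<lambda>w. ?A w (\<lambda>k. v (\<pi> k))) (\<lambda>w. diff_form (s p) w (\<lambda>k. v (\<pi> (p + k)))))
        (\<lambda>z. ?F z (\<lambda>k. v (\<pi> k)) * diff_form (l p) z (\<lambda>k. v (\<pi> (p + k))))"
      unfolding e by (rule prd[OF 1 2])
  qed
  then have "leads U (- of_nat (\<Sum>k<Suc p. xi_count [v k])) (\<lambda>z. 1 / (fact p * fact 1) *
      (\<Sum>\<pi> | \<pi> permutes {..<p + 1}. of_int (sign \<pi>) * prd (\<lambda>w. ?A w (\<lambda>k. v (\<pi> k))) (\<lambda>w. diff_form (s p) w (\<lambda>k. v (\<pi> (p + k)))) z))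
      (\<lambda>z. 1 / (fact p * fact 1) *
      (\<Sum>\<pi> | \<pi> permutes {..<p + 1}. of_int (sign \<pi>) * (?F z (\<lambda>k. v (\<pi> k)) * diff_form (l p) z (\<lambda>k. v (\<pi> (p + k))))))"
    by (intro leads_cmult[OF U, of _ _ _ "1 / (fact p * fact 1)"] leads_sum[OF U]) (simp only: mem_Collect_eq Suc_eq_plus1)
  then show ?case unfolding iterated_wedge.simps wedge_with_alt pw_mult_apply .
qed

section \<open>Products of thetas and sums over permutations\<close>

lemma leads_mult_prod:
  assumes U: "open U" and a: "leads U m a f" and F: "\<And>j. j \<in> {1..n::nat} \<Longrightarrow> leads U (- 1) (F j) (G j)"
  shows "leads U (m - of_nat n) (\<lambda>z. a z * (\<Prod>j = 1..n. F j z)) (\<lambda>z. f z * (\<Prod>j = 1..n. G j z))"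
  using F
proof (induction n)
  case (Suc n)
  then have "leads U (m - of_nat n + - 1) (\<lambda>z. (a z * (\<Prod>j = 1..n. F j z)) * F (Suc n) z)
      (\<lambda>z. (f z * (\<Prod>j = 1..n. G j z)) * G (Suc n) z)"
    by (intro leads_mult[OF U]) auto
  then show ?case by (simp add: mult.assoc algebra_simps)
qed (use a in simp)

text \<open>The antisymmetrisation permutes \<open>{1..N}\<close>, while matrix indices start at 0;
  conjugation with \<open>Suc\<close> preserves the sign.\<close>

lemma sum_permutes_shift:
  fixes M :: "nat \<Rightarrow> nat \<Rightarrow> complex"
  shows "(\<Sum>\<tau> | \<tau> permutes {1..N}. of_int (sign \<tau>) * (\<Prod>k = 1..N. M k (\<tau> k)))
    = (\<Sum>\<pi> | \<pi> permutes {..<N}. of_int (sign \<pi>) * (\<Prod>k<N. M (Suc k) (Suc (\<pi> k))))"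
proof (rule sym, rule sum.reindex_bij_witness[of _ "map_permutation {1..N} (\<lambda>k. k - 1)" "map_permutation {..<N} Suc"])
  have b: "bij_betw Suc {..<N} {1..N}" and b': "bij_betw (\<lambda>k. k - 1) {1..N} {..<N}"
    by (rule bij_betwI[of _ _ _ "\<lambda>k. k - 1"], auto) (rule bij_betwI[of _ _ _ Suc], auto)
  note inj = bij_betw_imp_inj_on[OF b] and inj' = bij_betw_imp_inj_on[OF b']
  fix \<pi> :: "nat \<Rightarrow> nat" assume "\<pi> \<in> {\<pi>. \<pi> permutes {..<N}}"
  then have \<pi>: "\<pi> permutes {..<N}" by simp
  show "map_permutation {1..N} (\<lambda>k. k - 1) (map_permutation {..<N} Suc \<pi>) = \<pi>"
    using map_permutation_compose[OF b inj'] \<pi> by (simp add: o_def)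
  show "map_permutation {..<N} Suc \<pi> \<in> {\<tau>. \<tau> permutes {1..N}}"
    using map_permutation_permutes[OF b \<pi>] by simp
  have m: "map_permutation {..<N} Suc \<pi> (Suc k) = Suc (\<pi> k)" if "k < N" for k
    using that inv_into_f_f[OF inj, of k] by (simp add: map_permutation_def restrict_id_def)
  have "(\<Prod>k = 1..N. M k (map_permutation {..<N} Suc \<pi> k)) = (\<Prod>k<N. M (Suc k) (map_permutation {..<N} Suc \<pi> (Suc k)))"
    by (rule prod.reindex_bij_betw[OF b, symmetric])
  also have "\<dots> = (\<Prod>k<N. M (Suc k) (Suc (\<pi> k)))" using m by (intro prod.cong) auto
  finally show "of_int (sign (map_permutation {..<N} Suc \<pi>)) * (\<Prod>k = 1..N. M k (map_permutation {..<N} Suc \<pi> k))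
      = of_int (sign \<pi>) * (\<Prod>k<N. M (Suc k) (Suc (\<pi> k)))"
    using sign_map_permutation[OF inj \<pi>] by simp
next
  have b: "bij_betw Suc {..<N} {1..N}" and b': "bij_betw (\<lambda>k. k - 1) {1..N} {..<N}"
    by (rule bij_betwI[of _ _ _ "\<lambda>k. k - 1"], auto) (rule bij_betwI[of _ _ _ Suc], auto)
  fix \<tau> :: "nat \<Rightarrow> nat" assume "\<tau> \<in> {\<tau>. \<tau> permutes {1..N}}"
  then have \<tau>: "\<tau> permutes {1..N}" by simp
  have "map_permutation {..<N} Suc (map_permutation {1..N} (\<lambda>k. k - 1) \<tau>) = map_permutation {1..N} (Suc \<circ> (\<lambda>k. k - 1)) \<tau>"
    using map_permutation_compose[OF b' bij_betw_imp_inj_on[OF b]] .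
  also have "\<dots> = map_permutation {1..N} id \<tau>"
    by (rule map_permutation_cong[OF _ \<tau>]) (auto simp: inj_on_def)
  also have "\<dots> = \<tau>" by (rule map_permutation_id[OF \<tau>])
  finally show "map_permutation {..<N} Suc (map_permutation {1..N} (\<lambda>k. k - 1) \<tau>) = \<tau>" .
  show "map_permutation {1..N} (\<lambda>k. k - 1) \<tau> \<in> {\<pi>. \<pi> permutes {..<N}}"
    using map_permutation_permutes[OF b' \<tau>] by simp
qed

lemma prod_pairs:
  fixes f :: "nat \<Rightarrow> 'a::comm_monoid_mult"
  shows "(\<Prod>j = 1..n. f (2 * j - 1) * f (2 * j)) = (\<Prod>k = 1..2 * n. f k)"
  by (induction n) (simp_all add: mult.assoc)

lemma cotangent_frame_Basis: "cotangent_frame k \<in> (Basis :: 'n::finite tpoint set)"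
  by (simp add: cotangent_frame_def std_frame_def Basis_tpoint)

text \<open>This count is the loss of order of the coefficient of the wedge product, and it places
  the leading component at the degree which the residue extracts.\<close>

lemma cotangent_frame_xi_count:
  "(\<Sum>k<2 * CARD('n). xi_count [cotangent_frame k :: 'n::finite tpoint]) = CARD('n)"
proof -
  have "(\<Sum>k<2 * CARD('n). xi_count [cotangent_frame k :: 'n tpoint])
      = (\<Sum>k<2 * CARD('n). if k < CARD('n) then 0 else 1)"
    by (intro sum.cong refl) (simp add: cotangent_frame_def std_frame_def)
  also have "\<dots> = (\<Sum>k\<in>{CARD('n)..<2 * CARD('n)}. 1)"
    by (intro sum.mono_neutral_cong_right) auto
  finally show ?thesis by simp
qed

lemma DIM_tpoint: "DIM('n::finite tpoint) = 2 * CARD('n)"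
  by simp

lemma res_0:
  assumes "open U" "cutoff U \<psi>" "leads U (- of_nat CARD('n)) f (g :: 'n::finite symb)" "\<And>z. z \<in> cotangent0 U \<Longrightarrow> g z = 0"
  shows "res \<psi> U f = 0"
  using sum_res_leads_0[of U \<psi> "{()}" "\<lambda>_. f" "\<lambda>_. g" "\<lambda>_. 1"] assms by simp

theorem theorem3:
  fixes U :: "(real ^ 'n::finite) set"
    and \<psi> :: "'n symb"
    and \<sigma> :: "nat \<Rightarrow> 'n symb"
  assumes "open U"
    and "cutoff U \<psi>"
    and "\<And>k. k \<le> 2 * CARD('n) \<Longrightarrow> \<sigma> k \<in> CS_com \<psi> U 0"
  shows "chi_res \<psi> U \<sigma> =
      res_form \<psi> U
        (iterated_wedge pw_mult (\<sigma> 0) (\<lambda>k. diff_form (\<sigma> (Suc k))) (2 * CARD('n)))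
    \<and> res_form \<psi> U
        (iterated_wedge pw_mult (\<sigma> 0) (\<lambda>k. diff_form (\<sigma> (Suc k))) (2 * CARD('n))) =
      cosphere_integral U (interior_product liouville
        (iterated_wedge pw_mult (leading_symbol \<psi> U (\<sigma> 0))
          (\<lambda>k. diff_form (leading_symbol \<psi> U (\<sigma> (Suc k)))) (2 * CARD('n))))
    \<and> cosphere_integral U (interior_product liouville
        (iterated_wedge pw_mult (leading_symbol \<psi> U (\<sigma> 0))
          (\<lambda>k. diff_form (leading_symbol \<psi> U (\<sigma> (Suc k)))) (2 * CARD('n)))) =
      (- \<i>) ^ CARD('n) / fact CARD('n) *
        antisymmetrise (2 * CARD('n))
          (\<lambda>s. res \<psi> U (\<lambda>z. s 0 z *
             (\<Prod>j = 1..CARD('n). theta U (s (2 * j - 1)) (s (2 * j)) z))) \<sigma>"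
proof -
  let ?n = "CARD('n)"
  note U = assms(1) and \<psi> = assms(2)
  define L where "L = (\<lambda>k. leading_symbol \<psi> U (\<sigma> k))"
  define \<Lambda> where "\<Lambda> = (\<lambda>z k. frechet_derivative (L k) (at z))"
  have lead: "leads U 0 (\<sigma> k) (L k)" if "k \<le> 2 * ?n" for k
    unfolding L_def by (rule leads_CS_com[OF U \<psi> assms(3)[OF that]])
  have det0: "Determinant.det (Matrix.mat (2 * ?n) (2 * ?n) (\<lambda>(k, i). \<Lambda> z (Suc k) (v i))) = 0"
    if z: "z \<in> cotangent0 U" for z v
  proof -
    obtain x \<xi> where x: "z = (x, \<xi>)" "x \<in> U" "\<xi> \<noteq> 0" using z unfolding cotangent0_def by auto
    have "Determinant.det (Matrix.mat DIM('n tpoint) DIM('n tpoint) (\<lambda>(k, i). \<Lambda> z (Suc k) (v i))) = 0"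
    proof (rule det_common_kernel[where X = "(0, \<xi>)"])
      fix k assume "k < DIM('n tpoint)"
      then have h: "pos_homogeneous U 0 (L (Suc k))"
        using leads_homogeneous[OF U lead[of "Suc k"]] by simp
      then have "L (Suc k) differentiable (at z)"
        using smooth_on_differentiable[OF _ z] unfolding pos_homogeneous_def by blast
      then show "linear (\<Lambda> z (Suc k))"
        unfolding \<Lambda>_def using frechet_derivative_works has_derivative_linear by blast
      show "\<Lambda> z (Suc k) (0, \<xi>) = 0"
        unfolding \<Lambda>_def x(1) by (rule frechet_derivative_radial[OF h x(2,3)])
    qed (use x in \<open>simp add: zero_prod_def\<close>)
    then show ?thesis by (simp only: DIM_tpoint)
  qed
  have wedge0: "iterated_wedge pw_mult (L 0) (\<lambda>k. diff_form (L (Suc k))) (2 * ?n) z v = 0"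
    if "z \<in> cotangent0 U" for z v
    by (subst iterated_wedge_det[where L = "\<lambda>k z. \<Lambda> z (Suc k)"])
       (simp_all add: diff_form_def \<Lambda>_def det0[OF that, unfolded \<Lambda>_def])
  \<comment> \<open>For any product that multiplies leading components the coefficient has the same
    leading symbol, so the left and the pointwise wedge are settled at once.\<close>
  have res0: "res_form \<psi> U (iterated_wedge prd (\<sigma> 0) (\<lambda>k. diff_form (\<sigma> (Suc k))) (2 * ?n)) = 0"
    if prd: "\<And>m n a b f g. leads U m a f \<Longrightarrow> leads U n b g \<Longrightarrow> leads U (m + n) (prd a b) (\<lambda>z. f z * g z)" for prd
  proof -
    have "leads U (- of_nat (\<Sum>k<2 * ?n. xi_count [cotangent_frame k :: 'n tpoint]))
        (\<lambda>z. iterated_wedge prd (\<sigma> 0) (\<lambda>k. diff_form (\<sigma> (Suc k))) (2 * ?n) z cotangent_frame)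
        (\<lambda>z. iterated_wedge pw_mult (L 0) (\<lambda>k. diff_form (L (Suc k))) (2 * ?n) z cotangent_frame)"
      by (rule leads_iterated_wedge[OF U prd]) (auto intro: lead cotangent_frame_Basis)
    then show ?thesis unfolding res_form_def cotangent_frame_xi_count
      by (rule res_0[OF U \<psi>]) (rule wedge0)
  qed
  have "chi_res \<psi> U \<sigma> = 0"
    unfolding chi_res_def by (rule res0) (rule leads_star[OF U])
  moreover have "res_form \<psi> U (iterated_wedge pw_mult (\<sigma> 0) (\<lambda>k. diff_form (\<sigma> (Suc k))) (2 * ?n)) = 0"
    by (rule res0) (unfold pw_mult_def, rule leads_mult[OF U])
  moreover have "cosphere_integral U (interior_product liouville
      (iterated_wedge pw_mult (L 0) (\<lambda>k. diff_form (L (Suc k))) (2 * ?n))) = 0"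
  proof -
    \<comment> \<open>The form itself vanishes at every point of the cosphere bundle, so its
      contraction vanishes whatever frame and orientation sign the integrand uses.\<close>
    have "iterated_wedge pw_mult (L 0) (\<lambda>k. diff_form (L (Suc k))) (2 * ?n) z v = 0"
      if "z \<in> U \<times> sphere 0 1" for z v
      using that by (intro wedge0) (auto simp: cotangent0_def)
    then have *: "interior_product liouville (iterated_wedge pw_mult (L 0) (\<lambda>k. diff_form (L (Suc k))) (2 * ?n)) z v = 0"
      if "z \<in> U \<times> sphere 0 1" for z v
      using that by (simp add: interior_product_def)
    have "indicator (U \<times> sphere 0 1) z *\<^sub>R (c * interior_product liouville
        (iterated_wedge pw_mult (L 0) (\<lambda>k. diff_form (L (Suc k))) (2 * ?n)) z v) = 0" for z c v
      using *[of z v] by (cases "z \<in> U \<times> sphere 0 1") auto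
    then show ?thesis
      unfolding cosphere_integral_def hypersurface_integral_def set_lebesgue_integral_def Let_def
      by (simp only: Bochner_Integration.integral_zero)
  qed
  \<comment> \<open>The signs of the permutations serve as the coefficients in
    \<open>sum_res_leads_0\<close>; the cancellation happens between different permutations.\<close>
  moreover have "antisymmetrise (2 * ?n) (\<lambda>s. res \<psi> U (\<lambda>z. s 0 z *
      (\<Prod>j = 1..?n. theta U (s (2 * j - 1)) (s (2 * j)) z))) \<sigma> = 0"
    unfolding antisymmetrise_def
  proof (rule sum_res_leads_0[OF U \<psi>])
    let ?g = "\<lambda>\<tau> z. L (\<tau> 0) z * (\<Prod>j = 1..?n. - \<i> * (\<Sum>e\<in>Basis.
      dderivs [(0, e)] (L (\<tau> (2 * j - 1))) z * dderivs [(e, 0)] (L (\<tau> (2 * j))) z))"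
    fix \<tau> :: "nat \<Rightarrow> nat" assume "\<tau> \<in> {\<tau>. \<tau> permutes {1..2 * ?n}}"
    then have \<tau>: "\<tau> permutes {1..2 * ?n}" by simp
    have \<tau>le: "\<tau> k \<le> 2 * ?n" if "k \<le> 2 * ?n" for k
    proof (cases "k \<in> {1..2 * ?n}")
      case True then show ?thesis using permutes_in_image[OF \<tau>, of k] by simp
    next
      case False then show ?thesis using \<tau> that by (simp add: permutes_def)
    qed
    have "leads U (0 - of_nat ?n) (\<lambda>z. \<sigma> (\<tau> 0) z * (\<Prod>j = 1..?n. theta U (\<sigma> (\<tau> (2 * j - 1))) (\<sigma> (\<tau> (2 * j))) z)) (?g \<tau>)"
    proof (rule leads_mult_prod[OF U lead])
      fix j assume j: "j \<in> {1..?n}"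
      have "leads U (0 + 0 - 1) (theta U (\<sigma> (\<tau> (2 * j - 1))) (\<sigma> (\<tau> (2 * j))))
        (\<lambda>z. - \<i> * (\<Sum>e\<in>Basis. dderivs [(0, e)] (L (\<tau> (2 * j - 1))) z * dderivs [(e, 0)] (L (\<tau> (2 * j))) z))"
        using j by (intro leads_theta[OF U] lead \<tau>le) auto
      then show "leads U (- 1) (theta U (\<sigma> (\<tau> (2 * j - 1))) (\<sigma> (\<tau> (2 * j))))
        (\<lambda>z. - \<i> * (\<Sum>e\<in>Basis. dderivs [(0, e)] (L (\<tau> (2 * j - 1))) z * dderivs [(e, 0)] (L (\<tau> (2 * j))) z))"
        by simp
    qed (use \<tau>le in simp)
    then show "leads U (- of_nat ?n) (\<lambda>z. \<sigma> (\<tau> 0) z * (\<Prod>j = 1..?n. theta U (\<sigma> (\<tau> (2 * j - 1))) (\<sigma> (\<tau> (2 * j))) z)) (?g \<tau>)"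
      by simp
  next
    fix z assume z: "z \<in> cotangent0 U"
    let ?\<Phi> = "PiE {1..?n} (\<lambda>_. Basis :: (real ^ 'n) set)"
    \<comment> \<open>A choice \<phi> of one basis vector for each of the n sums over
      \<open>Basis\<close> determines 2n tangent vectors: the odd slot \<open>2 * j - 1\<close>
      carries the \<xi>-direction \<open>\<phi> j\<close>, the even slot \<open>2 * j\<close> the
      x-direction \<open>\<phi> j\<close>.\<close>
    define w :: "(nat \<Rightarrow> real ^ 'n) \<Rightarrow> nat \<Rightarrow> 'n tpoint" where
      "w = (\<lambda>\<phi> k. if odd k then (0, \<phi> (Suc k div 2)) else (\<phi> (k div 2), 0))"
    have expand: "(\<Prod>j = 1..?n. - \<i> * (\<Sum>e\<in>Basis. dderivs [(0, e)] (L (\<tau> (2 * j - 1))) z * dderivs [(e, 0)] (L (\<tau> (2 * j))) z))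
        = (- \<i>) ^ ?n * (\<Sum>\<phi>\<in>?\<Phi>. \<Prod>k = 1..2 * ?n. \<Lambda> z (\<tau> k) (w \<phi> k))" for \<tau>
    proof -
      have "(\<Prod>j = 1..?n. \<Sum>e\<in>Basis. dderivs [(0, e)] (L (\<tau> (2 * j - 1))) z * dderivs [(e, 0)] (L (\<tau> (2 * j))) z)
          = (\<Sum>\<phi>\<in>?\<Phi>. \<Prod>j = 1..?n. dderivs [(0, \<phi> j)] (L (\<tau> (2 * j - 1))) z * dderivs [(\<phi> j, 0)] (L (\<tau> (2 * j))) z)"
        by (rule prod_sum_PiE) auto
      also have "\<dots> = (\<Sum>\<phi>\<in>?\<Phi>. \<Prod>k = 1..2 * ?n. \<Lambda> z (\<tau> k) (w \<phi> k))"
        unfolding prod_pairs[of "\<lambda>k. \<Lambda> z (\<tau> k) (w _ k)", symmetric]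
        by (intro sum.cong prod.cong refl) (auto simp: w_def \<Lambda>_def)
      finally show ?thesis by (simp only: prod.distrib prod_constant card_atLeastAtMost diff_Suc_1 Suc_eq_plus1[symmetric])
    qed
    have \<tau>0: "\<tau> 0 = 0" if "\<tau> permutes {1..2 * ?n}" for \<tau> using that by (simp add: permutes_def)
    \<comment> \<open>For a fixed choice \<phi> the vectors stay in place and the symbols are
      permuted, which gives the determinant of the values of the differentials on
      \<open>w \<phi>\<close>.\<close>
    have zero: "(\<Sum>\<tau> | \<tau> permutes {1..2 * ?n}. of_int (sign \<tau>) * (\<Prod>k = 1..2 * ?n. \<Lambda> z (\<tau> k) (w \<phi> k))) = 0" for \<phi>
      unfolding sum_permutes_shift[where N = "2 * ?n" and M = "\<lambda>k i. \<Lambda> z i (w \<phi> k)"]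
        det_mat_columns[where n = "2 * ?n" and M = "\<lambda>k i. \<Lambda> z (Suc k) (w \<phi> (Suc i))"] by (rule det0[OF z])
    have "(\<Sum>\<tau> | \<tau> permutes {1..2 * ?n}. of_int (sign \<tau>) * (L (\<tau> 0) z * (\<Prod>j = 1..?n. - \<i> * (\<Sum>e\<in>Basis.
          dderivs [(0, e)] (L (\<tau> (2 * j - 1))) z * dderivs [(e, 0)] (L (\<tau> (2 * j))) z))))
        = (\<Sum>\<tau> | \<tau> permutes {1..2 * ?n}. \<Sum>\<phi>\<in>?\<Phi>. (L 0 z * (- \<i>) ^ ?n) * (of_int (sign \<tau>) * (\<Prod>k = 1..2 * ?n. \<Lambda> z (\<tau> k) (w \<phi> k))))"
      unfolding expand
    proof (rule sum.cong[OF refl])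
      fix \<tau> :: "nat \<Rightarrow> nat" assume "\<tau> \<in> {\<tau>. \<tau> permutes {1..2 * ?n}}"
      then have "L (\<tau> 0) z = L 0 z" using \<tau>0[of \<tau>] by simp
      then show "of_int (sign \<tau>) * (L (\<tau> 0) z * ((- \<i>) ^ ?n * (\<Sum>\<phi>\<in>?\<Phi>. \<Prod>k = 1..2 * ?n. \<Lambda> z (\<tau> k) (w \<phi> k))))
          = (\<Sum>\<phi>\<in>?\<Phi>. (L 0 z * (- \<i>) ^ ?n) * (of_int (sign \<tau>) * (\<Prod>k = 1..2 * ?n. \<Lambda> z (\<tau> k) (w \<phi> k))))"
        unfolding sum_distrib_left[symmetric] by (simp only: mult_ac)
    qed
    also have "\<dots> = (\<Sum>\<phi>\<in>?\<Phi>. (L 0 z * (- \<i>) ^ ?n) * (\<Sum>\<tau> | \<tau> permutes {1..2 * ?n}. of_int (sign \<tau>) * (\<Prod>k = 1..2 * ?n. \<Lambda> z (\<tau> k) (w \<phi> k))))"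
      by (subst sum.swap) (simp only: sum_distrib_left)
    also have "\<dots> = 0" unfolding zero by simp
    finally show "(\<Sum>\<tau> | \<tau> permutes {1..2 * ?n}. of_int (sign \<tau>) * (L (\<tau> 0) z * (\<Prod>j = 1..?n. - \<i> * (\<Sum>e\<in>Basis.
          dderivs [(0, e)] (L (\<tau> (2 * j - 1))) z * dderivs [(e, 0)] (L (\<tau> (2 * j))) z)))) = 0" .
  qed
  ultimately show ?thesis unfolding L_def by simp
qed

end
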